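(* Let $\lambda^\bullet,\mu^\bullet$ be equivariant random measures on $M$ with intensities $1$ and $\beta\in(0,1]$ respectively, with $\lambda^\bullet$ absolutely continuous and with finite optimal mean transportation cost $\mathfrak c_{e,\infty}<\infty$. Then there exists at most one optimal semicoupling of $\lambda^\bullet$ and $\mu^\bullet$.
   Context: Setting. $(M,d,m)$ is a complete connected smooth non-compact Riemannian manifold with Riemannian distance $d$ and Riemannian volume $m$. $G$ is a group of isometries of $M$ acting properly discontinuously (for every $x\in M$ and compact $K\subset M$, $gx\in K$ for only finitely many $g\in G$), cocompactly ($M/G$ is compact) and freely ($gx=x$ for one $x$ implies $g=\mathrm{id}$). A fundamental region is a measurable set $F\subset M$ with $\bigcup_{g\in G}gF=M$ and $F\cap gF=\emptyset$ for $g\ne \mathrm{id}$. $B_0$ is a fixed fundamental region: the interior of a Dirichlet region $D=\{x: d(x,p)\le d(x,gp)\ \forall g\in G\}$ ($p\in M$ fixed) together with a measurable selection of exactly one point from each orbit meeting $\partial D$. The volume is scaled so that $m(B_0)=1$. Random measures. $(\Omega,\mathfrak A,\mathbb P)$ is a probability space, $\Omega$ a compact metric space with completed Borel $\sigma$-field $\mathfrak A$, with a measurable flow $(\theta_g)_{g\in G}$ on $\Omega$ ($(\omega,g)\mapsto\theta_g\omega$ measurable, $\theta_{\mathrm{id}}=\mathrm{id}$, $\theta_g\circ\theta_h=\theta_{gh}$); $\mathbb P$ is stationary: $\mathbb P\circ\theta_g=\mathbb P$ for all $g$. $\mathcal M(X)$ is the set of Radon measures on $X$ with the vague topology. A random measure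 on $M$ is a measurable map $\lambda^\bullet:\Omega\to\mathcal M(M)$; it is equivariant if $\lambda^{\theta_g\omega}(gA)=\lambda^\omega(A)$ for all $g,\omega$ and Borel $A$; it is absolutely continuous if $\lambda^\omega\ll m$ for a.e. $\omega$. A random measure $q^\bullet:\Omega\to\mathcal M(M\times M)$ is equivariant if $q^{\theta_g\omega}(gA\times gB)=q^\omega(A\times B)$ for all $g,\omega$ and Borel $A,B$. The intensity of $\lambda^\bullet$ is $\mathbb E[\lambda^\bullet(B_0)]$. $\lambda^\bullet,\mu^\bullet$ are almost surely not the zero measure. Random measures are identified if they agree $\mathbb P$-a.s. Cost and optimality. $c(x,y)=\vartheta(d(x,y))$ with $\vartheta:\mathbb R_+\to\mathbb R_+$ continuous, strictly increasing, $\vartheta(0)=0$, $\lim_{r\to\infty}\vartheta(r)=\infty$. It is assumed that for any two compactly supported probability measures $\lambda\ll m$ and $\mu$ on $M$ the optimal transport problem (minimize $\int c\,dq$ over couplings) has a unique solution, and it is induced by a measurable map. A semicoupling of measures $\lambda,\mu$ on $M$ is a measure $q$ on $M\times M$ with $(\pi_1)_*q\le\lambda$, $(\pi_2)_*q=\mu$. A semicoupling of $\lambda^\bullet,\mu^\bullet$ is a random measure $q^\bullet$ on $M\times M$ such that $q^\omega$ is a semicoupling of $\lambda^\omega,\mu^\omega$ for a.e. $\omega$; $\Pi_{es}(\lambda^\bullet,\mu^\bullet)$ is the set of equivariant ones. The mean transportation cost is $\mathfrak C(q^\bullet)=\sup_{B\in\mathrm{Adm}(M)}\frac1{m(B)}\mathbb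 E[\int_{M\times B}c(x,y)\,q^\bullet(dx,dy)]$, where $\mathrm{Adm}(M)$ is the collection of Borel sets $\bigcup_{g\in I}gF$ with $I\subset G$, $1\le|I|<\infty$, $F$ a fundamental region. $\mathfrak c_{e,\infty}=\inf_{\Pi_{es}(\lambda^\bullet,\mu^\bullet)}\mathfrak C$. A semicoupling is optimal if it is equivariant and $\mathfrak C(q^\bullet)=\mathfrak c_{e,\infty}$. *)

theory Defs
  imports "HOL-Probability.Probability_Measure"
begin

section \<open>Riemannian manifolds\<close>

text \<open>A manifold is the whole of a metric type, so that its topology is the metric one and the
  Riemannian distance is \<^const>\<open>dist\<close>. A chart is a pair of an open domain and a coordinate map,
  which is meaningful on that domain only. The dimension is the cardinality of the index type.\<close>

primrec Ck_on :: "nat \<Rightarrow> 'a::real_normed_vector set \<Rightarrow> ('a \<Rightarrow> 'b::real_normed_vector) \<Rightarrow> bool" where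
  "Ck_on 0 S f \<longleftrightarrow> continuous_on S f"
| "Ck_on (Suc k) S f \<longleftrightarrow>
     (\<forall>x\<in>S. f differentiable (at x)) \<and> (\<forall>v. Ck_on k S (\<lambda>x. frechet_derivative f (at x) v))"

definition smooth_on :: "'a::real_normed_vector set \<Rightarrow> ('a \<Rightarrow> 'b::real_normed_vector) \<Rightarrow> bool" where
  "smooth_on S f \<longleftrightarrow> (\<forall>k. Ck_on k S f)"

type_synonym ('m, 'n) chart = "'m set \<times> ('m \<Rightarrow> real ^ 'n)"

definition smooth_atlas :: "('m::topological_space, 'n::finite) chart set \<Rightarrow> bool" where
  "smooth_atlas \<A> \<longleftrightarrow>
     (\<Union>(U, \<phi>)\<in>\<A>. U) = UNIV \<and>
     (\<forall>(U, \<phi>)\<in>\<A>. open U \<and> open (\<phi> ` U) \<and> homeomorphism U (\<phi> ` U) \<phi> (inv_into U \<phi>)) \<and>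
     (\<forall>(U, \<phi>)\<in>\<A>. \<forall>(V, \<psi>)\<in>\<A>. smooth_on (\<phi> ` (U \<inter> V)) (\<psi> \<circ> inv_into U \<phi>))"

text \<open>Tangent vectors at \<open>x\<close> are represented by their coordinates in a chart around \<open>x\<close>, so a metric
  tensor is a family of bilinear forms \<open>g (U, \<phi>) x\<close>, for \<open>x \<in> U\<close>, that transforms under coordinate
  changes as a covariant 2-tensor.\<close>

type_synonym ('m, 'n) metric_tensor = "('m, 'n) chart \<Rightarrow> 'm \<Rightarrow> real ^ 'n \<Rightarrow> real ^ 'n \<Rightarrow> real"

definition riemannian_metric ::
    "('m::topological_space, 'n::finite) chart set \<Rightarrow> ('m, 'n) metric_tensor \<Rightarrow> bool" where
  "riemannian_metric \<A> g \<longleftrightarrow>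
     (\<forall>(U, \<phi>)\<in>\<A>. \<forall>x\<in>U. bilinear (g (U, \<phi>) x) \<and>
        (\<forall>v w. g (U, \<phi>) x v w = g (U, \<phi>) x w v) \<and>
        (\<forall>v. v \<noteq> 0 \<longrightarrow> g (U, \<phi>) x v v > 0)) \<and>
     (\<forall>(U, \<phi>)\<in>\<A>. \<forall>v w. smooth_on (\<phi> ` U) (\<lambda>y. g (U, \<phi>) (inv_into U \<phi> y) v w)) \<and>
     (\<forall>(U, \<phi>)\<in>\<A>. \<forall>(V, \<psi>)\<in>\<A>. \<forall>x\<in>U \<inter> V.
        let D = frechet_derivative (\<psi> \<circ> inv_into U \<phi>) (at (\<phi> x))
        in \<forall>v w. g (U, \<phi>) x v w = g (V, \<psi>) x (D v) (D w))"

definition piecewise_C1_curve ::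
    "('m::topological_space, 'n::finite) chart set \<Rightarrow> (real \<Rightarrow> 'm) \<Rightarrow> bool" where
  "piecewise_C1_curve \<A> \<gamma> \<longleftrightarrow> continuous_on {0..1} \<gamma> \<and>
     (\<exists>S. finite S \<and> (\<forall>(U, \<phi>)\<in>\<A>. (\<phi> \<circ> \<gamma>) C1_differentiable_on ({t\<in>{0..1}. \<gamma> t \<in> U} - S)))"

text \<open>The chart chosen to compute the speed is irrelevant, by the transformation rule of the
  metric tensor.\<close>

definition speed ::
    "('m, 'n::finite) chart set \<Rightarrow> ('m, 'n) metric_tensor \<Rightarrow> (real \<Rightarrow> 'm) \<Rightarrow> real \<Rightarrow> real" where
  "speed \<A> g \<gamma> t =
     (let (U, \<phi>) = (SOME c. c \<in> \<A> \<and> \<gamma> t \<in> fst c);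
          v = vector_derivative (\<phi> \<circ> \<gamma>) (at t)
      in sqrt (g (U, \<phi>) (\<gamma> t) v v))"

definition curve_length ::
    "('m, 'n::finite) chart set \<Rightarrow> ('m, 'n) metric_tensor \<Rightarrow> (real \<Rightarrow> 'm) \<Rightarrow> ennreal" where
  "curve_length \<A> g \<gamma> = (\<integral>\<^sup>+t\<in>{0..1}. ennreal (speed \<A> g \<gamma> t) \<partial>lborel)"

definition riemannian_distance ::
    "('m::topological_space, 'n::finite) chart set \<Rightarrow> ('m, 'n) metric_tensor \<Rightarrow> 'm \<Rightarrow> 'm \<Rightarrow> ennreal" where
  "riemannian_distance \<A> g x y =
     (INF \<gamma>\<in>{\<gamma>. piecewise_C1_curve \<A> \<gamma> \<and> \<gamma> 0 = x \<and> \<gamma> 1 = y}. curve_length \<A> g \<gamma>)"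

definition riemannian_volume ::
    "('m::topological_space, 'n::finite) chart set \<Rightarrow> ('m, 'n) metric_tensor \<Rightarrow> 'm measure \<Rightarrow> bool" where
  "riemannian_volume \<A> g vol \<longleftrightarrow> sets vol = sets borel \<and>
     (\<forall>(U, \<phi>)\<in>\<A>. \<forall>A\<in>sets borel. A \<subseteq> U \<longrightarrow>
        emeasure vol A =
          (\<integral>\<^sup>+y\<in>\<phi> ` A. ennreal (sqrt (det
             (\<chi> i j. g (U, \<phi>) (inv_into U \<phi> y) (axis i 1) (axis j 1)))) \<partial>lborel))"

definition riemannian_manifold ::
    "('m::{metric_space, second_countable_topology}, 'n::finite) chart set \<Rightarrow>
     ('m, 'n) metric_tensor \<Rightarrow> bool" where
  "riemannian_manifold \<A> g \<longleftrightarrow> smooth_atlas \<A> \<and> riemannian_metric \<A> g \<and>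
     (\<forall>x y. ennreal (dist x y) = riemannian_distance \<A> g x y)"

definition smooth_map :: "('m::topological_space, 'n::finite) chart set \<Rightarrow> ('m \<Rightarrow> 'm) \<Rightarrow> bool" where
  "smooth_map \<A> f \<longleftrightarrow> continuous_on UNIV f \<and>
     (\<forall>(U, \<phi>)\<in>\<A>. \<forall>(V, \<psi>)\<in>\<A>. smooth_on (\<phi> ` (U \<inter> f -` V)) (\<psi> \<circ> f \<circ> inv_into U \<phi>))"

definition isometry ::
    "('m::topological_space, 'n::finite) chart set \<Rightarrow> ('m, 'n) metric_tensor \<Rightarrow> ('m \<Rightarrow> 'm) \<Rightarrow> bool" where
  "isometry \<A> g f \<longleftrightarrow> bij f \<and> smooth_map \<A> f \<and> smooth_map \<A> (inv f) \<and>
     (\<forall>(U, \<phi>)\<in>\<A>. \<forall>(V, \<psi>)\<in>\<A>. \<forall>x\<in>U \<inter> f -` V.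
        let D = frechet_derivative (\<psi> \<circ> f \<circ> inv_into U \<phi>) (at (\<phi> x))
        in \<forall>v w. g (V, \<psi>) (f x) (D v) (D w) = g (U, \<phi>) x v w)"


section \<open>Group actions and fundamental regions\<close>

definition isometry_group ::
    "('m::topological_space, 'n::finite) chart set \<Rightarrow> ('m, 'n) metric_tensor \<Rightarrow> ('m \<Rightarrow> 'm) set \<Rightarrow> bool" where
  "isometry_group \<A> g G \<longleftrightarrow> (\<forall>f\<in>G. isometry \<A> g f) \<and> id \<in> G \<and>
     (\<forall>f\<in>G. \<forall>h\<in>G. f \<circ> h \<in> G) \<and> (\<forall>f\<in>G. inv f \<in> G)"

definition properly_discontinuous :: "('m::topological_space \<Rightarrow> 'm) set \<Rightarrow> bool" where
  "properly_discontinuous G \<longleftrightarrow> (\<forall>x K. compact K \<longrightarrow> finite {f\<in>G. f x \<in> K})"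

definition acts_freely :: "('m \<Rightarrow> 'm) set \<Rightarrow> bool" where
  "acts_freely G \<longleftrightarrow> (\<forall>f\<in>G. \<forall>x. f x = x \<longrightarrow> f = id)"

definition orbit :: "('m \<Rightarrow> 'm) set \<Rightarrow> 'm \<Rightarrow> 'm set" where
  "orbit G x = (\<lambda>f. f x) ` G"

definition orbit_space :: "('m::topological_space \<Rightarrow> 'm) set \<Rightarrow> 'm set topology" where
  "orbit_space G = topology (\<lambda>W. W \<subseteq> range (orbit G) \<and> open (orbit G -` W))"

lemma openin_orbit_space:
  "openin (orbit_space G) W \<longleftrightarrow> W \<subseteq> range (orbit G) \<and> open (orbit G -` W)"
proof -
  have "istopology (\<lambda>W. W \<subseteq> range (orbit G) \<and> open (orbit G -` W))"
    unfolding istopology_def by (auto simp: vimage_Union)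
  then show ?thesis
    by (simp add: orbit_space_def topology_inverse')
qed

lemma topspace_orbit_space: "topspace (orbit_space G) = range (orbit G)"
proof -
  have "orbit G -` range (orbit G) = UNIV"
    by auto
  then show ?thesis
    by (auto simp: topspace_def openin_orbit_space)
qed

definition cocompact :: "('m::topological_space \<Rightarrow> 'm) set \<Rightarrow> bool" where
  "cocompact G \<longleftrightarrow> compact_space (orbit_space G)"

definition fundamental_region :: "('m::topological_space \<Rightarrow> 'm) set \<Rightarrow> 'm set \<Rightarrow> bool" where
  "fundamental_region G F \<longleftrightarrow> F \<in> sets borel \<and> (\<Union>f\<in>G. f ` F) = UNIV \<and>
     (\<forall>f\<in>G. f \<noteq> id \<longrightarrow> F \<inter> f ` F = {})"

definition dirichlet_region :: "('m::metric_space \<Rightarrow> 'm) set \<Rightarrow> 'm \<Rightarrow> 'm set" where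
  "dirichlet_region G p = {x. \<forall>f\<in>G. dist x p \<le> dist x (f p)}"

definition dirichlet_fundamental_region ::
    "('m::metric_space \<Rightarrow> 'm) set \<Rightarrow> 'm \<Rightarrow> 'm set \<Rightarrow> bool" where
  "dirichlet_fundamental_region G p B \<longleftrightarrow> fundamental_region G B \<and>
     (\<exists>S\<in>sets borel. S \<subseteq> frontier (dirichlet_region G p) \<and>
        (\<forall>x\<in>frontier (dirichlet_region G p). \<exists>!y. y \<in> S \<and> y \<in> orbit G x) \<and>
        B = interior (dirichlet_region G p) \<union> S)"

definition admissible_sets :: "('m::topological_space \<Rightarrow> 'm) set \<Rightarrow> 'm set set" where
  "admissible_sets G =
     {\<Union>f\<in>I. f ` F | I F. I \<subseteq> G \<and> finite I \<and> I \<noteq> {} \<and> fundamental_region G F}"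


section \<open>Random measures\<close>

definition radon_measures :: "'a::topological_space measure set" where
  "radon_measures = {\<nu>. sets \<nu> = sets borel \<and> (\<forall>K. compact K \<longrightarrow> emeasure \<nu> K < \<infinity>) \<and>
     (\<forall>A\<in>sets borel. emeasure \<nu> A = (SUP K\<in>{K. compact K \<and> K \<subseteq> A}. emeasure \<nu> K))}"

definition vague_topology :: "'a::topological_space measure topology" where
  "vague_topology = topology_generated_by
     {{\<nu>\<in>radon_measures. (\<integral>x. f x \<partial>\<nu>) \<in> U} | (f :: 'a \<Rightarrow> real) U.
        continuous_on UNIV f \<and> compact (closure {x. f x \<noteq> 0}) \<and> open U}"

definition vague_borel :: "'a::topological_space measure measure" where
  "vague_borel = sigma radon_measures {W. openin vague_topology W}"

lemma topspace_vague_topology: "topspace (vague_topology :: 'a::topological_space measure topology) = radon_measures"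
proof
  show "topspace (vague_topology :: 'a measure topology) \<subseteq> radon_measures"
    unfolding vague_topology_def topology_generated_by_topspace by auto
  have "radon_measures \<in> {{\<nu>\<in>radon_measures. (\<integral>x. f x \<partial>\<nu>) \<in> U} | (f :: 'a \<Rightarrow> real) U.
        continuous_on UNIV f \<and> compact (closure {x. f x \<noteq> 0}) \<and> open U}"
    by (rule CollectI, rule exI[of _ "\<lambda>_. 0"], rule exI[of _ UNIV]) auto
  then show "radon_measures \<subseteq> topspace (vague_topology :: 'a measure topology)"
    unfolding vague_topology_def topology_generated_by_topspace by blast
qed

definition random_measure :: "'w measure \<Rightarrow> ('w \<Rightarrow> 'a::topological_space measure) \<Rightarrow> bool" where
  "random_measure P \<nu> \<longleftrightarrow> \<nu> \<in> P \<rightarrow>\<^sub>M vague_borel"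

text \<open>A group acting properly discontinuously is discrete, hence carries the discrete
  sigma-algebra.\<close>

definition measurable_flow :: "'w measure \<Rightarrow> ('m \<Rightarrow> 'm) set \<Rightarrow> (('m \<Rightarrow> 'm) \<Rightarrow> 'w \<Rightarrow> 'w) \<Rightarrow> bool" where
  "measurable_flow P G \<theta> \<longleftrightarrow>
     (\<lambda>(\<omega>, f). \<theta> f \<omega>) \<in> P \<Otimes>\<^sub>M count_space G \<rightarrow>\<^sub>M P \<and>
     \<theta> id = id \<and> (\<forall>f\<in>G. \<forall>h\<in>G. \<theta> f \<circ> \<theta> h = \<theta> (f \<circ> h))"

definition stationary :: "'w measure \<Rightarrow> ('m \<Rightarrow> 'm) set \<Rightarrow> (('m \<Rightarrow> 'm) \<Rightarrow> 'w \<Rightarrow> 'w) \<Rightarrow> bool" where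
  "stationary P G \<theta> \<longleftrightarrow> (\<forall>f\<in>G. distr P P (\<theta> f) = P)"

definition equivariant ::
    "('m::topological_space \<Rightarrow> 'm) set \<Rightarrow> (('m \<Rightarrow> 'm) \<Rightarrow> 'w \<Rightarrow> 'w) \<Rightarrow> ('w \<Rightarrow> 'm measure) \<Rightarrow> bool" where
  "equivariant G \<theta> \<nu> \<longleftrightarrow>
     (\<forall>f\<in>G. \<forall>\<omega>. \<forall>A\<in>sets borel. emeasure (\<nu> (\<theta> f \<omega>)) (f ` A) = emeasure (\<nu> \<omega>) A)"

definition equivariant2 ::
    "('m::topological_space \<Rightarrow> 'm) set \<Rightarrow> (('m \<Rightarrow> 'm) \<Rightarrow> 'w \<Rightarrow> 'w) \<Rightarrow> ('w \<Rightarrow> ('m \<times> 'm) measure) \<Rightarrow> bool" where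
  "equivariant2 G \<theta> q \<longleftrightarrow>
     (\<forall>f\<in>G. \<forall>\<omega>. \<forall>A\<in>sets borel. \<forall>B\<in>sets borel.
        emeasure (q (\<theta> f \<omega>)) (f ` A \<times> f ` B) = emeasure (q \<omega>) (A \<times> B))"

definition intensity :: "'w measure \<Rightarrow> 'm set \<Rightarrow> ('w \<Rightarrow> 'm measure) \<Rightarrow> ennreal" where
  "intensity P B \<nu> = (\<integral>\<^sup>+\<omega>. emeasure (\<nu> \<omega>) B \<partial>P)"


section \<open>Optimal transport\<close>

definition cost :: "(real \<Rightarrow> real) \<Rightarrow> 'm::metric_space \<times> 'm \<Rightarrow> ennreal" where
  "cost \<rho> = (\<lambda>(x, y). ennreal (\<rho> (dist x y)))"

definition coupling ::
    "'m::metric_space measure \<Rightarrow> 'm measure \<Rightarrow> ('m \<times> 'm) measure \<Rightarrow> bool" where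
  "coupling \<nu>\<^sub>1 \<nu>\<^sub>2 q \<longleftrightarrow> sets q = sets borel \<and> distr q borel fst = \<nu>\<^sub>1 \<and> distr q borel snd = \<nu>\<^sub>2"

definition optimal_coupling ::
    "(real \<Rightarrow> real) \<Rightarrow> 'm::metric_space measure \<Rightarrow> 'm measure \<Rightarrow> ('m \<times> 'm) measure \<Rightarrow> bool" where
  "optimal_coupling \<rho> \<nu>\<^sub>1 \<nu>\<^sub>2 q \<longleftrightarrow> coupling \<nu>\<^sub>1 \<nu>\<^sub>2 q \<and>
     (\<forall>q'. coupling \<nu>\<^sub>1 \<nu>\<^sub>2 q' \<longrightarrow> (\<integral>\<^sup>+z. cost \<rho> z \<partial>q) \<le> (\<integral>\<^sup>+z. cost \<rho> z \<partial>q'))"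

definition compactly_supported_prob :: "'m::topological_space measure \<Rightarrow> bool" where
  "compactly_supported_prob \<nu> \<longleftrightarrow> prob_space \<nu> \<and> sets \<nu> = sets borel \<and>
     (\<exists>K. compact K \<and> emeasure \<nu> (- K) = 0)"

definition unique_optimal_transport :: "(real \<Rightarrow> real) \<Rightarrow> 'm::metric_space measure \<Rightarrow> bool" where
  "unique_optimal_transport \<rho> m \<longleftrightarrow>
     (\<forall>\<nu>\<^sub>1 \<nu>\<^sub>2. compactly_supported_prob \<nu>\<^sub>1 \<and> compactly_supported_prob \<nu>\<^sub>2 \<and>
        absolutely_continuous m \<nu>\<^sub>1 \<longrightarrow>
        (\<exists>!q. optimal_coupling \<rho> \<nu>\<^sub>1 \<nu>\<^sub>2 q) \<and>
        (\<forall>q. optimal_coupling \<rho> \<nu>\<^sub>1 \<nu>\<^sub>2 q \<longrightarrow>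
           (\<exists>T\<in>borel \<rightarrow>\<^sub>M borel. q = distr \<nu>\<^sub>1 borel (\<lambda>x. (x, T x)))))"

definition semicoupling ::
    "'m::metric_space measure \<Rightarrow> 'm measure \<Rightarrow> ('m \<times> 'm) measure \<Rightarrow> bool" where
  "semicoupling \<nu>\<^sub>1 \<nu>\<^sub>2 q \<longleftrightarrow> sets q = sets borel \<and>
     (\<forall>A\<in>sets borel. emeasure (distr q borel fst) A \<le> emeasure \<nu>\<^sub>1 A) \<and>
     distr q borel snd = \<nu>\<^sub>2"

definition random_semicoupling ::
    "'w measure \<Rightarrow> ('w \<Rightarrow> 'm::metric_space measure) \<Rightarrow> ('w \<Rightarrow> 'm measure) \<Rightarrow>
     ('w \<Rightarrow> ('m \<times> 'm) measure) \<Rightarrow> bool" where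
  "random_semicoupling P \<nu>\<^sub>1 \<nu>\<^sub>2 q \<longleftrightarrow> random_measure P q \<and>
     (AE \<omega> in P. semicoupling (\<nu>\<^sub>1 \<omega>) (\<nu>\<^sub>2 \<omega>) (q \<omega>))"

definition equivariant_semicouplings ::
    "('m::metric_space \<Rightarrow> 'm) set \<Rightarrow> 'w measure \<Rightarrow> (('m \<Rightarrow> 'm) \<Rightarrow> 'w \<Rightarrow> 'w) \<Rightarrow>
     ('w \<Rightarrow> 'm measure) \<Rightarrow> ('w \<Rightarrow> 'm measure) \<Rightarrow> ('w \<Rightarrow> ('m \<times> 'm) measure) set" where
  "equivariant_semicouplings G P \<theta> \<nu>\<^sub>1 \<nu>\<^sub>2 =
     {q. random_semicoupling P \<nu>\<^sub>1 \<nu>\<^sub>2 q \<and> equivariant2 G \<theta> q}"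

definition mean_cost ::
    "('m::metric_space \<Rightarrow> 'm) set \<Rightarrow> 'm measure \<Rightarrow> (real \<Rightarrow> real) \<Rightarrow> 'w measure \<Rightarrow>
     ('w \<Rightarrow> ('m \<times> 'm) measure) \<Rightarrow> ennreal" where
  "mean_cost G m \<rho> P q =
     (SUP B\<in>admissible_sets G.
        (\<integral>\<^sup>+\<omega>. (\<integral>\<^sup>+z\<in>UNIV \<times> B. cost \<rho> z \<partial>q \<omega>) \<partial>P) / emeasure m B)"

definition optimal_mean_cost ::
    "('m::metric_space \<Rightarrow> 'm) set \<Rightarrow> 'm measure \<Rightarrow> (real \<Rightarrow> real) \<Rightarrow> 'w measure \<Rightarrow>
     (('m \<Rightarrow> 'm) \<Rightarrow> 'w \<Rightarrow> 'w) \<Rightarrow> ('w \<Rightarrow> 'm measure) \<Rightarrow> ('w \<Rightarrow> 'm measure) \<Rightarrow> ennreal" where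
  "optimal_mean_cost G m \<rho> P \<theta> \<nu>\<^sub>1 \<nu>\<^sub>2 =
     (INF q\<in>equivariant_semicouplings G P \<theta> \<nu>\<^sub>1 \<nu>\<^sub>2. mean_cost G m \<rho> P q)"

definition optimal_semicoupling ::
    "('m::metric_space \<Rightarrow> 'm) set \<Rightarrow> 'm measure \<Rightarrow> (real \<Rightarrow> real) \<Rightarrow> 'w measure \<Rightarrow>
     (('m \<Rightarrow> 'm) \<Rightarrow> 'w \<Rightarrow> 'w) \<Rightarrow> ('w \<Rightarrow> 'm measure) \<Rightarrow> ('w \<Rightarrow> 'm measure) \<Rightarrow>
     ('w \<Rightarrow> ('m \<times> 'm) measure) \<Rightarrow> bool" where
  "optimal_semicoupling G m \<rho> P \<theta> \<nu>\<^sub>1 \<nu>\<^sub>2 q \<longleftrightarrow>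
     q \<in> equivariant_semicouplings G P \<theta> \<nu>\<^sub>1 \<nu>\<^sub>2 \<and>
     mean_cost G m \<rho> P q = optimal_mean_cost G m \<rho> P \<theta> \<nu>\<^sub>1 \<nu>\<^sub>2"

end

theory Submission
  imports Defs
begin

text \<open>
  Why an optimal semicoupling is unique. By stationarity, the mean cost of an equivariant semicoupling
  \<open>q\<close> is, up to a factor that does not depend on \<open>q\<close>, the expected cost of the mass that arrives in one
  fundamental region (\<open>mean_cost_factor\<close>). This cost is affine in \<open>q\<close>, so the average \<open>q\<close> of two optimal
  semicouplings \<open>q1\<close>, \<open>q2\<close> is optimal (\<open>average_minimal\<close>), and it is enough to read off from the structure
  of \<open>q\<close> that \<open>q1 = q2\<close>.

  An optimal \<open>q\<close> admits no local improvement. Suppose that, with positive probability, finitely many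
  small rectangles are charged by \<open>q\<close> and their targets can be served at smaller total cost, from the
  same sources in another order or from a source that \<open>q\<close> leaves unused. Then exchange a little mass
  there and, simultaneously, in all translates under the group (\<open>exchange\<close>, \<open>transfer\<close>). The new kernel
  is an equivariant semicoupling, and by unfolding (\<open>nn_integral_per\<close>) it costs strictly less. As
  countably many configurations of rectangles suffice, almost every realization of \<open>q\<close> has a
  cyclically monotone support (\<open>minimal_cyclically_monotone\<close>), and no unused source is closer to a
  target than the sources that serve it (\<open>minimal_unused_farther\<close>).

  The rest concerns a single realization. A cyclically monotone coupling with compact support is
  optimal, by duality (\<open>cyclically_monotone_optimal\<close>). The hypothesis on transport problems
  therefore puts \<open>q\<close> on a graph over each compact set (\<open>local_graph\<close>), and the density of \<open>q1\<close> with
  respect to \<open>q\<close> is a function of the source alone. Where this density exceeds 1, the source is not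
  exhausted by \<open>q\<close>. Such a source is a closest one to its target among all unused sources. Consider
  the coupling that sends half of each such source to its target and leaves the other half where it
  is. It is optimal, because the distance to the unused sources is a dual potential for it. By the
  hypothesis it is induced by a map, so target and source agree (\<open>unused_sources_stay\<close>). Hence neither
  \<open>q1\<close> nor \<open>q2\<close> exceeds their average off the diagonal, and they agree there. On the diagonal they
  agree because their second marginals do (\<open>semicoupling_unique\<close>).

  The Riemannian structure provides the local compactness of \<open>M\<close> (\<open>smooth_atlas_locally_compact\<close>) and the
  invariance of the distance, hence of the cost, under the group (\<open>isometry_dist\<close>).
\<close>

section \<open>Locally compact separable metric spaces\<close>

lemma locally_compact_cball:
  fixes x :: "'a::metric_space"
  assumes "locally compact (UNIV :: 'a set)"
  obtains e where "e > 0" "compact (cball x e)"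
proof -
  obtain U K where U: "open U" "x \<in> U" "U \<subseteq> K" "compact K"
    using assms unfolding locally_def
    by (metis UNIV_I open_UNIV openin_subtopology_refl subtopology_UNIV open_openin)
  then obtain e where e: "e > 0" "cball x e \<subseteq> U"
    using open_contains_cball by blast
  have "compact (cball x e)"
    using compact_Int_closed[OF \<open>compact K\<close>, of "cball x e"] e U(3)
    by (metis closed_cball inf.absorb2 order_trans)
  with e that show thesis by blast
qed

lemma locally_compact_UNIV_I:
  assumes "\<And>x::'a::metric_space. \<exists>U K. open U \<and> x \<in> U \<and> U \<subseteq> K \<and> compact K"
  shows "locally compact (UNIV :: 'a set)"
proof (rule locallyI)
  fix w and x :: 'a assume w: "openin (top_of_set UNIV) w" "x \<in> w"
  then have "open w" by simp
  obtain U K where U: "open U" "x \<in> U" "U \<subseteq> K" "compact K" using assms by blast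
  then have "open (U \<inter> w)" "x \<in> U \<inter> w" using \<open>open w\<close> w by auto
  then obtain e where e: "e > 0" "cball x e \<subseteq> U \<inter> w"
    using open_contains_cball by blast
  have "compact (K \<inter> cball x e)" using U(4) by (simp add: compact_Int_closed)
  moreover have "K \<inter> cball x e = cball x e" using e U by auto
  ultimately have "compact (cball x e)" by simp
  then show "\<exists>u v. openin (top_of_set UNIV) u \<and> compact v \<and> x \<in> u \<and> u \<subseteq> v \<and> v \<subseteq> w"
    using e by (intro exI[of _ "ball x e"] exI[of _ "cball x e"]) auto
qed

lemma locally_compact_Times:
  assumes "locally compact (UNIV :: 'a::metric_space set)" "locally compact (UNIV :: 'b::metric_space set)"
  shows "locally compact (UNIV :: ('a \<times> 'b) set)"
proof (rule locally_compact_UNIV_I)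
  fix z :: "'a \<times> 'b"
  obtain d where d: "d > 0" "compact (cball (fst z) d)" by (rule locally_compact_cball[OF assms(1)])
  obtain e where e: "e > 0" "compact (cball (snd z) e)" by (rule locally_compact_cball[OF assms(2)])
  show "\<exists>U K. open U \<and> z \<in> U \<and> U \<subseteq> K \<and> compact K"
    using d e by (intro exI[of _ "ball (fst z) d \<times> ball (snd z) e"] exI[of _ "cball (fst z) d \<times> cball (snd z) e"])
      (auto simp: open_Times compact_Times mem_Times_iff)
qed

lemma countable_base:
  obtains \<B> :: "'a::second_countable_topology set set"
  where "countable \<B>" "\<And>U. U \<in> \<B> \<Longrightarrow> open U" "\<And>x W. open W \<Longrightarrow> x \<in> W \<Longrightarrow> \<exists>U\<in>\<B>. x \<in> U \<and> U \<subseteq> W"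
  using ex_countable_basis by (metis topological_basis_def topological_basisE)

text \<open>Discarding the large members of a base leaves a base, whenever every point has a small
  neighbourhood and smallness is inherited by subsets.\<close>

lemma countable_base_small:
  assumes "\<And>x::'a::second_countable_topology. \<exists>U. open U \<and> x \<in> U \<and> S U"
    and "\<And>U V. S U \<Longrightarrow> V \<subseteq> U \<Longrightarrow> S V"
  obtains \<B> where "countable \<B>" "\<And>U. U \<in> \<B> \<Longrightarrow> open U" "\<And>U. U \<in> \<B> \<Longrightarrow> S U"
    "\<And>(x::'a) W. open W \<Longrightarrow> x \<in> W \<Longrightarrow> \<exists>U\<in>\<B>. x \<in> U \<and> U \<subseteq> W"
proof -
  obtain \<B> :: "'a set set" where B: "countable \<B>" "\<And>U. U \<in> \<B> \<Longrightarrow> open U"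
    "\<And>x W. open W \<Longrightarrow> x \<in> W \<Longrightarrow> \<exists>U\<in>\<B>. x \<in> U \<and> U \<subseteq> W" using countable_base by metis
  show thesis
  proof (rule that[of "{U\<in>\<B>. S U}"])
    fix x W assume W: "open W" "(x::'a) \<in> W"
    obtain V where V: "open V" "x \<in> V" "S V" using assms(1) by blast
    then obtain U where "U \<in> \<B>" "x \<in> U" "U \<subseteq> V \<inter> W" using B(3)[of "V \<inter> W" x] W by auto
    then show "\<exists>U\<in>{U \<in> \<B>. S U}. x \<in> U \<and> U \<subseteq> W" using assms(2)[OF V(3)] by auto
  qed (use B in auto)
qed

lemma compact_closure_subset:
  fixes U :: "'a::t2_space set"
  assumes "compact (closure U)" "V \<subseteq> U" shows "compact (closure V)"
  using assms closure_mono[OF assms(2)] compact_Int_closed[OF assms(1) closed_closure[of V]]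
  by (simp add: inf.absorb2)

lemma open_rel_compact_nbhd:
  fixes x :: "'a::metric_space"
  assumes "locally compact (UNIV :: 'a set)"
  shows "\<exists>U. open U \<and> x \<in> U \<and> compact (closure U)"
proof -
  obtain e where e: "e > 0" "compact (cball x e)" by (rule locally_compact_cball[OF assms])
  have "compact (closure (ball x e))"
    by (rule compact_closure_subset[of "cball x e"]) (use e in auto)
  with e show ?thesis by (intro exI[of _ "ball x e"]) auto
qed

lemma open_exhaustion:
  assumes "locally compact (UNIV :: 'a::{metric_space, second_countable_topology} set)"
  obtains V :: "nat \<Rightarrow> 'a::{metric_space, second_countable_topology} set" where "\<And>n. open (V n)" "\<And>n. compact (closure (V n))" "incseq V"
    "(\<Union>n. V n) = UNIV" "\<And>K. compact K \<Longrightarrow> \<exists>n. K \<subseteq> V n"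
proof -
  obtain \<B> :: "'a set set" where B: "countable \<B>" "\<And>U. U \<in> \<B> \<Longrightarrow> open U" "\<And>U. U \<in> \<B> \<Longrightarrow> compact (closure U)"
    "\<And>x W. open W \<Longrightarrow> x \<in> W \<Longrightarrow> \<exists>U\<in>\<B>. x \<in> U \<and> U \<subseteq> W"
  proof (rule countable_base_small[of "\<lambda>U::'a set. compact (closure U)"])
    show "\<exists>U. open U \<and> x \<in> U \<and> compact (closure U)" for x :: 'a
      by (rule open_rel_compact_nbhd[OF assms])
  qed (auto intro: compact_closure_subset)
  have ne: "\<B> \<noteq> {}" using B(4)[of UNIV] by auto
  define V where "V n = (\<Union>i<n. from_nat_into \<B> i)" for n
  have inB: "from_nat_into \<B> i \<in> \<B>" for i using ne by (rule from_nat_into)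
  have op: "open (V n)" for n unfolding V_def using inB B(2) by (intro open_UN) auto
  have inc: "incseq V" unfolding V_def by (intro incseq_SucI) (auto simp: lessThan_Suc)
  have un: "(\<Union>n. V n) = UNIV"
  proof -
    have "x \<in> (\<Union>n. V n)" for x
    proof -
      obtain U where U: "U \<in> \<B>" "x \<in> U" using B(4)[of UNIV x] by auto
      then obtain i where "from_nat_into \<B> i = U" using B(1) by (metis from_nat_into_surj)
      then have "x \<in> V (Suc i)" using U unfolding V_def by auto
      then show ?thesis by blast
    qed
    then show ?thesis by blast
  qed
  show thesis
  proof (rule that[of V])
    show "compact (closure (V n))" for n
      by (induction n) (auto simp: V_def lessThan_Suc closure_Un inB B(3) compact_Un)
    show "\<exists>n. K \<subseteq> V n" if K: "compact K" for K
    proof -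
      obtain C where C: "finite C" "K \<subseteq> (\<Union>n\<in>C. V n)"
        using compactE_image[OF K, of UNIV V] op un by auto
      have "V n \<subseteq> V (Max (insert 0 C))" if "n \<in> C" for n
        using incseqD[OF inc] C(1) that by simp
      then show ?thesis using C(2) by blast
    qed
  qed (use op inc un in auto)
qed

section \<open>Radon measures\<close>

text \<open>On a metric space every finite Borel measure is closed inner and open outer regular: the sets
  that are approximated in both ways form a sigma-algebra, and a closed set is the limit of its
  open neighbourhoods.\<close>

lemma finite_measure_closed_open_regular:
  fixes M :: "'a::metric_space measure"
  assumes sb: "sets M = sets borel" and fin: "finite_measure M" and A: "A \<in> sets borel" and e: "e > (0::real)"
  shows "\<exists>C U. closed C \<and> open U \<and> C \<subseteq> A \<and> A \<subseteq> U \<and> measure M (U - C) < e"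
proof -
  interpret finite_measure M by fact
  have [measurable]: "open U \<Longrightarrow> U \<in> sets M" "closed U \<Longrightarrow> U \<in> sets M" for U
    using sb by auto
  have "A \<in> sigma_sets UNIV {S. closed S}" using A unfolding borel_eq_closed
    by (simp add: sets_measure_of)
  then show ?thesis using e
  proof (induction arbitrary: e)
    case (Basic C)
    then have C: "closed C" by simp
    show ?case
    proof (cases "C = {}")
      case True then show ?thesis using Basic by (intro exI[of _ "{}"]) auto
    next
      case False
      define U where "U n = {x. infdist x C < 1 / Suc n}" for n :: nat
      have op: "open (U n)" for n unfolding U_def
        by (intro open_Collect_less continuous_intros)
      have lim: "(\<lambda>n. measure M (U n)) \<longlonglongrightarrow> measure M (\<Inter>n. U n)"
      proof (rule finite_Lim_measure_decseq)
        show "range U \<subseteq> sets M" using op by auto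
        show "decseq U" unfolding U_def decseq_def
          by (auto intro: less_le_trans simp: frac_le)
      qed
      have "(\<Inter>n. U n) = C"
      proof (intro equalityI subsetI)
        fix x assume x: "x \<in> (\<Inter>n. U n)"
        have "infdist x C \<le> 0"
        proof (rule field_le_epsilon)
          fix d :: real assume "d > 0"
          then obtain n where "1 / Suc n < d" using nat_approx_posE by blast
          then show "infdist x C \<le> 0 + d" using x by (auto simp: U_def dest: spec[of _ n])
        qed
        then show "x \<in> C" using in_closed_iff_infdist_zero[OF C False] infdist_nonneg[of x C] by auto
      next
        fix x assume "x \<in> C" then show "x \<in> (\<Inter>n. U n)" by (auto simp: U_def)
      qed
      with lim have "(\<lambda>n. measure M (U n)) \<longlonglongrightarrow> measure M C" by simp
      then have "\<forall>\<^sub>F n in sequentially. measure M (U n) < measure M C + e"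
        by (rule order_tendstoD) (use Basic in auto)
      then obtain n where n: "measure M (U n) < measure M C + e"
        by (meson eventually_sequentially order_refl)
      have "C \<subseteq> U n" by (auto simp: U_def)
      then have "measure M (U n - C) = measure M (U n) - measure M C"
        using op C by (intro finite_measure_Diff) auto
      then show ?thesis using n op[of n] C \<open>C \<subseteq> U n\<close> by (intro exI[of _ C] exI[of _ "U n"]) auto
    qed
  next
    case Empty then show ?case by (intro exI[of _ "{}"]) auto
  next
    case (Compl A)
    obtain C U where "closed C" "open U" "C \<subseteq> A" "A \<subseteq> U" "measure M (U - C) < e"
      using Compl.IH[OF Compl.prems] by metis
    moreover have "(- C) - (- U) = U - C" by auto
    ultimately show ?case by (intro exI[of _ "- U"] exI[of _ "- C"]) (auto simp: Compl_eq_Diff_UNIV[symmetric])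
  next
    case (Union A)
    have "\<forall>n. \<exists>C U. closed C \<and> open U \<and> C \<subseteq> A n \<and> A n \<subseteq> U \<and> measure M (U - C) < e / 4 * (1/2)^n"
      using Union by (intro allI Union.IH) auto
    then obtain C U where CU: "\<And>n. closed (C n)" "\<And>n. open (U n)" "\<And>n. C n \<subseteq> A n" "\<And>n. A n \<subseteq> U n"
      "\<And>n. measure M (U n - C n) < e / 4 * (1/2)^n" by metis
    define D where "D N = (\<Union>n\<le>N. C n)" for N :: nat
    have clD: "closed (D N)" for N unfolding D_def using CU by auto
    have "(\<lambda>N. measure M (D N)) \<longlonglongrightarrow> measure M (\<Union>N. D N)"
      by (rule finite_Lim_measure_incseq) (use clD in \<open>auto simp: D_def incseq_def\<close>, fastforce)
    then have "\<forall>\<^sub>F N in sequentially. measure M (\<Union>N. D N) - e/2 < measure M (D N)"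
      by (rule order_tendstoD) (use Union in auto)
    then obtain N where N: "measure M (\<Union>N. D N) - e/2 < measure M (D N)"
      by (meson eventually_sequentially order_refl)
    have DC: "(\<Union>N. D N) = (\<Union>n. C n)" unfolding D_def by auto
    have [measurable]: "C n \<in> sets M" "U n \<in> sets M" for n using CU by auto
    have s: "(\<lambda>n. e / 4 * (1/2)^n) sums (e/4 * 2)" using power_half_series
      by (intro sums_mult) (use geometric_sums[of "1/2::real"] in auto)
    have sm: "summable (\<lambda>n. measure M (U n - C n))"
      by (rule summable_comparison_test'[OF sums_summable[OF s], of 0]) (use CU(5) in \<open>auto intro: less_imp_le\<close>)
    have "measure M ((\<Union>n. U n) - (\<Union>n. C n)) \<le> measure M (\<Union>n. U n - C n)"
      by (intro finite_measure_mono) auto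
    also have "\<dots> \<le> (\<Sum>n. measure M (U n - C n))"
      by (rule finite_measure_subadditive_countably) (use sm in auto)
    also have "\<dots> \<le> (\<Sum>n. e / 4 * (1/2)^n)"
      by (rule suminf_le) (use CU(5) sm sums_summable[OF s] in \<open>auto intro: less_imp_le\<close>)
    also have "\<dots> = e / 2" using sums_unique[OF s] by simp
    finally have 1: "measure M ((\<Union>n. U n) - (\<Union>n. C n)) \<le> e / 2" .
    have 2: "measure M ((\<Union>n. C n) - D N) < e / 2"
      using N clD[of N] unfolding DC by (subst finite_measure_Diff) (auto simp: D_def)
    have "measure M ((\<Union>n. U n) - D N) \<le> measure M (((\<Union>n. U n) - (\<Union>n. C n)) \<union> ((\<Union>n. C n) - D N))"
      by (intro finite_measure_mono) (use clD[of N] in auto)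
    also have "\<dots> \<le> measure M ((\<Union>n. U n) - (\<Union>n. C n)) + measure M ((\<Union>n. C n) - D N)"
      by (intro measure_Un_le) (use clD[of N] in auto)
    finally have "measure M ((\<Union>n. U n) - D N) < e" using 1 2 by simp
    then show ?case using clD[of N] CU
      by (intro exI[of _ "D N"] exI[of _ "\<Union>n. U n"]) (auto simp: D_def; blast)
  qed
qed

text \<open>Inner regularity by closed sets becomes inner regularity by compact sets after intersecting with
  the members of a compact exhaustion.\<close>

lemma locally_finite_imp_radon:
  fixes M :: "'a::{metric_space, second_countable_topology} measure"
  assumes lc: "locally compact (UNIV :: 'a set)" and sb: "sets M = sets borel"
    and fin: "\<And>K. compact K \<Longrightarrow> emeasure M K < \<infinity>"
  shows "M \<in> radon_measures"
proof -
  obtain V :: "nat \<Rightarrow> 'a set" where V: "\<And>n. open (V n)" "\<And>n. compact (closure (V n))" "incseq V"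
    "(\<Union>n. V n) = UNIV" using open_exhaustion[OF lc] by metis
  have "emeasure M A = (SUP K\<in>{K. compact K \<and> K \<subseteq> A}. emeasure M K)" if A: "A \<in> sets borel" for A
  proof (rule antisym)
    show "(SUP K\<in>{K. compact K \<and> K \<subseteq> A}. emeasure M K) \<le> emeasure M A"
      by (rule SUP_least) (use A sb in \<open>auto intro!: emeasure_mono\<close>)
    have "emeasure M A = (SUP n. emeasure M (A \<inter> closure (V n)))"
    proof (subst SUP_emeasure_incseq)
      show "range (\<lambda>n. A \<inter> closure (V n)) \<subseteq> sets M"
        unfolding sb by (intro image_subsetI sets.Int borel_closed closed_closure A)
      show "incseq (\<lambda>n. A \<inter> closure (V n))"
        unfolding incseq_def using closure_mono[OF incseqD[OF V(3)]] by (intro allI impI Int_mono) auto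
      have "(\<Union>n. V n) \<subseteq> (\<Union>n. closure (V n))"
        by (intro UN_mono closure_subset) auto
      then have "(\<Union>n. A \<inter> closure (V n)) = A" using V(4) by auto
      then show "emeasure M A = emeasure M (\<Union>n. A \<inter> closure (V n))" by simp
    qed
    also have "\<dots> \<le> (SUP K\<in>{K. compact K \<and> K \<subseteq> A}. emeasure M K)"
    proof (rule SUP_least)
      fix n
      define K where "K = closure (V n)"
      have K: "compact K" "closed K" "K \<in> sets borel" using V(2) by (auto simp: K_def)
      define N where "N = density M (indicator K)"
      have N: "emeasure N B = emeasure M (B \<inter> K)" if "B \<in> sets borel" for B
        using that K(3) unfolding N_def sb[symmetric]
        by (subst emeasure_density) (auto simp: Int_commute indicator_inter_arith[symmetric])
      have "emeasure M K < \<infinity>" using K fin by auto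
      then have finN: "finite_measure N"
        by (intro finite_measureI) (use N[of UNIV] sb in \<open>auto simp: N_def sets_eq_imp_space_eq[OF sb]\<close>)
      interpret N: finite_measure N by fact
      show "emeasure M (A \<inter> closure (V n)) \<le> (SUP K\<in>{K. compact K \<and> K \<subseteq> A}. emeasure M K)"
        unfolding K_def[symmetric]
      proof (rule ennreal_le_epsilon)
        fix e :: real assume e: "e > 0"
        have AK: "A \<inter> K \<in> sets borel" using A K by auto
        obtain C U where C: "closed C" "open U" "C \<subseteq> A \<inter> K" "A \<inter> K \<subseteq> U" "measure N (U - C) < e"
          using finite_measure_closed_open_regular[OF _ finN AK e] sb N_def by auto
        have cC: "compact C" using C K by (metis compact_Int_closed inf.absorb2 le_inf_iff)
        have sN: "sets N = sets borel" using sb N_def by auto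
        have "emeasure M (A \<inter> K) = emeasure N (A \<inter> K)" using N[OF AK] by (simp add: Int_assoc)
        also have "\<dots> \<le> emeasure N (C \<union> (U - C))"
          using C by (intro emeasure_mono) (auto simp: sN)
        also have "\<dots> \<le> emeasure N C + emeasure N (U - C)"
          using C by (intro emeasure_subadditive) (auto simp: sN)
        also have "\<dots> \<le> emeasure M C + e"
        proof (rule add_mono)
          show "emeasure N C \<le> emeasure M C"
            using C N[of C] sb by (auto intro!: emeasure_mono)
          show "emeasure N (U - C) \<le> e" using C(5) e
            by (simp add: N.emeasure_eq_measure ennreal_leI)
        qed
        also have "\<dots> \<le> (SUP K\<in>{K. compact K \<and> K \<subseteq> A}. emeasure M K) + e"
          using cC C(3) by (intro add_right_mono SUP_upper) auto
        finally show "emeasure M (A \<inter> K) \<le> (SUP K\<in>{K. compact K \<and> K \<subseteq> A}. emeasure M K) + ennreal e" .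
      qed
    qed
    finally show "emeasure M A \<le> (SUP K\<in>{K. compact K \<and> K \<subseteq> A}. emeasure M K)" .
  qed
  then show ?thesis using sb fin unfolding radon_measures_def by blast
qed

section \<open>Measurability with respect to the vague topology\<close>

definition Cc :: "('a::topological_space \<Rightarrow> real) \<Rightarrow> bool" where
  "Cc f \<longleftrightarrow> continuous_on UNIV f \<and> compact (closure {x. f x \<noteq> 0})"

lemma radon_measure_finite: "M \<in> radon_measures \<Longrightarrow> compact K \<Longrightarrow> emeasure M K < \<infinity>"
  and radon_measure_sets: "M \<in> radon_measures \<Longrightarrow> sets M = sets borel"
  by (auto simp: radon_measures_def)

lemma Cc_integrable:
  fixes f :: "'a::metric_space \<Rightarrow> real"
  assumes "Cc f" "\<nu> \<in> radon_measures" shows "integrable \<nu> f"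
proof -
  define K where "K = closure {x. f x \<noteq> 0}"
  have K: "compact K" "continuous_on K f" using assms continuous_on_subset by (auto simp: Cc_def K_def)
  then obtain B where B: "\<And>x. x \<in> K \<Longrightarrow> norm (f x) \<le> B"
    using compact_imp_bounded[OF compact_continuous_image[OF K(2,1)]] unfolding bounded_iff by auto
  have s: "sets \<nu> = sets borel" using assms by (simp add: radon_measures_def)
  have m: "f \<in> borel_measurable \<nu>" using assms borel_measurable_continuous_onI[of f]
    by (simp add: Cc_def measurable_cong_sets[OF s refl])
  show ?thesis
  proof (rule integrableI_bounded_set[where A=K and B=B])
    show "K \<in> sets \<nu>" unfolding s by (rule borel_compact[OF K(1)])
    show "emeasure \<nu> K < \<infinity>" using assms K by (auto simp: radon_measures_def)
    show "AE x in \<nu>. x \<notin> K \<longrightarrow> f x = 0"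
      using closure_subset[of "{x. f x \<noteq> 0}"] by (auto simp: K_def)
  qed (use m B in auto)
qed

lemma Cc_subset:
  assumes "Cc f" "continuous_on UNIV g" "\<And>x. f x = 0 \<Longrightarrow> g x = (0::real)" shows "Cc (g :: 'a::metric_space \<Rightarrow> real)"
proof -
  have "{x. g x \<noteq> 0} \<subseteq> {x. f x \<noteq> 0}" using assms(3) by auto
  then show ?thesis using assms compact_closure_subset by (auto simp: Cc_def)
qed

lemma openin_vague:
  assumes "Cc f" "open U" shows "openin vague_topology {\<nu>\<in>radon_measures. (\<integral>x. f x \<partial>\<nu>) \<in> U}"
  unfolding vague_topology_def
  by (rule topology_generated_by_Basis) (use assms Cc_def in blast)

lemma space_vague_borel: "space vague_borel = radon_measures"
  and sets_vague_borel: "sets vague_borel = sigma_sets radon_measures {W. openin vague_topology W}"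
proof -
  have "{W. openin vague_topology W} \<subseteq> Pow radon_measures"
    using openin_subset[of vague_topology] by (auto simp: topspace_vague_topology)
  then show "space vague_borel = radon_measures" and
    "sets vague_borel = sigma_sets radon_measures {W. openin vague_topology W}"
    unfolding vague_borel_def by (rule space_measure_of, rule sets_measure_of)
qed

lemma random_measure_integral:
  assumes "random_measure P \<nu>" "Cc f"
  shows "(\<lambda>\<omega>. \<integral>x. f x \<partial>\<nu> \<omega>) \<in> borel_measurable P"
proof (rule borel_measurableI)
  fix U :: "real set" assume "open U"
  then have "{\<nu>\<in>radon_measures. (\<integral>x. f x \<partial>\<nu>) \<in> U} \<in> sets vague_borel"
    using openin_vague[OF assms(2)] by (auto simp: sets_vague_borel)
  then have "\<nu> -` {\<nu>\<in>radon_measures. (\<integral>x. f x \<partial>\<nu>) \<in> U} \<inter> space P \<in> sets P"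
    using assms(1) unfolding random_measure_def by (rule measurable_sets[rotated])
  moreover have "\<nu> -` {\<nu>\<in>radon_measures. (\<integral>x. f x \<partial>\<nu>) \<in> U} \<inter> space P = (\<lambda>\<omega>. \<integral>x. f x \<partial>\<nu> \<omega>) -` U \<inter> space P"
    using measurable_space[of \<nu> P vague_borel] assms(1) by (auto simp: random_measure_def space_vague_borel)
  ultimately show "(\<lambda>\<omega>. \<integral>x. f x \<partial>\<nu> \<omega>) -` U \<inter> space P \<in> sets P" by simp
qed

lemma random_measure_radon:
  assumes "random_measure P \<nu>" "\<omega> \<in> space P" shows "\<nu> \<omega> \<in> radon_measures"
  using assms measurable_space[of \<nu> P vague_borel] by (auto simp: random_measure_def space_vague_borel)

text \<open>Multiples of the distance to the complement, cut off at 1. The distance to the empty set is 0 by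
  convention, so \<open>U = UNIV\<close> is treated separately.\<close>

lemma Cc_increasing_to_indicator:
  fixes U :: "'a::metric_space set"
  assumes "open U" "compact (closure U)"
  obtains f :: "nat \<Rightarrow> 'a \<Rightarrow> real" where "\<forall>n. Cc (f n)" "\<forall>n x. 0 \<le> f n x" "\<forall>n x. f n x \<le> 1"
    "\<forall>n x. f n x \<le> f (Suc n) x" "\<forall>n. \<forall>x\<in>-U. f n x = 0" "\<forall>x\<in>U. \<exists>n. f n x = 1"
proof
  define g where "g x = (if U = UNIV then 1 else infdist x (-U))" for x
  define f where "f n x = min 1 (real n * g x)" for n x
  have g: "continuous_on UNIV g" unfolding g_def by (cases "U = UNIV") (auto intro!: continuous_intros)
  have g0: "g x \<ge> 0" for x by (auto simp: g_def infdist_nonneg)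
  have gU: "x \<in> U \<longleftrightarrow> g x > 0" for x
  proof (cases "U = UNIV")
    case False
    then have "x \<in> -U \<longleftrightarrow> infdist x (-U) = 0" using assms by (intro in_closed_iff_infdist_zero) auto
    then show ?thesis using False infdist_nonneg[of x "-U"] by (auto simp: g_def)
  qed (auto simp: g_def)
  show z: "\<forall>n. \<forall>x\<in>-U. f n x = 0" 
  proof (intro allI ballI)
    fix n x assume "x \<in> -U"
    then have "g x = 0" using gU[of x] g0[of x] by auto
    then show "f n x = 0" by (simp add: f_def)
  qed
  show "\<forall>n. Cc (f n)"
  proof
    fix n
    have "{x. f n x \<noteq> 0} \<subseteq> U" using z by auto
    then have "compact (closure {x. f n x \<noteq> 0})" using assms compact_closure_subset by auto
    moreover have "continuous_on UNIV (f n)" unfolding f_def by (intro continuous_intros g)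
    ultimately show "Cc (f n)" by (simp add: Cc_def)
  qed
  show "\<forall>n x. 0 \<le> f n x" "\<forall>n x. f n x \<le> 1" using g0 by (auto simp: f_def)
  show "\<forall>n x. f n x \<le> f (Suc n) x"
    unfolding f_def by (intro allI min.mono mult_right_mono g0) auto
  show "\<forall>x\<in>U. \<exists>n. f n x = 1"
  proof
    fix x assume "x \<in> U"
    then have "g x > 0" using gU by blast
    then obtain n where "real n * g x > 1" using reals_Archimedean3[of "g x"] by auto
    then show "\<exists>n. f n x = 1" by (intro exI[of _ n]) (simp add: f_def)
  qed
qed

text \<open>A Dynkin argument inside each \<open>V n\<close>: complements require that the total mass is finite.\<close>

lemma emeasure_measurable_from_generator:
  fixes \<nu> :: "'w \<Rightarrow> 'a measure"
  assumes sets: "\<And>\<omega>. \<omega> \<in> space P \<Longrightarrow> sets (\<nu> \<omega>) = sigma_sets \<Omega> E" and E: "E \<subseteq> Pow \<Omega>" "Int_stable E"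
    and m: "\<And>A. A \<in> E \<Longrightarrow> (\<lambda>\<omega>. emeasure (\<nu> \<omega>) A) \<in> borel_measurable P"
    and V: "range V \<subseteq> E" "incseq V" "(\<Union>n::nat. V n) = \<Omega>"
    and fin: "\<And>\<omega> n. \<omega> \<in> space P \<Longrightarrow> emeasure (\<nu> \<omega>) (V n) < \<infinity>"
    and A: "A \<in> sigma_sets \<Omega> E"
  shows "(\<lambda>\<omega>. emeasure (\<nu> \<omega>) A) \<in> borel_measurable P"
proof -
  interpret sigma_algebra \<Omega> "sigma_sets \<Omega> E" by (rule sigma_algebra_sigma_sets) fact
  have VE: "V n \<in> E" for n using V by auto
  have VS: "V n \<in> sigma_sets \<Omega> E" for n using VE by auto
  have 1: "(\<lambda>\<omega>. emeasure (\<nu> \<omega>) (A \<inter> V n)) \<in> borel_measurable P" for n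
    using E(2,1) A
  proof (induction rule: sigma_sets_induct_disjoint)
    case (basic A) then show ?case using m E(2) VE by (auto simp: Int_stable_def)
  next
    case (compl A)
    have "(\<lambda>\<omega>. emeasure (\<nu> \<omega>) (V n) - emeasure (\<nu> \<omega>) (A \<inter> V n)) \<in> borel_measurable P"
      using compl m[OF VE] by auto
    moreover have "emeasure (\<nu> \<omega>) ((\<Omega> - A) \<inter> V n) = emeasure (\<nu> \<omega>) (V n) - emeasure (\<nu> \<omega>) (A \<inter> V n)"
      if "\<omega> \<in> space P" for \<omega>
    proof -
      have "emeasure (\<nu> \<omega>) (A \<inter> V n) \<le> emeasure (\<nu> \<omega>) (V n)"
        using sets[OF that] VS by (intro emeasure_mono) auto
      then have "emeasure (\<nu> \<omega>) (A \<inter> V n) \<noteq> \<infinity>" using fin[OF that, of n] by (auto simp: top_unique)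
      then have "emeasure (\<nu> \<omega>) (V n - A \<inter> V n) = emeasure (\<nu> \<omega>) (V n) - emeasure (\<nu> \<omega>) (A \<inter> V n)"
        using sets[OF that] VS compl by (intro emeasure_Diff) auto
      moreover have "V n - A \<inter> V n = (\<Omega> - A) \<inter> V n" using V by auto
      ultimately show ?thesis by simp
    qed
    ultimately show ?case by (simp cong: measurable_cong)
  next
    case (union A)
    have An: "A i \<inter> V n \<in> sigma_sets \<Omega> E" for i using union(2) VS[of n] by (intro Int) auto
    have "emeasure (\<nu> \<omega>) ((\<Union>i. A i) \<inter> V n) = (\<Sum>i. emeasure (\<nu> \<omega>) (A i \<inter> V n))" if "\<omega> \<in> space P" for \<omega>
    proof -
      have "(\<Sum>i. emeasure (\<nu> \<omega>) (A i \<inter> V n)) = emeasure (\<nu> \<omega>) (\<Union>i. A i \<inter> V n)"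
        using union(1) sets[OF that] An by (intro suminf_emeasure) (auto simp: disjoint_family_on_def)
      moreover have "(\<Union>i. A i) \<inter> V n = (\<Union>i. A i \<inter> V n)" by blast
      ultimately show ?thesis by (simp only:)
    qed
    moreover have "(\<lambda>\<omega>. \<Sum>i. emeasure (\<nu> \<omega>) (A i \<inter> V n)) \<in> borel_measurable P"
      using union by (intro borel_measurable_suminf_order) auto
    ultimately show ?case by (simp cong: measurable_cong)
  qed auto
  have "emeasure (\<nu> \<omega>) A = (SUP n. emeasure (\<nu> \<omega>) (A \<inter> V n))" if "\<omega> \<in> space P" for \<omega>
  proof -
    have "(SUP n. emeasure (\<nu> \<omega>) (A \<inter> V n)) = emeasure (\<nu> \<omega>) (\<Union>n. A \<inter> V n)"
    proof (rule SUP_emeasure_incseq)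
      show "range (\<lambda>n. A \<inter> V n) \<subseteq> sets (\<nu> \<omega>)" using sets[OF that] VS A by auto
      show "incseq (\<lambda>n. A \<inter> V n)" using V(2) unfolding incseq_def by blast
    qed
    moreover have "(\<Union>n. A \<inter> V n) = A" using V(3) sets_into_space[OF A] by auto
    ultimately show ?thesis by simp
  qed
  moreover have "(\<lambda>\<omega>. SUP n. emeasure (\<nu> \<omega>) (A \<inter> V n)) \<in> borel_measurable P"
    using 1 by (intro borel_measurable_SUP) auto
  ultimately show ?thesis by (simp cong: measurable_cong)
qed

text \<open>The indicator of a relatively compact open set is an increasing limit of test functions, and
  these sets are stable under intersection and generate the Borel sets.\<close>

lemma random_measure_emeasure:
  fixes \<nu> :: "'w \<Rightarrow> 'a::{metric_space, second_countable_topology} measure"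
  assumes lc: "locally compact (UNIV :: 'a set)" and \<nu>: "random_measure P \<nu>" and A: "A \<in> sets borel"
  shows "(\<lambda>\<omega>. emeasure (\<nu> \<omega>) A) \<in> borel_measurable P"
proof -
  obtain V :: "nat \<Rightarrow> 'a set" where V: "\<And>n. open (V n)" "\<And>n. compact (closure (V n))" "incseq V"
    "(\<Union>n. V n) = UNIV" "\<And>K. compact K \<Longrightarrow> \<exists>n. K \<subseteq> V n" using open_exhaustion[OF lc] by metis
  define E where "E = {U::'a set. open U \<and> compact (closure U)}"
  have eq: "sets borel = sigma_sets (UNIV :: 'a set) E"
  proof
    show "sigma_sets UNIV E \<subseteq> sets borel"
      by (rule sets.sigma_sets_subset[of E borel, simplified]) (auto simp: E_def)
    have "U \<in> sigma_sets UNIV E" if "open U" for U :: "'a set"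
    proof -
      have "(\<Union>n. U \<inter> V n) \<in> sigma_sets UNIV E"
        using V(1) compact_closure_subset[OF V(2) Int_lower2] that
        by (intro sigma_sets.Union sigma_sets.Basic) (simp add: E_def open_Int)
      also have "(\<Union>n. U \<inter> V n) = U" using V(4) by blast
      finally show ?thesis .
    qed
    then have "sigma_sets UNIV {S::'a set. open S} \<subseteq> sigma_sets UNIV E"
      by (intro sigma_sets_mono) auto
    then show "sets borel \<subseteq> sigma_sets (UNIV :: 'a set) E"
      by (simp add: borel_def sets_measure_of)
  qed
  have rad: "\<nu> \<omega> \<in> radon_measures" "sets (\<nu> \<omega>) = sets borel" if "\<omega> \<in> space P" for \<omega>
    using random_measure_radon[OF \<nu> that] by (auto simp: radon_measures_def)
  show ?thesis
  proof (rule emeasure_measurable_from_generator[where E=E and \<Omega>=UNIV and V=V])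
    show "Int_stable E"
      using compact_closure_subset by (fastforce simp: Int_stable_def E_def)
    show "emeasure (\<nu> \<omega>) (V n) < \<infinity>" if "\<omega> \<in> space P" for \<omega> n
    proof -
      have "emeasure (\<nu> \<omega>) (V n) \<le> emeasure (\<nu> \<omega>) (closure (V n))"
        using rad[OF that] closure_subset by (intro emeasure_mono) auto
      also have "\<dots> < \<infinity>" using radon_measure_finite[OF rad(1)[OF that] V(2)] .
      finally show ?thesis .
    qed
    show "(\<lambda>\<omega>. emeasure (\<nu> \<omega>) U) \<in> borel_measurable P" if "U \<in> E" for U
    proof -
      have U: "open U" "compact (closure U)" using that by (auto simp: E_def)
      obtain f :: "nat \<Rightarrow> 'a \<Rightarrow> real" where f': "\<forall>n. Cc (f n)" "\<forall>n x. 0 \<le> f n x" "\<forall>n x. f n x \<le> 1"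
        "\<forall>n x. f n x \<le> f (Suc n) x" "\<forall>n. \<forall>x\<in>-U. f n x = 0" "\<forall>x\<in>U. \<exists>n. f n x = 1"
        by (rule Cc_increasing_to_indicator[OF U])
      note f = f'[rule_format]
      have "emeasure (\<nu> \<omega>) U = (SUP n. ennreal (\<integral>x. f n x \<partial>\<nu> \<omega>))" if w: "\<omega> \<in> space P" for \<omega>
      proof -
        have "ennreal (\<integral>x. f n x \<partial>\<nu> \<omega>) = (\<integral>\<^sup>+x. f n x \<partial>\<nu> \<omega>)" for n
          using Cc_integrable[OF f(1) rad(1)[OF w]] f(2)
          by (intro nn_integral_eq_integral[symmetric]) auto
        moreover have "(SUP n. (\<integral>\<^sup>+x. f n x \<partial>\<nu> \<omega>)) = (\<integral>\<^sup>+x. (SUP n. ennreal (f n x)) \<partial>\<nu> \<omega>)"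
          using Cc_integrable[OF f(1) rad(1)[OF w]] f(4)
          by (intro nn_integral_monotone_convergence_SUP[symmetric] incseq_SucI le_funI ennreal_leI) auto
        moreover have "(SUP n. ennreal (f n x)) = indicator U x" for x
        proof (cases "x \<in> U")
          case True
          then obtain n where "f n x = 1" using f(6) by metis
          then show ?thesis using True f(3)
            by (intro antisym SUP_least) (auto intro!: SUP_upper2[of n] simp: ennreal_le_1)
        qed (auto simp: f(5))
        ultimately show ?thesis using \<open>U \<in> E\<close> rad(2)[OF w] by (simp add: E_def)
      qed
      then show ?thesis using random_measure_integral[OF \<nu> f(1)]
        by (simp cong: measurable_cong)
    qed
  qed (use V A rad eq in \<open>auto simp: E_def\<close>)
qed

text \<open>The vague Borel sets are generated by all vaguely open sets, that is, by arbitrary unions of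
  basic ones. Measurability of the integrals of single test functions therefore suffices only because
  the vague topology has a countable base. Countably many test functions are enough: maxima of
  finitely many tents \<open>x \<mapsto> s * max 0 (1 - dist a x / r)\<close> with rational \<open>r\<close>, \<open>s\<close> and centre \<open>a\<close> in a
  countable dense set approximate nonnegative test functions uniformly from below.\<close>

fun tents :: "('a::metric_space \<times> real \<times> real) list \<Rightarrow> 'a \<Rightarrow> real" where
  "tents [] x = 0"
| "tents ((a, r, s) # ps) x = max (s * max 0 (1 - dist a x / r)) (tents ps x)"

lemma tents_nonneg: "0 \<le> tents ps x"
  by (induction ps x rule: tents.induct) auto

lemma continuous_tents: "continuous_on S (tents ps)"
proof (induction ps)
  case (Cons p ps)
  obtain a r s where p: "p = (a, r, s)" by (cases p)
  have "tents (p # ps) = (\<lambda>x. max (s * max 0 (1 - dist a x / r)) (tents ps x))"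
    by (auto simp: p)
  moreover have "continuous_on S (\<lambda>x. max (s * max 0 (1 - dist a x / r)) (tents ps x))"
    by (cases "r = 0") (auto intro!: continuous_intros Cons)
  ultimately show ?case by simp
qed (simp add: continuous_on_const)

lemma tents_ge: "p \<in> set ps \<Longrightarrow> tents [p] x \<le> tents ps x"
proof (induction ps)
  case (Cons q ps)
  obtain a r s where q: "q = (a, r, s)" by (cases q)
  show ?case using Cons tents_nonneg[of ps x] by (auto simp: q)
qed simp

lemma tents_le: "(\<And>p. p \<in> set ps \<Longrightarrow> tents [p] x \<le> c) \<Longrightarrow> 0 \<le> c \<Longrightarrow> tents ps x \<le> c"
proof (induction ps)
  case (Cons p ps)
  obtain a r s where p: "p = (a, r, s)" by (cases p)
  have "tents [p] x \<le> c" "tents ps x \<le> c" using Cons by auto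
  then show ?case by (auto simp: p)
qed simp

definition tent_data :: "'a set \<Rightarrow> ('a \<times> real \<times> real) set" where
  "tent_data D = D \<times> {r\<in>\<rat>. 0 < r} \<times> {s\<in>\<rat>. 0 < s}"

text \<open>Around each point where \<open>f\<close> is at least \<open>e\<close>, a narrow tent below \<open>f\<close> comes within \<open>e\<close> of \<open>f\<close>;
  finitely many of them cover this compact set. Lying below \<open>f\<close> also controls the support.\<close>

lemma tents_approx:
  fixes f :: "'a::metric_space \<Rightarrow> real"
  assumes f: "Cc f" "\<And>x. 0 \<le> f x" and e: "e > 0" and D: "\<And>U. open U \<Longrightarrow> U \<noteq> {} \<Longrightarrow> \<exists>a\<in>D. (a::'a) \<in> U"
  shows "\<exists>ps\<in>lists (tent_data D). Cc (tents ps) \<and> (\<forall>x. tents ps x \<le> f x \<and> f x \<le> tents ps x + e)"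
proof -
  have cont: "continuous_on UNIV f" using f(1) by (simp add: Cc_def)
  define K where "K = {x. e \<le> f x}"
  have "closed K" unfolding K_def by (intro closed_Collect_le continuous_on_const cont)
  moreover have "K \<subseteq> closure {x. f x \<noteq> 0}" using e closure_subset by (fastforce simp: K_def)
  ultimately have K: "compact K" using f(1) unfolding Cc_def by (metis compact_Int_closed inf.absorb2)
  have "\<exists>p\<in>tent_data D. (\<forall>y. tents [p] y \<le> f y) \<and> f x < tents [p] x + e" if x: "x \<in> K" for x
  proof -
    have fx: "e \<le> f x" using x by (simp add: K_def)
    obtain s where s: "s \<in> \<rat>" "f x - e / 2 < s" "s < f x" using Rats_dense_in_real[of "f x - e/2" "f x"] e by auto
    have s0: "s > 0" using s fx e by linarith
    have "open {y. s < f y}" by (intro open_Collect_less continuous_on_const cont)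
    then obtain d where d: "d > 0" "\<And>y. dist y x < d \<Longrightarrow> s < f y"
      using s(3) unfolding open_dist by blast
    obtain r where r: "r \<in> \<rat>" "0 < r" "r < d / 2" using Rats_dense_in_real[of 0 "d/2"] d by auto
    define h where "h = min r (r * (e / 2) / s)"
    have h: "h > 0" using r s0 e by (auto simp: h_def)
    obtain a where a: "a \<in> D" "dist a x < h" using D[of "ball x h"] h by (auto simp: dist_commute)
    have "tents [(a, r, s)] y \<le> f y" for y
    proof (cases "dist a y < r")
      case True
      have "dist y x < d" using True a(2) r dist_triangle2[of y x a] by (auto simp: h_def dist_commute)
      then have "s < f y" by (rule d(2))
      moreover have "s * max 0 (1 - dist a y / r) \<le> s * 1" using s0 r by (intro mult_left_mono) auto
      ultimately show ?thesis using f(2)[of y] by auto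
    next
      case False
      then have "1 - dist a y / r \<le> 0" using r by (auto simp: divide_simps)
      then show ?thesis using f(2)[of y] by (simp add: max_def)
    qed
    moreover have "f x < tents [(a, r, s)] x + e"
    proof -
      have "dist a x < r * (e / 2) / s" using a by (auto simp: h_def)
      then have "s * (dist a x / r) < e / 2" using r s0 by (simp add: field_simps)
      then have "f x < s * (1 - dist a x / r) + e" using s by (simp add: right_diff_distrib)
      also have "\<dots> \<le> tents [(a, r, s)] x + e" using s0 by auto
      finally show ?thesis .
    qed
    moreover have "(a, r, s) \<in> tent_data D" using a r s s0 by (auto simp: tent_data_def)
    ultimately show ?thesis by blast
  qed
  then obtain p where p: "\<And>x. x \<in> K \<Longrightarrow> p x \<in> tent_data D" "\<And>x y. x \<in> K \<Longrightarrow> tents [p x] y \<le> f y"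
    "\<And>x. x \<in> K \<Longrightarrow> f x < tents [p x] x + e" by metis
  have op: "open {y. f y < tents [p x] y + e}" for x
    by (intro open_Collect_less continuous_on_add cont continuous_tents continuous_on_const)
  have cov: "K \<subseteq> (\<Union>x\<in>K. {y. f y < tents [p x] y + e})" using p(3) by auto
  obtain C where C: "C \<subseteq> K" "finite C" "K \<subseteq> (\<Union>x\<in>C. {y. f y < tents [p x] y + e})"
    by (rule compactE_image[OF K op cov])
  obtain xs where xs: "set xs = C" using C(2) finite_list by blast
  define ps where "ps = map p xs"
  have le: "tents ps x \<le> f x" for x
    by (rule tents_le) (use xs C p f(2) in \<open>auto simp: ps_def simp del: tents.simps\<close>)
  have ge: "f x \<le> tents ps x + e" for x
  proof (cases "x \<in> K")
    case True
    then obtain z where z: "z \<in> C" "f x < tents [p z] x + e" using C(3) by auto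
    have "tents [p z] x \<le> tents ps x" by (rule tents_ge) (use z xs in \<open>auto simp: ps_def\<close>)
    then show ?thesis using z by simp
  next
    case False then show ?thesis using tents_nonneg[of ps x] by (auto simp: K_def)
  qed
  have "Cc (tents ps)"
  proof (rule Cc_subset[OF f(1) continuous_tents])
    show "tents ps x = 0" if "f x = 0" for x
      using le[of x] tents_nonneg[of ps x] that by linarith
  qed
  moreover have "ps \<in> lists (tent_data D)" using xs C(1) p(1) by (force simp: ps_def)
  ultimately show ?thesis using le ge by blast
qed

text \<open>A test function \<open>f\<close> differs from a difference \<open>s - t\<close> of maxima of tents by at most \<open>e * g\<close>, where \<open>g\<close>
  is such a maximum that is at least 1 on the support of \<open>f\<close>. Hence the integral of \<open>f\<close> is controlled
  by those of \<open>s\<close>, \<open>t\<close> and \<open>g\<close>.\<close>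

lemma vague_countable_subbase:
  assumes lc: "locally compact (UNIV :: 'a::{metric_space, second_countable_topology} set)"
  obtains \<S> :: "'a::{metric_space, second_countable_topology} measure set set"
  where "countable \<S>" 
    "\<forall>S\<in>\<S>. \<exists>f U. Cc f \<and> open U \<and> S = {\<nu>\<in>radon_measures. (\<integral>x. f x \<partial>\<nu>) \<in> U}"
    "\<forall>W \<nu>. openin vague_topology W \<longrightarrow> \<nu> \<in> W \<longrightarrow>
       (\<exists>F. finite F \<and> F \<subseteq> \<S> \<and> \<nu> \<in> \<Inter>F \<and> radon_measures \<inter> \<Inter>F \<subseteq> W)"
proof -
  obtain D :: "'a set" where D: "countable D" "\<And>U. open U \<Longrightarrow> U \<noteq> {} \<Longrightarrow> \<exists>a\<in>D. a \<in> U"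
    using countable_dense_setE by metis
  define box where "box ps a b = {\<nu>::'a measure. \<nu> \<in> radon_measures \<and> (\<integral>x. tents ps x \<partial>\<nu>) \<in> {a<..<b}}" for ps a b
  define L where "L = {ps \<in> lists (tent_data D). Cc (tents ps)}"
  define \<S> where "\<S> = (\<lambda>(ps, a, b). box ps a b) ` (L \<times> \<rat> \<times> \<rat>)"
  have "countable (tent_data D)" unfolding tent_data_def
    using D(1) countable_rat by (intro countable_SIGMA) (auto intro: countable_subset)
  then have "countable L" unfolding L_def by (rule countable_subset[OF _ countable_lists, rotated]) auto
  then have 1: "countable \<S>" unfolding \<S>_def using countable_rat by auto
  have 2: "\<exists>f U. Cc f \<and> open U \<and> S = {\<nu>\<in>radon_measures. (\<integral>x. f x \<partial>\<nu>) \<in> U}" if "S \<in> \<S>" for S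
  proof -
    obtain ps a b where "ps \<in> L" "S = box ps a b" using \<open>S \<in> \<S>\<close> by (auto simp: \<S>_def)
    then show ?thesis
      by (intro exI[of _ "tents ps"] exI[of _ "{a<..<b}"]) (auto simp: L_def box_def)
  qed
  have near: "\<exists>S\<in>\<S>. \<nu> \<in> S \<and> (\<forall>\<nu>'\<in>S. \<bar>(\<integral>x. tents ps x \<partial>\<nu>') - (\<integral>x. tents ps x \<partial>\<nu>)\<bar> < d)"
    if ps: "ps \<in> L" and d: "d > 0" and \<nu>: "\<nu> \<in> radon_measures" for ps d \<nu>
  proof -
    let ?I = "\<integral>x. tents ps x \<partial>\<nu>"
    obtain a where a: "a \<in> \<rat>" "?I - d < a" "a < ?I" using Rats_dense_in_real[of "?I - d" ?I] d by auto
    obtain b where b: "b \<in> \<rat>" "?I < b" "b < ?I + d" using Rats_dense_in_real[of ?I "?I + d"] d by auto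
    show ?thesis
      by (rule bexI[of _ "box ps a b"]) (use a b ps \<nu> in \<open>auto simp: \<S>_def box_def\<close>)
  qed
  have 3: "\<exists>F. finite F \<and> F \<subseteq> \<S> \<and> \<nu> \<in> \<Inter>F \<and> radon_measures \<inter> \<Inter>F \<subseteq> W"
    if W: "openin vague_topology W" and "\<nu> \<in> W" for W \<nu>
  proof -
    have "generate_topology_on {{\<nu>\<in>radon_measures. (\<integral>x. f x \<partial>\<nu>) \<in> U} | (f :: 'a \<Rightarrow> real) U.
        continuous_on UNIV f \<and> compact (closure {x. f x \<noteq> 0}) \<and> open U} W"
      using W unfolding vague_topology_def by (simp add: openin_topology_generated_by_iff)
    then show ?thesis using \<open>\<nu> \<in> W\<close>
    proof (induction arbitrary: \<nu>)
      case Empty then show ?case by simp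
    next
      case (Int a b)
      obtain F where F: "finite F" "F \<subseteq> \<S>" "\<nu> \<in> \<Inter>F" "radon_measures \<inter> \<Inter>F \<subseteq> a" using Int by (meson IntD1)
      obtain F' where F': "finite F'" "F' \<subseteq> \<S>" "\<nu> \<in> \<Inter>F'" "radon_measures \<inter> \<Inter>F' \<subseteq> b" using Int by (meson IntD2)
      show ?case by (rule exI[of _ "F \<union> F'"]) (use F F' in blast)
    next
      case (UN K)
      then obtain k where k: "k \<in> K" "\<nu> \<in> k" by blast
      then show ?case using UN.IH[OF k] by (meson Union_upper order_trans)
    next
      case (Basis W)
      then obtain f :: "'a \<Rightarrow> real" and U where W: "W = {\<nu>\<in>radon_measures. (\<integral>x. f x \<partial>\<nu>) \<in> U}" and f: "Cc f" and U: "open U"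
        by (auto simp: Cc_def)
      have \<nu>: "\<nu> \<in> radon_measures" and "(\<integral>x. f x \<partial>\<nu>) \<in> U" using Basis W by auto
      then obtain \<delta> where \<delta>: "\<delta> > 0" "\<And>t. \<bar>t - (\<integral>x. f x \<partial>\<nu>)\<bar> < \<delta> \<Longrightarrow> t \<in> U"
        using U unfolding open_dist dist_real_def by blast
      define K where "K = closure {x. f x \<noteq> 0}"
      have K: "compact K" using f by (simp add: K_def Cc_def)
      \<comment> \<open>a test function that is at least 1 on the support of \<open>f\<close>\<close>
      obtain g where g: "g \<in> L" "\<And>x. x \<in> K \<Longrightarrow> 1 \<le> tents g x"
      proof -
        obtain V :: "nat \<Rightarrow> 'a set" where V: "\<And>n. open (V n)" "\<And>n. compact (closure (V n))" "incseq V"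
          "(\<Union>n. V n) = UNIV" "\<And>K. compact K \<Longrightarrow> \<exists>n. K \<subseteq> V n" using open_exhaustion[OF lc] by metis
        obtain n where n: "K \<subseteq> V n" using V(5) K by auto
        obtain h :: "nat \<Rightarrow> 'a \<Rightarrow> real" where h': "\<forall>n. Cc (h n)" "\<forall>n x. 0 \<le> h n x" "\<forall>n x. h n x \<le> 1"
          "\<forall>n x. h n x \<le> h (Suc n) x" "\<forall>i. \<forall>x\<in>-V n. h i x = 0" "\<forall>x\<in>V n. \<exists>i. h i x = 1"
          by (rule Cc_increasing_to_indicator[OF V(1,2), of n])
        note h = h'[rule_format]
        have "open {x. 1/2 < h i x}" for i using h(1)[of i]
          by (intro open_Collect_less) (auto simp: Cc_def)
        moreover have "K \<subseteq> (\<Union>i. {x. 1/2 < h i x})"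
        proof
          fix x assume "x \<in> K"
          then obtain i where "h i x = 1" using h(6)[of x] n by auto
          then have "x \<in> {x. 1/2 < h i x}" by simp
          then show "x \<in> (\<Union>i. {x. 1/2 < h i x})" by blast
        qed
        ultimately obtain C where C: "finite C" "K \<subseteq> (\<Union>i\<in>C. {x. 1/2 < h i x})"
          using compactE_image[OF K, of UNIV "\<lambda>i. {x. 1/2 < h i x}"] by auto
        define N where "N = Max (insert 0 C)"
        have mono: "h i x \<le> h j x" if "i \<le> j" for i j x using that h(4) lift_Suc_mono_le[of "\<lambda>n. h n x"] by blast
        have hN: "1/2 < h N x" if x: "x \<in> K" for x
        proof -
          obtain i where "i \<in> C" "1/2 < h i x" using C(2) x by auto
          moreover have "h i x \<le> h N x" using \<open>i \<in> C\<close> C(1) by (intro mono) (simp add: N_def)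
          ultimately show ?thesis by linarith
        qed
        have "Cc (\<lambda>x. 4 * h N x)"
          using h(1)[of N] by (intro Cc_subset[OF h(1)[of N]]) (auto simp: Cc_def intro!: continuous_intros)
        then obtain ps where "ps \<in> lists (tent_data D)" "Cc (tents ps)" and ps: "\<And>x. 4 * h N x \<le> tents ps x + 1"
          using tents_approx[of "\<lambda>x. 4 * h N x" 1 D] h(2) D(2) by fastforce
        moreover have "1 \<le> tents ps x" if "x \<in> K" for x using ps[of x] hN[OF that] by linarith
        ultimately show ?thesis by (intro that[of ps]) (auto simp: L_def)
      qed
      define I where "I = (\<integral>x. tents g x \<partial>\<nu>)"
      have I: "I \<ge> 0" unfolding I_def by (intro integral_nonneg_AE) (auto simp: tents_nonneg)
      \<comment> \<open>\<open>I + 1\<close> will bound the integrals of \<open>g\<close> near \<open>\<nu>\<close>, so the error terms add up to less than \<open>\<delta>\<close>\<close>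
      define e where "e = \<delta> / (8 * (I + 1))"
      have e: "e > 0" "e * (I + 1) = \<delta> / 8" using \<delta> I by (auto simp: e_def field_simps)
      have fp: "Cc (\<lambda>x. max 0 (f x))" "Cc (\<lambda>x. max 0 (- f x))"
        by (rule Cc_subset[OF f]; use f in \<open>auto simp: Cc_def intro!: continuous_intros\<close>)+
      obtain s where s: "s \<in> L" "\<And>x. tents s x \<le> max 0 (f x)" "\<And>x. max 0 (f x) \<le> tents s x + e"
        using tents_approx[OF fp(1) _ e(1) D(2)] unfolding L_def by auto
      obtain t where t: "t \<in> L" "\<And>x. tents t x \<le> max 0 (- f x)" "\<And>x. max 0 (- f x) \<le> tents t x + e"
        using tents_approx[OF fp(2) _ e(1) D(2)] unfolding L_def by auto
      have bd: "\<bar>f x - (tents s x - tents t x)\<bar> \<le> e * tents g x" for x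
      proof (cases "x \<in> K")
        case True
        have "\<bar>f x - (tents s x - tents t x)\<bar> \<le> e"
          using s(2,3)[of x] t(2,3)[of x] tents_nonneg[of s x] tents_nonneg[of t x] by linarith
        moreover have "e * 1 \<le> e * tents g x" using g(2)[OF True] e by (intro mult_left_mono) auto
        ultimately show ?thesis by simp
      next
        case False
        then have "f x = 0" using closure_subset[of "{x. f x \<noteq> 0}"] by (auto simp: K_def)
        then show ?thesis using s(2)[of x] t(2)[of x] tents_nonneg[of s x] tents_nonneg[of t x] e(1) tents_nonneg[of g x] by auto
      qed
      have bdI: "\<bar>(\<integral>x. f x \<partial>\<nu>') - ((\<integral>x. tents s x \<partial>\<nu>') - (\<integral>x. tents t x \<partial>\<nu>'))\<bar> \<le> e * (\<integral>x. tents g x \<partial>\<nu>')"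
        if "\<nu>' \<in> radon_measures" for \<nu>'
      proof -
        have i: "integrable \<nu>' f" "integrable \<nu>' (tents s)" "integrable \<nu>' (tents t)" "integrable \<nu>' (tents g)"
          using that f s t g by (auto intro!: Cc_integrable simp: L_def)
        have "\<bar>\<integral>x. f x - (tents s x - tents t x) \<partial>\<nu>'\<bar> \<le> (\<integral>x. e * tents g x \<partial>\<nu>')"
          using i bd by (intro order_trans[OF integral_abs_bound] integral_mono) auto
        then show ?thesis using i by simp
      qed
      obtain S1 where S1: "S1 \<in> \<S>" "\<nu> \<in> S1" "\<And>\<nu>'. \<nu>' \<in> S1 \<Longrightarrow> \<bar>(\<integral>x. tents g x \<partial>\<nu>') - I\<bar> < 1"
        using near[OF g(1) _ \<nu>, of 1] unfolding I_def by auto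
      obtain S2 where S2: "S2 \<in> \<S>" "\<nu> \<in> S2" "\<And>\<nu>'. \<nu>' \<in> S2 \<Longrightarrow> \<bar>(\<integral>x. tents s x \<partial>\<nu>') - (\<integral>x. tents s x \<partial>\<nu>)\<bar> < \<delta>/4"
        using near[OF s(1) _ \<nu>, of "\<delta>/4"] \<delta> by auto
      obtain S3 where S3: "S3 \<in> \<S>" "\<nu> \<in> S3" "\<And>\<nu>'. \<nu>' \<in> S3 \<Longrightarrow> \<bar>(\<integral>x. tents t x \<partial>\<nu>') - (\<integral>x. tents t x \<partial>\<nu>)\<bar> < \<delta>/4"
        using near[OF t(1) _ \<nu>, of "\<delta>/4"] \<delta> by auto
      have "\<nu>' \<in> W" if \<nu>': "\<nu>' \<in> radon_measures" "\<nu>' \<in> S1" "\<nu>' \<in> S2" "\<nu>' \<in> S3" for \<nu>'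
      proof -
        have "e * (\<integral>x. tents g x \<partial>\<nu>') \<le> e * (I + 1)" "e * I \<le> e * (I + 1)"
          using S1(3)[OF \<nu>'(2)] e by (auto intro!: mult_left_mono)
        then have "\<bar>(\<integral>x. f x \<partial>\<nu>') - (\<integral>x. f x \<partial>\<nu>)\<bar> < \<delta>"
          using bdI[OF \<nu>'(1)] bdI[OF \<nu>] S2(3)[OF \<nu>'(3)] S3(3)[OF \<nu>'(4)] e(2) \<delta>(1)
          unfolding I_def[symmetric] by linarith
        then show ?thesis using \<delta>(2) \<nu>' W by simp
      qed
      then show ?case using S1(1,2) S2(1,2) S3(1,2) by (intro exI[of _ "{S1, S2, S3}"]) auto
    qed
  qed
  show thesis
    by (rule that[OF 1]) (intro ballI allI impI, erule 2, intro allI impI, rule 3)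
qed

text \<open>Random measures without any finiteness condition. This class is closed under countable sums,
  restrictions and images, so that local finiteness has to be checked only for the final result of a
  construction.\<close>

definition borel_kernel :: "'w measure \<Rightarrow> ('w \<Rightarrow> 'a::topological_space measure) \<Rightarrow> bool" where
  "borel_kernel P \<kappa> \<longleftrightarrow> (\<forall>\<omega>\<in>space P. sets (\<kappa> \<omega>) = sets borel) \<and>
     (\<forall>A\<in>sets borel. (\<lambda>\<omega>. emeasure (\<kappa> \<omega>) A) \<in> borel_measurable P)"

lemma kernel_sets: "borel_kernel P \<kappa> \<Longrightarrow> \<omega> \<in> space P \<Longrightarrow> sets (\<kappa> \<omega>) = sets borel"
  and kernel_emeasure: "borel_kernel P \<kappa> \<Longrightarrow> A \<in> sets borel \<Longrightarrow> (\<lambda>\<omega>. emeasure (\<kappa> \<omega>) A) \<in> borel_measurable P"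
  by (auto simp: borel_kernel_def)

lemma kernel_nn_integral:
  assumes \<kappa>: "borel_kernel P \<kappa>" and h: "h \<in> borel_measurable borel"
  shows "(\<lambda>\<omega>. \<integral>\<^sup>+x. h x \<partial>\<kappa> \<omega>) \<in> borel_measurable P"
  using h
proof (induction h rule: borel_measurable_induct)
  case (cong f g) then show ?case by (simp cong: nn_integral_cong)
next
  case (set A)
  then have "(\<integral>\<^sup>+x. indicator A x \<partial>\<kappa> \<omega>) = emeasure (\<kappa> \<omega>) A" if "\<omega> \<in> space P" for \<omega>
    using kernel_sets[OF \<kappa> that] by (intro nn_integral_indicator) simp
  then show ?case using kernel_emeasure[OF \<kappa> set] by (simp cong: measurable_cong)
next
  case (mult u c)
  then have "(\<integral>\<^sup>+x. c * u x \<partial>\<kappa> \<omega>) = c * (\<integral>\<^sup>+x. u x \<partial>\<kappa> \<omega>)" if "\<omega> \<in> space P" for \<omega>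
    using kernel_sets[OF \<kappa> that] by (intro nn_integral_cmult) (simp cong: measurable_cong_sets)
  then show ?case using mult by (simp cong: measurable_cong)
next
  case (add u v)
  then have "(\<integral>\<^sup>+x. v x + u x \<partial>\<kappa> \<omega>) = (\<integral>\<^sup>+x. v x \<partial>\<kappa> \<omega>) + (\<integral>\<^sup>+x. u x \<partial>\<kappa> \<omega>)" if "\<omega> \<in> space P" for \<omega>
    using kernel_sets[OF \<kappa> that] by (intro nn_integral_add) (simp_all cong: measurable_cong_sets)
  then show ?case using add by (simp cong: measurable_cong)
next
  case (seq U)
  then have "(\<integral>\<^sup>+x. (SUP i. U i x) \<partial>\<kappa> \<omega>) = (SUP i. \<integral>\<^sup>+x. U i x \<partial>\<kappa> \<omega>)" if "\<omega> \<in> space P" for \<omega>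
    using kernel_sets[OF \<kappa> that] by (intro nn_integral_monotone_convergence_SUP) (simp_all cong: measurable_cong_sets)
  then show ?case using seq by (simp add: image_comp cong: measurable_cong)
qed

text \<open>Together with \<open>random_measure_emeasure\<close> this reduces vague measurability to the measurability of
  the masses of Borel sets.\<close>

lemma random_measureI:
  fixes \<nu> :: "'w \<Rightarrow> 'a::{metric_space, second_countable_topology} measure"
  assumes lc: "locally compact (UNIV :: 'a set)"
    and rad: "\<And>\<omega>. \<omega> \<in> space P \<Longrightarrow> \<nu> \<omega> \<in> radon_measures"
    and m: "\<And>A. A \<in> sets borel \<Longrightarrow> (\<lambda>\<omega>. emeasure (\<nu> \<omega>) A) \<in> borel_measurable P"
  shows "random_measure P \<nu>"
proof -
  obtain \<S> :: "'a measure set set" where S: "countable \<S>"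
    "\<forall>S\<in>\<S>. \<exists>f U. Cc f \<and> open U \<and> S = {\<nu>\<in>radon_measures. (\<integral>x. f x \<partial>\<nu>) \<in> U}"
    "\<forall>W \<nu>. openin vague_topology W \<longrightarrow> \<nu> \<in> W \<longrightarrow>
       (\<exists>F. finite F \<and> F \<subseteq> \<S> \<and> \<nu> \<in> \<Inter>F \<and> radon_measures \<inter> \<Inter>F \<subseteq> W)"
    by (rule vague_countable_subbase[OF lc])
  have "\<nu> \<in> P \<rightarrow>\<^sub>M vague_borel"
    unfolding vague_borel_def
  proof (rule measurable_measure_of)
    show "{W. openin vague_topology W} \<subseteq> Pow (radon_measures :: 'a measure set)"
      using openin_subset[of vague_topology] by (auto simp: topspace_vague_topology)
    show "\<nu> \<in> space P \<rightarrow> radon_measures" using rad by auto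
    have int: "(\<lambda>\<omega>. \<integral>x. f x \<partial>\<nu> \<omega>) \<in> borel_measurable P" if f: "Cc f" for f :: "'a \<Rightarrow> real"
    proof -
      have fm: "f \<in> borel_measurable borel" using f by (auto simp: Cc_def intro: borel_measurable_continuous_onI)
      have nn: "(\<lambda>\<omega>. \<integral>\<^sup>+x. h x \<partial>\<nu> \<omega>) \<in> borel_measurable P" if "h \<in> borel_measurable borel" for h :: "'a \<Rightarrow> ennreal"
        using that rad m by (intro kernel_nn_integral) (auto simp: borel_kernel_def radon_measures_def)
      have "(\<integral>x. f x \<partial>\<nu> \<omega>) = enn2real (\<integral>\<^sup>+x. f x \<partial>\<nu> \<omega>) - enn2real (\<integral>\<^sup>+x. - f x \<partial>\<nu> \<omega>)" if "\<omega> \<in> space P" for \<omega>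
        using Cc_integrable[OF f rad[OF that]] by (rule real_lebesgue_integral_def)
      then show ?thesis using nn fm by (simp cong: measurable_cong)
    qed
    fix W :: "'a measure set" assume "W \<in> {W. openin vague_topology W}"
    then have W: "openin vague_topology W" by simp
    define \<F> where "\<F> = {F. finite F \<and> F \<subseteq> \<S> \<and> radon_measures \<inter> \<Inter>F \<subseteq> W}"
    have cF: "countable \<F>" unfolding \<F>_def
      by (rule countable_subset[OF _ countable_Collect_finite_subset[OF S(1)]]) auto
    have "W \<subseteq> radon_measures" using openin_subset[OF W] by (simp add: topspace_vague_topology)
    have "\<nu> -` W \<inter> space P = (\<Union>F\<in>\<F>. {\<omega>\<in>space P. \<forall>S\<in>F. \<nu> \<omega> \<in> S})"
    proof (intro equalityI subsetI)
      fix \<omega> assume w: "\<omega> \<in> \<nu> -` W \<inter> space P"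
      then obtain F where "finite F" "F \<subseteq> \<S>" "\<nu> \<omega> \<in> \<Inter>F" "radon_measures \<inter> \<Inter>F \<subseteq> W"
        using S(3)[rule_format, OF W, of "\<nu> \<omega>"] w by auto
      then show "\<omega> \<in> (\<Union>F\<in>\<F>. {\<omega>\<in>space P. \<forall>S\<in>F. \<nu> \<omega> \<in> S})" using w by (auto simp: \<F>_def)
    next
      fix \<omega> assume "\<omega> \<in> (\<Union>F\<in>\<F>. {\<omega>\<in>space P. \<forall>S\<in>F. \<nu> \<omega> \<in> S})"
      then show "\<omega> \<in> \<nu> -` W \<inter> space P" using rad by (auto simp: \<F>_def)
    qed
    also have "\<dots> \<in> sets P"
    proof (intro sets.countable_UN''[OF cF])
      fix F assume F: "F \<in> \<F>"
      have "{\<omega>\<in>space P. \<nu> \<omega> \<in> S} \<in> sets P" if SF: "S \<in> F" for S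
      proof -
        obtain f U where fU: "Cc f" "open U" "S = {\<nu>\<in>radon_measures. (\<integral>x. f x \<partial>\<nu>) \<in> U}"
          using bspec[OF S(2), of S] F SF by (auto simp: \<F>_def)
        have "{\<omega>\<in>space P. \<nu> \<omega> \<in> S} = (\<lambda>\<omega>. \<integral>x. f x \<partial>\<nu> \<omega>) -` U \<inter> space P"
          using rad fU(3) by auto
        then show ?thesis using measurable_sets[OF int[OF fU(1)], of U] fU(2) by simp
      qed
      then show "{\<omega>\<in>space P. \<forall>S\<in>F. \<nu> \<omega> \<in> S} \<in> sets P"
        using F by (cases "F = {}") (auto simp: \<F>_def intro!: sets.sets_Collect_finite_All')
    qed
    finally show "\<nu> -` W \<inter> space P \<in> sets P" .
  qed
  then show ?thesis by (simp add: random_measure_def)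
qed


lemma random_measure_kernel:
  fixes \<nu> :: "'w \<Rightarrow> 'a::{metric_space, second_countable_topology} measure"
  assumes "locally compact (UNIV :: 'a set)" "random_measure P \<nu>" shows "borel_kernel P \<nu>"
  using random_measure_emeasure[OF assms] random_measure_radon[OF assms(2)] radon_measure_sets
  by (auto simp: borel_kernel_def)

section \<open>Sums and differences of measures\<close>

definition sum_measure :: "'i set \<Rightarrow> ('i \<Rightarrow> 'a::topological_space measure) \<Rightarrow> 'a measure" where
  "sum_measure I M = measure_of UNIV (sets borel) (\<lambda>A. \<integral>\<^sup>+i. emeasure (M i) A \<partial>count_space I)"

lemma sets_sum_measure [simp]: "sets (sum_measure I M) = sets borel"
  unfolding sum_measure_def using sets.sigma_sets_eq[of borel] by (simp add: sets_measure_of_conv)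

lemma space_sum_measure [simp]: "space (sum_measure I M) = UNIV"
  using sets_eq_imp_space_eq[OF sets_sum_measure] by simp

lemma emeasure_sum_measure:
  assumes "\<And>i. i \<in> I \<Longrightarrow> sets (M i) = sets borel" "A \<in> sets borel"
  shows "emeasure (sum_measure I M) A = (\<integral>\<^sup>+i. emeasure (M i) A \<partial>count_space I)"
proof (rule emeasure_measure_of[OF sum_measure_def])
  show "positive (sets (sum_measure I M)) (\<lambda>A. \<integral>\<^sup>+i. emeasure (M i) A \<partial>count_space I)"
    by (simp add: positive_def)
  show "countably_additive (sets (sum_measure I M)) (\<lambda>A. \<integral>\<^sup>+i. emeasure (M i) A \<partial>count_space I)"
  proof (rule countably_additiveI)
    fix B :: "nat \<Rightarrow> 'b set" assume B: "range B \<subseteq> sets (sum_measure I M)" "disjoint_family B"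
    have "(\<Sum>n. \<integral>\<^sup>+i. emeasure (M i) (B n) \<partial>count_space I) = (\<integral>\<^sup>+i. (\<Sum>n. emeasure (M i) (B n)) \<partial>count_space I)"
      by (rule nn_integral_suminf[symmetric]) simp
    also have "\<dots> = (\<integral>\<^sup>+i. emeasure (M i) (\<Union>n. B n) \<partial>count_space I)"
      using B assms(1) by (intro nn_integral_cong suminf_emeasure) auto
    finally show "(\<Sum>n. \<integral>\<^sup>+i. emeasure (M i) (B n) \<partial>count_space I) = (\<integral>\<^sup>+i. emeasure (M i) (\<Union>n. B n) \<partial>count_space I)" .
  qed
qed (use assms sets.space_closed[of borel] in auto)

lemma nn_integral_sum_measure:
  assumes I: "countable I" and M: "\<And>i. i \<in> I \<Longrightarrow> sets (M i) = sets borel" and f: "f \<in> borel_measurable borel"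
  shows "(\<integral>\<^sup>+x. f x \<partial>sum_measure I M) = (\<integral>\<^sup>+i. \<integral>\<^sup>+x. f x \<partial>M i \<partial>count_space I)"
  using f
proof (induction f rule: borel_measurable_induct)
  case (cong f g) then show ?case by (simp cong: nn_integral_cong)
next
  case (set A)
  have "(\<integral>\<^sup>+i. \<integral>\<^sup>+x. indicator A x \<partial>M i \<partial>count_space I) = (\<integral>\<^sup>+i. emeasure (M i) A \<partial>count_space I)"
    using set M by (intro nn_integral_cong nn_integral_indicator) simp
  moreover have "(\<integral>\<^sup>+x. indicator A x \<partial>sum_measure I M) = emeasure (sum_measure I M) A"
    using set by (intro nn_integral_indicator) simp
  ultimately show ?case using emeasure_sum_measure[OF M set] by simp
next
  case (mult u c)
  then have "(\<integral>\<^sup>+i. \<integral>\<^sup>+x. c * u x \<partial>M i \<partial>count_space I) = (\<integral>\<^sup>+i. c * (\<integral>\<^sup>+x. u x \<partial>M i) \<partial>count_space I)"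
    using M by (intro nn_integral_cong nn_integral_cmult) (auto cong: measurable_cong_sets)
  then show ?case using mult by (simp add: nn_integral_cmult cong: measurable_cong_sets)
next
  case (add u v)
  then have "(\<integral>\<^sup>+i. \<integral>\<^sup>+x. v x + u x \<partial>M i \<partial>count_space I) = (\<integral>\<^sup>+i. (\<integral>\<^sup>+x. v x \<partial>M i) + (\<integral>\<^sup>+x. u x \<partial>M i) \<partial>count_space I)"
    using M by (intro nn_integral_cong nn_integral_add) (auto cong: measurable_cong_sets)
  then show ?case using add by (simp add: nn_integral_add cong: measurable_cong_sets)
next
  case (seq U)
  have "(\<integral>\<^sup>+x. (SUP i. U i x) \<partial>sum_measure I M) = (SUP i. \<integral>\<^sup>+x. U i x \<partial>sum_measure I M)"
    using seq by (intro nn_integral_monotone_convergence_SUP) (simp_all cong: measurable_cong_sets)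
  also have "\<dots> = (SUP k. \<integral>\<^sup>+i. \<integral>\<^sup>+x. U k x \<partial>M i \<partial>count_space I)"
    using seq by simp
  also have "\<dots> = (\<integral>\<^sup>+i. (SUP k. \<integral>\<^sup>+x. U k x \<partial>M i) \<partial>count_space I)"
    using seq(3) by (intro nn_integral_monotone_convergence_SUP[symmetric])
      (auto simp: incseq_def le_fun_def intro!: nn_integral_mono)
  also have "\<dots> = (\<integral>\<^sup>+i. \<integral>\<^sup>+x. (SUP k. U k x) \<partial>M i \<partial>count_space I)"
    using seq M by (intro nn_integral_cong nn_integral_monotone_convergence_SUP[symmetric]) (auto cong: measurable_cong_sets)
  finally show ?case by (simp add: image_comp)
qed

lemma kernel_sum_measure:
  assumes I: "countable I" and M: "\<And>i. i \<in> I \<Longrightarrow> borel_kernel P (\<lambda>\<omega>. M \<omega> i)"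
  shows "borel_kernel P (\<lambda>\<omega>. sum_measure I (M \<omega>))"
proof -
  interpret sigma_finite_measure "count_space I" using I by (rule sigma_finite_measure_count_space_countable)
  have "(\<lambda>\<omega>. emeasure (sum_measure I (M \<omega>)) A) \<in> borel_measurable P" if A: "A \<in> sets borel" for A
  proof -
    have "(\<lambda>(\<omega>, i). emeasure (M \<omega> i) A) \<in> borel_measurable (P \<Otimes>\<^sub>M count_space I)"
      unfolding case_prod_beta
      by (rule measurable_compose_countable'[where f="\<lambda>i p. emeasure (M (fst p) i) A" and g=snd and I=I])
        (use I kernel_emeasure[OF M A] in \<open>auto intro: measurable_compose[OF measurable_fst]\<close>)
    then have "(\<lambda>\<omega>. \<integral>\<^sup>+i. emeasure (M \<omega> i) A \<partial>count_space I) \<in> borel_measurable P"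
      by (rule borel_measurable_nn_integral)
    moreover have "emeasure (sum_measure I (M \<omega>)) A = (\<integral>\<^sup>+i. emeasure (M \<omega> i) A \<partial>count_space I)" if "\<omega> \<in> space P" for \<omega>
      using kernel_sets[OF M that] A by (intro emeasure_sum_measure) auto
    ultimately show ?thesis by (simp cong: measurable_cong)
  qed
  then show ?thesis by (simp add: borel_kernel_def)
qed

definition add_measure :: "'a::topological_space measure \<Rightarrow> 'a measure \<Rightarrow> 'a measure" where
  "add_measure M N = sum_measure UNIV (\<lambda>b. if b then M else N)"

lemma sets_add_measure [simp]: "sets (add_measure M N) = sets borel"
  and space_add_measure [simp]: "space (add_measure M N) = UNIV"
  by (simp_all add: add_measure_def)

lemma emeasure_add_measure:
  assumes "sets M = sets borel" "sets N = sets borel" "A \<in> sets borel"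
  shows "emeasure (add_measure M N) A = emeasure M A + emeasure N A"
  unfolding add_measure_def using assms
  by (subst emeasure_sum_measure) (auto simp: nn_integral_count_space_finite UNIV_bool add.commute)

lemma nn_integral_add_measure:
  assumes "sets M = sets borel" "sets N = sets borel" "f \<in> borel_measurable borel"
  shows "(\<integral>\<^sup>+x. f x \<partial>add_measure M N) = (\<integral>\<^sup>+x. f x \<partial>M) + (\<integral>\<^sup>+x. f x \<partial>N)"
  unfolding add_measure_def using assms
  by (subst nn_integral_sum_measure) (auto simp: nn_integral_count_space_finite UNIV_bool add.commute)

lemma kernel_add_measure:
  assumes "borel_kernel P M" "borel_kernel P N" shows "borel_kernel P (\<lambda>\<omega>. add_measure (M \<omega>) (N \<omega>))"
  unfolding add_measure_def
proof (rule kernel_sum_measure)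
  show "borel_kernel P (\<lambda>\<omega>. if b then M \<omega> else N \<omega>)" for b
    using assms by (cases b) auto
qed simp

abbreviation restr :: "'a measure \<Rightarrow> 'a set \<Rightarrow> 'a measure" where
  "restr M A \<equiv> density M (indicator A)"

lemma emeasure_restr:
  assumes "sets M = sets borel" "A \<in> sets borel" "B \<in> sets borel"
  shows "emeasure (restr M A) B = emeasure M (A \<inter> B)"
  using assms by (intro emeasure_restricted) auto

lemma nn_integral_restr:
  assumes "sets M = sets borel" "A \<in> sets borel" "f \<in> borel_measurable borel"
  shows "(\<integral>\<^sup>+x. f x \<partial>restr M A) = (\<integral>\<^sup>+x. f x * indicator A x \<partial>M)"
proof -
  have [measurable]: "A \<in> sets M" "f \<in> borel_measurable M"
    using assms by (simp_all cong: measurable_cong_sets)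
  show ?thesis by (subst nn_integral_density) (auto simp: mult.commute)
qed

lemma kernel_restr:
  assumes "borel_kernel P M" "A \<in> sets borel" shows "borel_kernel P (\<lambda>\<omega>. restr (M \<omega>) A)"
proof -
  have "emeasure (restr (M \<omega>) A) B = emeasure (M \<omega>) (A \<inter> B)" if "B \<in> sets borel" "\<omega> \<in> space P" for B \<omega>
    using kernel_sets[OF assms(1) that(2)] assms that by (intro emeasure_restr)
  then show ?thesis using assms by (auto simp: borel_kernel_def cong: measurable_cong)
qed

lemma kernel_scale:
  assumes "borel_kernel P M" "c \<in> borel_measurable P" shows "borel_kernel P (\<lambda>\<omega>. scale_measure (c \<omega>) (M \<omega>))"
  using assms by (auto simp: borel_kernel_def)

lemma emeasure_distr_borel:
  assumes "sets M = sets borel" "f \<in> borel_measurable borel" "A \<in> sets borel"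
  shows "emeasure (distr M borel f) A = emeasure M (f -` A)"
  using assms by (subst emeasure_distr) (auto simp: sets_eq_imp_space_eq[OF assms(1)] cong: measurable_cong_sets)

lemma nn_integral_distr_borel:
  assumes "sets M = sets borel" "f \<in> borel_measurable borel" "h \<in> borel_measurable borel"
  shows "(\<integral>\<^sup>+x. h x \<partial>distr M borel f) = (\<integral>\<^sup>+x. h (f x) \<partial>M)"
  using assms by (subst nn_integral_distr) (auto cong: measurable_cong_sets)

lemma vimage_borel: "f \<in> borel_measurable borel \<Longrightarrow> A \<in> sets borel \<Longrightarrow> f -` A \<in> sets borel"
  using measurable_sets[of f borel borel A] by simp

lemma kernel_distr:
  assumes "borel_kernel P M" "f \<in> borel_measurable borel" shows "borel_kernel P (\<lambda>\<omega>. distr (M \<omega>) borel f)"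
proof -
  have "emeasure (distr (M \<omega>) borel f) B = emeasure (M \<omega>) (f -` B)" if "B \<in> sets borel" "\<omega> \<in> space P" for B \<omega>
    using kernel_sets[OF assms(1) that(2)] assms that by (intro emeasure_distr_borel)
  then show ?thesis using assms vimage_borel[OF assms(2)] by (auto simp: borel_kernel_def cong: measurable_cong)
qed

lemma emeasure_incseq_SUP:
  assumes "sets M = sets borel" "A \<in> sets borel" "incseq V" "\<And>n. V n \<in> sets borel" "(\<Union>n. V n) = UNIV"
  shows "emeasure M A = (SUP n. emeasure M (A \<inter> V n))"
proof -
  have "(SUP n. emeasure M (A \<inter> V n)) = emeasure M (\<Union>n. A \<inter> V n)"
    using assms by (intro SUP_emeasure_incseq) (auto simp: incseq_def)
  also have "(\<Union>n. A \<inter> V n) = A" using assms(5) by blast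
  finally show ?thesis by simp
qed

text \<open>Subtraction of infinite masses is meaningless, so the difference is formed on the pieces of a
  countable partition into sets of finite measure.\<close>

lemma measure_difference:
  fixes M N :: "'a::topological_space measure"
  assumes s: "sets M = sets borel" "sets N = sets borel" and le: "\<And>A. A \<in> sets borel \<Longrightarrow> emeasure N A \<le> emeasure M A"
    and V: "\<And>n::nat. V n \<in> sets borel" "(\<Union>n. V n) = UNIV" "\<And>n. emeasure M (V n) < \<infinity>"
  shows "\<exists>D. sets D = sets borel \<and> (\<forall>A\<in>sets borel. emeasure D A + emeasure N A = emeasure M A)"
proof -
  define W where "W = disjointed V"
  have W: "W n \<in> sets borel" for n
    using sets.range_disjointed_sets[of V borel] V(1) by (auto simp: W_def)
  have dW: "disjoint_family W" "(\<Union>n. W n) = UNIV" unfolding W_def using V(2)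
    by (auto simp: disjoint_family_disjointed UN_disjointed_eq)
  have fW: "emeasure M (W n \<inter> A) < \<infinity>" if "A \<in> sets borel" for n A
  proof -
    have "emeasure M (W n \<inter> A) \<le> emeasure M (V n)"
      using disjointed_subset[of V n] s V(1) by (intro emeasure_mono) (auto simp: W_def)
    then show ?thesis using V(3)[of n] by (rule le_less_trans)
  qed
  let ?D = "\<lambda>n. diff_measure (restr M (W n)) (restr N (W n))"
  have D: "emeasure (?D n) A = emeasure M (W n \<inter> A) - emeasure N (W n \<inter> A)" if A: "A \<in> sets borel" for A n
  proof (subst emeasure_diff_measure)
    show "finite_measure (restr M (W n))" using fW[of UNIV n]
      by (intro finite_measureI) (auto simp: emeasure_restr s W sets_eq_imp_space_eq[OF s(1)])
    show "finite_measure (restr N (W n))" using fW[of UNIV n] le[OF W, of n]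
      by (intro finite_measureI) (auto simp: emeasure_restr s W sets_eq_imp_space_eq[OF s(2)] top_unique)
  qed (use A s le W in \<open>auto simp: emeasure_restr\<close>)
  have sum: "(\<Sum>n. emeasure K (W n \<inter> A)) = emeasure K A" if "sets K = sets borel" "A \<in> sets borel" for K A
  proof -
    have "(\<Sum>n. emeasure K (W n \<inter> A)) = emeasure K (\<Union>n. W n \<inter> A)"
      using dW(1) W that by (intro suminf_emeasure) (auto simp: disjoint_family_on_def)
    also have "(\<Union>n. W n \<inter> A) = A" using dW(2) by blast
    finally show ?thesis .
  qed
  have "emeasure (sum_measure UNIV ?D) A + emeasure N A = emeasure M A" if A: "A \<in> sets borel" for A
  proof -
    have "emeasure (sum_measure UNIV ?D) A = (\<Sum>n. emeasure M (W n \<inter> A) - emeasure N (W n \<inter> A))"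
      using A s D[OF A] by (subst emeasure_sum_measure) (auto simp: nn_integral_count_space_nat)
    moreover have "emeasure N A = (\<Sum>n. emeasure N (W n \<inter> A))" using sum[OF s(2) A] by simp
    ultimately have "emeasure (sum_measure UNIV ?D) A + emeasure N A
      = (\<Sum>n. (emeasure M (W n \<inter> A) - emeasure N (W n \<inter> A)) + emeasure N (W n \<inter> A))"
      by (simp add: suminf_add)
    also have "\<dots> = (\<Sum>n. emeasure M (W n \<inter> A))"
      using le W A by (intro suminf_cong diff_add_cancel_ennreal) auto
    finally show ?thesis using sum[OF s(1) A] by simp
  qed
  then show ?thesis by (intro exI[of _ "sum_measure UNIV ?D"]) auto
qed

lemma measure_difference_unique:
  assumes s: "sets D = sets borel" "sets D' = sets borel" "sets N = sets borel"
    and eq: "\<And>A. A \<in> sets borel \<Longrightarrow> emeasure D A + emeasure N A = emeasure D' A + emeasure N A"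
    and V: "incseq V" "\<And>n::nat. V n \<in> sets borel" "(\<Union>n. V n) = UNIV" "\<And>n. emeasure N (V n) < \<infinity>"
  shows "D = D'"
proof (rule measure_eqI)
  fix A assume "A \<in> sets D"
  then have A: "A \<in> sets borel" using s by simp
  have "emeasure D (A \<inter> V n) = emeasure D' (A \<inter> V n)" for n
  proof -
    have "emeasure N (A \<inter> V n) \<le> emeasure N (V n)" using s V(2) by (intro emeasure_mono) auto
    then have "emeasure N (A \<inter> V n) \<noteq> \<infinity>" using V(4)[of n] by (auto simp: top_unique)
    moreover have "A \<inter> V n \<in> sets borel" by (intro sets.Int A V(2))
    from eq[OF this] have "emeasure N (A \<inter> V n) + emeasure D (A \<inter> V n) = emeasure N (A \<inter> V n) + emeasure D' (A \<inter> V n)"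
      by (simp add: add.commute)
    ultimately show ?thesis unfolding ennreal_add_left_cancel by simp
  qed
  then show "emeasure D A = emeasure D' A"
    using emeasure_incseq_SUP[OF s(1) A V(1-3)] emeasure_incseq_SUP[OF s(2) A V(1-3)] by simp
qed (use s in simp)

lemma kernel_difference:
  assumes M: "borel_kernel P M" and N: "borel_kernel P N" and D: "\<And>\<omega>. \<omega> \<in> space P \<Longrightarrow> sets (D \<omega>) = sets borel"
    and eq: "\<And>\<omega> A. \<omega> \<in> space P \<Longrightarrow> A \<in> sets borel \<Longrightarrow> emeasure (D \<omega>) A + emeasure (N \<omega>) A = emeasure (M \<omega>) A"
    and V: "incseq V" "\<And>n::nat. V n \<in> sets borel" "(\<Union>n. V n) = UNIV"
      "\<And>\<omega> n. \<omega> \<in> space P \<Longrightarrow> emeasure (N \<omega>) (V n) < \<infinity>"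
  shows "borel_kernel P D"
proof -
  have "(\<lambda>\<omega>. emeasure (D \<omega>) A) \<in> borel_measurable P" if A: "A \<in> sets borel" for A
  proof -
    have "emeasure (D \<omega>) (A \<inter> V n) = emeasure (M \<omega>) (A \<inter> V n) - emeasure (N \<omega>) (A \<inter> V n)" if w: "\<omega> \<in> space P" for \<omega> n
    proof -
      have "emeasure (N \<omega>) (A \<inter> V n) \<le> emeasure (N \<omega>) (V n)"
        using V(2) kernel_sets[OF N w] by (intro emeasure_mono) auto
      then have "emeasure (N \<omega>) (A \<inter> V n) \<noteq> \<infinity>" using V(4)[OF w, of n] by (auto simp: top_unique)
      moreover have "emeasure (M \<omega>) (A \<inter> V n) = emeasure (D \<omega>) (A \<inter> V n) + emeasure (N \<omega>) (A \<inter> V n)"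
        by (intro eq[OF w, symmetric] sets.Int A V(2))
      ultimately show ?thesis by simp
    qed
    then have "emeasure (D \<omega>) A = (SUP n. emeasure (M \<omega>) (A \<inter> V n) - emeasure (N \<omega>) (A \<inter> V n))" if w: "\<omega> \<in> space P" for \<omega>
      using emeasure_incseq_SUP[OF D[OF w] A V(1-3)] w by simp
    moreover have "(\<lambda>\<omega>. SUP n. emeasure (M \<omega>) (A \<inter> V n) - emeasure (N \<omega>) (A \<inter> V n)) \<in> borel_measurable P"
      using kernel_emeasure[OF M] kernel_emeasure[OF N] A V(2)
      by (intro borel_measurable_SUP borel_measurable_minus_ennreal) auto
    ultimately show ?thesis by (simp cong: measurable_cong)
  qed
  then show ?thesis using D by (simp add: borel_kernel_def)
qed

lemma borel_rectangles:
  "sets (borel :: ('a::second_countable_topology \<times> 'b::second_countable_topology) measure)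
     = sigma_sets UNIV {A \<times> B | A B. A \<in> sets borel \<and> B \<in> sets borel}"
  by (subst borel_prod[symmetric]) (simp add: sets_pair_measure)

lemma rectangle_borel:
  fixes A :: "'a::second_countable_topology set" and B :: "'b::second_countable_topology set"
  shows "A \<in> sets borel \<Longrightarrow> B \<in> sets borel \<Longrightarrow> A \<times> B \<in> sets borel"
  by (subst borel_prod[symmetric]) simp

lemma kernel_pair:
  fixes M :: "'w \<Rightarrow> 'a::second_countable_topology measure" and N :: "'w \<Rightarrow> 'b::second_countable_topology measure"
  assumes M: "borel_kernel P M" "\<And>\<omega>. \<omega> \<in> space P \<Longrightarrow> finite_measure (M \<omega>)"
    and N: "borel_kernel P N" "\<And>\<omega>. \<omega> \<in> space P \<Longrightarrow> finite_measure (N \<omega>)"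
  shows "borel_kernel P (\<lambda>\<omega>. M \<omega> \<Otimes>\<^sub>M N \<omega>)"
proof -
  have s: "sets (M \<omega> \<Otimes>\<^sub>M N \<omega>) = sets borel" if "\<omega> \<in> space P" for \<omega>
    using kernel_sets[OF M(1) that] kernel_sets[OF N(1) that] borel_prod
    by (metis sets_pair_measure_cong)
  have rect: "emeasure (M \<omega> \<Otimes>\<^sub>M N \<omega>) (A \<times> B) = emeasure (M \<omega>) A * emeasure (N \<omega>) B"
    if "\<omega> \<in> space P" "A \<in> sets borel" "B \<in> sets borel" for \<omega> A B
  proof -
    interpret finite_measure "N \<omega>" using that N by simp
    show ?thesis using that kernel_sets[OF M(1)] kernel_sets[OF N(1)]
      by (intro emeasure_pair_measure_Times) auto
  qed
  have "(\<lambda>\<omega>. emeasure (M \<omega> \<Otimes>\<^sub>M N \<omega>) Z) \<in> borel_measurable P" if "Z \<in> sets borel" for Z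
  proof (rule emeasure_measurable_from_generator[where V="\<lambda>_. UNIV"])
    show "sets (M \<omega> \<Otimes>\<^sub>M N \<omega>) = sigma_sets UNIV {A \<times> B | A B. A \<in> sets borel \<and> B \<in> sets borel}" if "\<omega> \<in> space P" for \<omega>
      using s[OF that] borel_rectangles by simp
    show "Int_stable {A \<times> B | (A::'a set) (B::'b set). A \<in> sets borel \<and> B \<in> sets borel}"
      unfolding Int_stable_def by (clarsimp simp: Times_Int_Times) (blast intro: sets.Int)
    show "(\<lambda>\<omega>. emeasure (M \<omega> \<Otimes>\<^sub>M N \<omega>) Z) \<in> borel_measurable P"
      if "Z \<in> {A \<times> B | A B. A \<in> sets borel \<and> B \<in> sets borel}" for Z
      using that kernel_emeasure[OF M(1)] kernel_emeasure[OF N(1)]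
      by (auto simp: rect cong: measurable_cong)
    show "range (\<lambda>_. UNIV) \<subseteq> {A \<times> B | (A::'a set) (B::'b set). A \<in> sets borel \<and> B \<in> sets borel}"
      by (rule image_subsetI, rule CollectI, rule exI[of _ UNIV], rule exI[of _ UNIV]) simp
    show "emeasure (M \<omega> \<Otimes>\<^sub>M N \<omega>) UNIV < \<infinity>" if "\<omega> \<in> space P" for \<omega> and n :: nat
    proof -
      interpret M: finite_measure "M \<omega>" using that M by simp
      interpret N: finite_measure "N \<omega>" using that N by simp
      show ?thesis using rect[OF that, of UNIV UNIV] M.emeasure_finite[of UNIV] N.emeasure_finite[of UNIV]
        by (simp add: ennreal_mult_eq_top_iff less_top[symmetric] del: M.emeasure_finite N.emeasure_finite)
    qed
    show "Z \<in> sigma_sets UNIV {A \<times> B | A B. A \<in> sets borel \<and> B \<in> sets borel}"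
      using that unfolding borel_rectangles .
  qed (auto simp: incseq_def)
  then show ?thesis using s by (simp add: borel_kernel_def)
qed

section \<open>Stationary flows and periodization\<close>

locale stationary_flow =
  fixes G :: "('m::{metric_space, second_countable_topology} \<Rightarrow> 'm) set"
    and P :: "'w measure" and \<theta> :: "('m \<Rightarrow> 'm) \<Rightarrow> 'w \<Rightarrow> 'w"
  assumes lc: "locally compact (UNIV :: 'm set)"
    and prob: "prob_space P" and space_P: "space P = UNIV"
    and G_id: "id \<in> G" and G_comp: "f \<in> G \<Longrightarrow> h \<in> G \<Longrightarrow> f \<circ> h \<in> G" and G_inv: "f \<in> G \<Longrightarrow> inv f \<in> G"
    and G_bij: "f \<in> G \<Longrightarrow> bij f" and G_dist: "f \<in> G \<Longrightarrow> dist (f x) (f y) = dist x y"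
    and G_proper: "compact K \<Longrightarrow> finite {f\<in>G. f x \<in> K}"
    and G_free: "f \<in> G \<Longrightarrow> f x = x \<Longrightarrow> f = id"
    and \<theta>_measurable: "f \<in> G \<Longrightarrow> \<theta> f \<in> P \<rightarrow>\<^sub>M P"
    and \<theta>_stationary: "f \<in> G \<Longrightarrow> distr P P (\<theta> f) = P"
    and \<theta>_id: "\<theta> id \<omega> = \<omega>"
    and \<theta>_comp: "f \<in> G \<Longrightarrow> h \<in> G \<Longrightarrow> \<theta> f (\<theta> h \<omega>) = \<theta> (f \<circ> h) \<omega>"
begin

lemma inv_apply [simp]: "f \<in> G \<Longrightarrow> f (inv f x) = x" "f \<in> G \<Longrightarrow> inv f (f x) = x" "f \<in> G \<Longrightarrow> inv (inv f) = f"
  using G_bij by (auto simp: bij_is_surj surj_f_inv_f bij_is_inj inv_f_f inv_inv_eq)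

lemma G_continuous: "f \<in> G \<Longrightarrow> continuous_on S f"
  unfolding continuous_on_iff by (auto simp: G_dist)

lemma G_measurable: "f \<in> G \<Longrightarrow> f \<in> borel_measurable borel"
  by (intro borel_measurable_continuous_onI G_continuous)

lemma image_eq_vimage_inv: "f \<in> G \<Longrightarrow> f ` U = inv f -` U"
  using bij_vimage_eq_inv_image[OF bij_imp_bij_inv[OF G_bij], of f U] by simp

lemma countable_G: "countable G"
proof -
  obtain V :: "nat \<Rightarrow> 'm set" where V: "\<And>n. compact (closure (V n))" "(\<Union>n. V n) = UNIV"
    using open_exhaustion[OF lc] by metis
  obtain x :: 'm where "True" by simp
  have "G \<subseteq> (\<Union>n. {f\<in>G. f x \<in> closure (V n)})"
  proof
    fix f assume f: "f \<in> G"
    have "f x \<in> (\<Union>n. V n)" using V(2) by simp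
    then obtain n where "f x \<in> V n" by blast
    then have "f x \<in> closure (V n)" using closure_subset by blast
    then show "f \<in> (\<Union>n. {f\<in>G. f x \<in> closure (V n)})" using f by blast
  qed
  moreover have "countable (\<Union>n. {f\<in>G. f x \<in> closure (V n)})"
    using G_proper[OF V(1)] by (intro countable_UN) (auto intro: countable_finite)
  ultimately show ?thesis by (rule countable_subset)
qed

text \<open>Proper discontinuity extends from points to compact sets, because the elements of \<open>G\<close> are
  isometries: cover \<open>K\<close> by balls that are small enough for a neighbourhood of \<open>L\<close> to be compact.\<close>

lemma finite_meets_compact:
  assumes K: "compact K" and L: "compact L"
  shows "finite {f\<in>G. f ` K \<inter> L \<noteq> {}}"
proof -
  obtain V :: "nat \<Rightarrow> 'm set" where V: "\<And>n. open (V n)" "\<And>n. compact (closure (V n))"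
    "\<And>K. compact K \<Longrightarrow> \<exists>n. K \<subseteq> V n"
    using open_exhaustion[OF lc] by metis
  obtain n where n: "L \<subseteq> V n" using V(3)[OF L] by auto
  obtain e where e: "e > 0" "\<And>x y. x \<in> L \<Longrightarrow> dist y x < e \<Longrightarrow> y \<in> V n"
  proof -
    obtain e where "0 < e" and e: "\<And>x. x \<in> L \<Longrightarrow> \<exists>G\<in>{V n}. ball x e \<subseteq> G"
      using Heine_Borel_lemma[OF L, of "{V n}"] n V(1) by (metis Union_insert Union_empty Un_empty_right singletonD)
    show ?thesis
    proof (rule that[OF \<open>0 < e\<close>])
      fix x y assume "x \<in> L" "dist y x < e"
      then show "y \<in> V n" using e[of x] by (auto simp: dist_commute)
    qed
  qed
  have "K \<subseteq> (\<Union>x\<in>K. ball x e)" using e(1) by auto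
  then obtain C where C: "C \<subseteq> K" "finite C" "K \<subseteq> (\<Union>x\<in>C. ball x e)"
    by (rule compactE_image[OF K open_ball])
  have "{f\<in>G. f ` K \<inter> L \<noteq> {}} \<subseteq> (\<Union>x\<in>C. {f\<in>G. f x \<in> closure (V n)})"
  proof
    fix f assume "f \<in> {f\<in>G. f ` K \<inter> L \<noteq> {}}"
    then obtain y where y: "f \<in> G" "y \<in> K" "f y \<in> L" by auto
    then obtain x where x: "x \<in> C" "dist x y < e" using C(3) by auto
    then have "f x \<in> V n" using y by (intro e(2)[of "f y"]) (simp_all add: G_dist)
    then have "f x \<in> closure (V n)" using closure_subset by blast
    then show "f \<in> (\<Union>x\<in>C. {f\<in>G. f x \<in> closure (V n)})" using x y by blast
  qed
  then show ?thesis by (rule finite_subset) (use C(2) G_proper[OF V(2)] in blast)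
qed

text \<open>A set that is disjoint from all its other translates. Fundamental regions and small open sets
  are of this kind, and one such side makes the translates of a rectangle disjoint.\<close>

definition moved :: "'m set \<Rightarrow> bool" where
  "moved U \<longleftrightarrow> (\<forall>f\<in>G. f \<noteq> id \<longrightarrow> U \<inter> f ` U = {})"

lemma moved_disjoint:
  assumes U: "moved U" and fh: "f \<in> G" "h \<in> G" "inv f x \<in> U" "inv h x \<in> U"
  shows "f = h"
proof -
  have "inv f \<circ> h \<in> G" using fh G_inv G_comp by auto
  moreover have "inv f x = (inv f \<circ> h) (inv h x)" using fh by simp
  then have "U \<inter> (inv f \<circ> h) ` U \<noteq> {}" using fh by blast
  ultimately have "inv f \<circ> h = id" using U unfolding moved_def by blast
  then have "h y = f y" for y using fh by (metis comp_apply id_apply inv_apply(1))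
  then show ?thesis by auto
qed

text \<open>The orbit of \<open>x\<close> is discrete and the action is free, so \<open>x\<close> has a positive distance from its
  other translates.\<close>

lemma moved_nbhd: "\<exists>U. open U \<and> x \<in> U \<and> moved U"
proof -
  obtain e where e: "e > 0" "compact (cball x e)" by (rule locally_compact_cball[OF lc])
  define F where "F = {f\<in>G. f x \<in> cball x e} - {id}"
  have F: "finite F" using G_proper[OF e(2), of x] by (simp add: F_def)
  define d where "d = Min (insert e ((\<lambda>f. dist x (f x)) ` F))"
  have "dist x (f x) > 0" if "f \<in> F" for f using G_free[of f x] that by (auto simp: F_def)
  then have d: "d > 0" using F e by (simp add: d_def)
  have far: "d \<le> dist x (f x)" if "f \<in> G" "f \<noteq> id" for f
  proof (cases "f \<in> F")
    case True then show ?thesis using F by (simp add: d_def)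
  next
    case False
    then have "e < dist x (f x)" using that by (auto simp: F_def)
    moreover have "d \<le> e" using F by (simp add: d_def)
    ultimately show ?thesis by simp
  qed
  have "moved (ball x (d/2))"
    unfolding moved_def
  proof (intro ballI impI, rule ccontr)
    fix f assume f: "f \<in> G" "f \<noteq> id" and "ball x (d/2) \<inter> f ` ball x (d/2) \<noteq> {}"
    then obtain y where y: "dist x (f y) < d/2" "dist x y < d/2" by auto
    have "dist x (f x) \<le> dist x (f y) + dist (f x) (f y)" by (rule dist_triangle2)
    also have "\<dots> < d" using y f by (simp add: G_dist)
    finally show False using far[OF f] by simp
  qed
  then show ?thesis using d by (intro exI[of _ "ball x (d/2)"]) auto
qed

lemma fundamental_moved: "fundamental_region G F \<Longrightarrow> moved F"
  by (simp add: fundamental_region_def moved_def)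

lemma fundamental_count:
  assumes F: "fundamental_region G F" shows "(\<integral>\<^sup>+f. indicator F (f y) \<partial>count_space G) = 1"
proof -
  have "y \<in> (\<Union>f\<in>G. f ` F)" using F by (simp add: fundamental_region_def)
  then obtain h z where h: "h \<in> G" "z \<in> F" "y = h z" by blast
  have "f = inv h" if "f \<in> G" "f y \<in> F" for f
    using moved_disjoint[OF fundamental_moved[OF F], of "inv f" h y] that h G_inv
    by (metis inv_apply(2,3))
  then have "(\<integral>\<^sup>+f. indicator F (f y) \<partial>count_space G) = (\<Sum>f\<in>{inv h}. indicator F (f y))"
    using h G_inv by (intro nn_integral_count_space') (auto simp: indicator_def)
  then show ?thesis using h by simp
qed

text \<open>Used for the diagonal action on \<open>M \<times> M\<close>.\<close>

definition action :: "(('m \<Rightarrow> 'm) \<Rightarrow> 'x::topological_space \<Rightarrow> 'x) \<Rightarrow> bool" where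
  "action a \<longleftrightarrow> (\<forall>f\<in>G. a f \<in> borel_measurable borel) \<and> a id = id \<and>
     (\<forall>f\<in>G. \<forall>h\<in>G. a (f \<circ> h) = a f \<circ> a h)"

abbreviation diag :: "('m \<Rightarrow> 'm) \<Rightarrow> 'm \<times> 'm \<Rightarrow> 'm \<times> 'm" where
  "diag f \<equiv> map_prod f f"

lemma diag_continuous: "f \<in> G \<Longrightarrow> continuous_on S (diag f)"
  unfolding map_prod_def case_prod_beta
  by (intro continuous_intros continuous_on_compose2[OF G_continuous[of f UNIV]]) auto

lemma action_diag: "action diag"
  by (auto simp: action_def map_prod.comp map_prod.id intro!: borel_measurable_continuous_onI diag_continuous)

context
  fixes a :: "('m \<Rightarrow> 'm) \<Rightarrow> 'x::topological_space \<Rightarrow> 'x" assumes a: "action a"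
begin

lemma action_measurable: "f \<in> G \<Longrightarrow> a f \<in> borel_measurable borel"
  using a by (auto simp: action_def)

lemma action_inv: "f \<in> G \<Longrightarrow> a f (a (inv f) z) = z" "f \<in> G \<Longrightarrow> a (inv f) (a f z) = z"
proof -
  assume f: "f \<in> G"
  then have "inv f \<circ> f = id" "f \<circ> inv f = id" by (auto simp: fun_eq_iff)
  then have "a f \<circ> a (inv f) = id" "a (inv f) \<circ> a f = id" using f G_inv a unfolding action_def by metis+
  then show "a f (a (inv f) z) = z" "a (inv f) (a f z) = z" by (simp_all add: fun_eq_iff)
qed

text \<open>The periodization of \<open>A\<close>: each \<open>f\<close> contributes the image under \<open>f\<close> of what \<open>A\<close> does in the
  environment \<open>\<theta> (inv f) \<omega>\<close>, which is \<open>\<omega>\<close> as seen from the translate by \<open>f\<close>. This makes the sum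
  invariant.\<close>

definition per :: "('w \<Rightarrow> 'x measure) \<Rightarrow> 'w \<Rightarrow> 'x measure" where
  "per A \<omega> = sum_measure G (\<lambda>f. distr (A (\<theta> (inv f) \<omega>)) borel (a f))"

lemma sets_per [simp]: "sets (per A \<omega>) = sets borel"
  by (simp add: per_def)

lemma kernel_shift:
  assumes "borel_kernel P A" "f \<in> G" shows "borel_kernel P (\<lambda>\<omega>. A (\<theta> f \<omega>))"
  using assms \<theta>_measurable[OF assms(2)] measurable_compose[OF \<theta>_measurable[OF assms(2)]]
  by (auto simp: borel_kernel_def space_P)

lemma kernel_per:
  assumes A: "borel_kernel P A" shows "borel_kernel P (per A)"
  unfolding per_def
  by (intro kernel_sum_measure countable_G kernel_distr kernel_shift[OF A] G_inv action_measurable)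

lemma emeasure_per:
  assumes A: "borel_kernel P A" and Z: "Z \<in> sets borel"
  shows "emeasure (per A \<omega>) Z = (\<integral>\<^sup>+f. emeasure (A (\<theta> (inv f) \<omega>)) (a f -` Z) \<partial>count_space G)"
  using Z kernel_sets[OF A] action_measurable unfolding per_def
  by (subst emeasure_sum_measure) (auto intro!: nn_integral_cong simp: emeasure_distr_borel space_P)

text \<open>Unfolding: integrating a periodization against a function is integrating the original
  against the periodized function, by stationarity.\<close>

lemma nn_integral_per:
  assumes A: "borel_kernel P A" and F: "F \<in> borel_measurable borel"
  shows "(\<integral>\<^sup>+\<omega>. \<integral>\<^sup>+z. F z \<partial>per A \<omega> \<partial>P) = (\<integral>\<^sup>+\<omega>. \<integral>\<^sup>+z. (\<integral>\<^sup>+f. F (a f z) \<partial>count_space G) \<partial>A \<omega> \<partial>P)"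
proof -
  have sA: "sets (A \<omega>) = sets borel" for \<omega> using kernel_sets[OF A] by (simp add: space_P)
  have Fa: "(\<lambda>z. F (a f z)) \<in> borel_measurable borel" if "f \<in> G" for f
    using measurable_compose[OF action_measurable[OF that] F] .
  have "(\<integral>\<^sup>+\<omega>. \<integral>\<^sup>+z. F z \<partial>per A \<omega> \<partial>P)
      = (\<integral>\<^sup>+\<omega>. \<integral>\<^sup>+f. (\<integral>\<^sup>+z. F (a f z) \<partial>A (\<theta> (inv f) \<omega>)) \<partial>count_space G \<partial>P)"
    unfolding per_def using F sA action_measurable
    by (intro nn_integral_cong, subst nn_integral_sum_measure)
      (auto intro!: nn_integral_cong simp: nn_integral_distr_borel countable_G)
  also have "\<dots> = (\<integral>\<^sup>+f. \<integral>\<^sup>+\<omega>. (\<integral>\<^sup>+z. F (a f z) \<partial>A (\<theta> (inv f) \<omega>)) \<partial>P \<partial>count_space G)"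
    by (intro nn_integral_count_space_nn_integral countable_G kernel_nn_integral[OF kernel_shift[OF A]] G_inv Fa)
  also have "\<dots> = (\<integral>\<^sup>+f. \<integral>\<^sup>+\<omega>. (\<integral>\<^sup>+z. F (a f z) \<partial>A \<omega>) \<partial>P \<partial>count_space G)"
  proof (rule nn_integral_cong)
    fix f assume "f \<in> space (count_space G)"
    then have f: "f \<in> G" by simp
    have "(\<integral>\<^sup>+\<omega>. (\<integral>\<^sup>+z. F (a f z) \<partial>A \<omega>) \<partial>distr P P (\<theta> (inv f))) = (\<integral>\<^sup>+\<omega>. (\<integral>\<^sup>+z. F (a f z) \<partial>A (\<theta> (inv f) \<omega>)) \<partial>P)"
      using kernel_nn_integral[OF A Fa[OF f]] f by (intro nn_integral_distr \<theta>_measurable G_inv) simp_all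
    then show "(\<integral>\<^sup>+\<omega>. (\<integral>\<^sup>+z. F (a f z) \<partial>A (\<theta> (inv f) \<omega>)) \<partial>P) = (\<integral>\<^sup>+\<omega>. (\<integral>\<^sup>+z. F (a f z) \<partial>A \<omega>) \<partial>P)"
      using \<theta>_stationary[OF G_inv[OF f]] by simp
  qed
  also have "\<dots> = (\<integral>\<^sup>+\<omega>. \<integral>\<^sup>+f. (\<integral>\<^sup>+z. F (a f z) \<partial>A \<omega>) \<partial>count_space G \<partial>P)"
    by (intro nn_integral_count_space_nn_integral[symmetric] countable_G kernel_nn_integral[OF A] Fa)
  also have "\<dots> = (\<integral>\<^sup>+\<omega>. \<integral>\<^sup>+z. (\<integral>\<^sup>+f. F (a f z) \<partial>count_space G) \<partial>A \<omega> \<partial>P)"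
    using Fa by (intro nn_integral_cong nn_integral_count_space_nn_integral[symmetric] countable_G)
      (simp add: measurable_cong_sets[OF sA refl])
  finally show ?thesis .
qed

lemma per_shift:
  assumes A: "borel_kernel P A" and h: "h \<in> G"
  shows "per A (\<theta> h \<omega>) = distr (per A \<omega>) borel (a h)"
proof (rule measure_eqI)
  fix Z assume "Z \<in> sets (per A (\<theta> h \<omega>))"
  then have Z: "Z \<in> sets borel" by simp
  have bij: "bij_betw (\<lambda>f. h \<circ> f) G G"
    by (rule bij_betw_byWitness[where f'="\<lambda>f. inv h \<circ> f"])
      (use h G_inv G_comp in \<open>auto simp: fun_eq_iff\<close>)
  have "emeasure (per A (\<theta> h \<omega>)) Z = (\<integral>\<^sup>+f. emeasure (A (\<theta> (inv f) (\<theta> h \<omega>))) (a f -` Z) \<partial>count_space G)"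
    by (rule emeasure_per[OF A Z])
  also have "\<dots> = (\<integral>\<^sup>+f. emeasure (A (\<theta> (inv (h \<circ> f)) (\<theta> h \<omega>))) (a (h \<circ> f) -` Z) \<partial>count_space G)"
    by (rule nn_integral_bij_count_space[OF bij, symmetric])
  also have "\<dots> = (\<integral>\<^sup>+f. emeasure (A (\<theta> (inv f) \<omega>)) (a f -` (a h -` Z)) \<partial>count_space G)"
  proof (rule nn_integral_cong)
    fix f assume "f \<in> space (count_space G)"
    then have f: "f \<in> G" by simp
    have "inv (h \<circ> f) \<circ> h = inv f"
      using o_inv_distrib[OF G_bij[OF h] G_bij[OF f]] h by (auto simp: fun_eq_iff)
    then have "\<theta> (inv (h \<circ> f)) (\<theta> h \<omega>) = \<theta> (inv f) \<omega>"
      using f h by (simp add: \<theta>_comp G_inv G_comp)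
    moreover have "a (h \<circ> f) -` Z = a f -` (a h -` Z)"
      using a f h by (auto simp: action_def)
    ultimately show "emeasure (A (\<theta> (inv (h \<circ> f)) (\<theta> h \<omega>))) (a (h \<circ> f) -` Z) = emeasure (A (\<theta> (inv f) \<omega>)) (a f -` (a h -` Z))"
      by simp
  qed
  also have "\<dots> = emeasure (per A \<omega>) (a h -` Z)"
    using vimage_borel[OF action_measurable[OF h] Z] by (rule emeasure_per[OF A, symmetric])
  also have "\<dots> = emeasure (distr (per A \<omega>) borel (a h)) Z"
    using Z h by (intro emeasure_distr_borel[symmetric] action_measurable) auto
  finally show "emeasure (per A (\<theta> h \<omega>)) Z = emeasure (distr (per A \<omega>) borel (a h)) Z" .
qed simp

definition invariant :: "('w \<Rightarrow> 'x measure) \<Rightarrow> bool" where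
  "invariant q \<longleftrightarrow> (\<forall>f\<in>G. \<forall>\<omega>. q (\<theta> f \<omega>) = distr (q \<omega>) borel (a f))"

lemma invariant_emeasure:
  assumes q: "borel_kernel P q" "invariant q" and f: "f \<in> G" and Z: "Z \<in> sets borel"
  shows "emeasure (q (\<theta> (inv f) \<omega>)) (a f -` Z) = emeasure (q \<omega>) Z"
proof -
  have "emeasure (q (\<theta> (inv f) \<omega>)) (a f -` Z) = emeasure (distr (q \<omega>) borel (a (inv f))) (a f -` Z)"
    using q(2) f G_inv by (simp add: invariant_def)
  also have "\<dots> = emeasure (q \<omega>) (a (inv f) -` (a f -` Z))"
    using kernel_sets[OF q(1)] f Z
    by (intro emeasure_distr_borel action_measurable G_inv vimage_borel) (auto simp: space_P)
  also have "a (inv f) -` (a f -` Z) = Z" using action_inv[OF f] by auto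
  finally show ?thesis .
qed

text \<open>For an invariant kernel, the translate of the restriction to \<open>W\<close> is the restriction to the
  translate of \<open>W\<close>.\<close>

lemma per_restr:
  assumes q: "borel_kernel P q" "invariant q" and W: "W \<in> sets borel"
    and disj: "disjoint_family_on (\<lambda>f. a (inv f) -` W) G" and Z: "Z \<in> sets borel"
  shows "emeasure (per (\<lambda>\<omega>. restr (q \<omega>) W) \<omega>) Z = emeasure (q \<omega>) ((\<Union>f\<in>G. a (inv f) -` W) \<inter> Z)"
proof -
  have sq: "sets (q \<omega>) = sets borel" for \<omega> using kernel_sets[OF q(1)] by (simp add: space_P)
  have W': "a (inv f) -` W \<in> sets borel" if "f \<in> G" for f
    using vimage_borel[OF action_measurable[OF G_inv[OF that]] W] .
  have "emeasure (per (\<lambda>\<omega>. restr (q \<omega>) W) \<omega>) Z = (\<integral>\<^sup>+f. emeasure (restr (q (\<theta> (inv f) \<omega>)) W) (a f -` Z) \<partial>count_space G)"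
    by (intro emeasure_per kernel_restr q W Z)
  also have "\<dots> = (\<integral>\<^sup>+f. emeasure (q \<omega>) (a (inv f) -` W \<inter> Z) \<partial>count_space G)"
  proof (rule nn_integral_cong)
    fix f assume "f \<in> space (count_space G)"
    then have f: "f \<in> G" by simp
    have "emeasure (restr (q (\<theta> (inv f) \<omega>)) W) (a f -` Z) = emeasure (q (\<theta> (inv f) \<omega>)) (W \<inter> a f -` Z)"
      by (intro emeasure_restr sq W vimage_borel action_measurable f Z)
    also have "W \<inter> a f -` Z = a f -` (a (inv f) -` W \<inter> Z)" using action_inv[OF f] by auto
    also have "emeasure (q (\<theta> (inv f) \<omega>)) \<dots> = emeasure (q \<omega>) (a (inv f) -` W \<inter> Z)"
      by (intro invariant_emeasure q f sets.Int W' Z)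
    finally show "emeasure (restr (q (\<theta> (inv f) \<omega>)) W) (a f -` Z) = emeasure (q \<omega>) (a (inv f) -` W \<inter> Z)" .
  qed
  also have "\<dots> = emeasure (q \<omega>) (\<Union>f\<in>G. a (inv f) -` W \<inter> Z)"
    using disj W' Z sq countable_G
    by (intro emeasure_UN_countable[symmetric]) (auto simp: disjoint_family_on_def)
  also have "(\<Union>f\<in>G. a (inv f) -` W \<inter> Z) = (\<Union>f\<in>G. a (inv f) -` W) \<inter> Z" by blast
  finally show ?thesis .
qed

lemma per_mono_cmult:
  assumes A: "borel_kernel P A" and B: "borel_kernel P B" and Z: "Z \<in> sets borel"
    and le: "\<And>\<omega> Z. Z \<in> sets borel \<Longrightarrow> emeasure (A \<omega>) Z \<le> c * emeasure (B \<omega>) Z"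
  shows "emeasure (per A \<omega>) Z \<le> c * emeasure (per B \<omega>) Z"
proof -
  have "emeasure (per A \<omega>) Z \<le> (\<integral>\<^sup>+f. c * emeasure (B (\<theta> (inv f) \<omega>)) (a f -` Z) \<partial>count_space G)"
    unfolding emeasure_per[OF A Z]
    by (intro nn_integral_mono le vimage_borel action_measurable Z) simp
  also have "\<dots> = c * emeasure (per B \<omega>) Z"
    unfolding emeasure_per[OF B Z] by (intro nn_integral_cmult) simp
  finally show ?thesis .
qed

lemma per_restr_le:
  assumes q: "borel_kernel P q" "invariant q" and W: "W \<in> sets borel"
    and disj: "disjoint_family_on (\<lambda>f. a (inv f) -` W) G"
    and w: "w \<in> borel_measurable P" "\<And>\<omega>. w \<omega> \<le> c" and Z: "Z \<in> sets borel"
  shows "emeasure (per (\<lambda>\<omega>. scale_measure (w \<omega>) (restr (q \<omega>) W)) \<omega>) Z \<le> c * emeasure (q \<omega>) Z"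
proof -
  have "emeasure (per (\<lambda>\<omega>. scale_measure (w \<omega>) (restr (q \<omega>) W)) \<omega>) Z \<le> c * emeasure (per (\<lambda>\<omega>. restr (q \<omega>) W) \<omega>) Z"
    by (intro per_mono_cmult kernel_scale kernel_restr q W w Z) (auto intro: mult_right_mono w)
  also have "\<dots> \<le> c * emeasure (q \<omega>) Z"
    unfolding per_restr[OF q W disj Z]
    using kernel_sets[OF q(1)] Z by (intro mult_left_mono emeasure_mono) (auto simp: space_P)
  finally show ?thesis .
qed

end

lemma diag_vimage_Times: "diag f -` (A \<times> B) = (f -` A) \<times> (f -` B)"
  by auto

lemma moved_disjoint_diag:
  assumes "moved U" shows "disjoint_family_on (\<lambda>f. diag (inv f) -` (U \<times> V)) G"
    "disjoint_family_on (\<lambda>f. diag (inv f) -` (V \<times> U)) G" "disjoint_family_on (\<lambda>f. inv f -` U) G"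
  using moved_disjoint[OF assms] unfolding disjoint_family_on_def by auto

lemma lc2: "locally compact (UNIV :: ('m \<times> 'm) set)"
  by (rule locally_compact_Times[OF lc lc])

lemma exhaustion_Times:
  obtains V :: "nat \<Rightarrow> 'm set" where "\<forall>n. open (V n)" "\<forall>n. compact (closure (V n))" "incseq V"
    "(\<Union>n. V n) = UNIV" "incseq (\<lambda>n. V n \<times> V n)" "(\<Union>n. V n \<times> V n) = UNIV" "\<forall>n. V n \<times> V n \<in> sets borel"
proof -
  obtain V :: "nat \<Rightarrow> 'm set" where V: "\<And>n. open (V n)" "\<And>n. compact (closure (V n))" "incseq V"
    "(\<Union>n. V n) = UNIV" using open_exhaustion[OF lc] by metis
  have inc: "incseq (\<lambda>n. V n \<times> V n)" using V(3) unfolding incseq_def by (auto simp: subset_iff)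
  have "z \<in> (\<Union>n. V n \<times> V n)" for z :: "'m \<times> 'm"
  proof -
    have "fst z \<in> (\<Union>n. V n)" "snd z \<in> (\<Union>n. V n)" using V(4) by auto
    then obtain i j where "fst z \<in> V i" "snd z \<in> V j" by blast
    then have "fst z \<in> V (max i j)" "snd z \<in> V (max i j)"
      using incseqD[OF V(3), of i "max i j"] incseqD[OF V(3), of j "max i j"] by auto
    then show ?thesis by (intro UN_I[of "max i j"]) (auto simp: mem_Times_iff)
  qed
  then have un: "(\<Union>n. V n \<times> V n) = UNIV" by blast
  show thesis
    by (rule that[of V]) (use V inc un in \<open>auto intro!: borel_open open_Times\<close>)
qed

lemma radon_rectangle_finite:
  assumes q: "q \<in> radon_measures" and "compact (closure U)" "compact (closure V)"
  shows "emeasure q (U \<times> V) < (\<infinity>::ennreal)"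
proof -
  have "emeasure q (U \<times> V) \<le> emeasure q (closure U \<times> closure V)"
    using radon_measure_sets[OF q] closure_subset[of U] closure_subset[of V]
    by (intro emeasure_mono Sigma_mono) (auto intro!: borel_closed closed_Times)
  also have "\<dots> < \<infinity>" using assms by (intro radon_measure_finite compact_Times)
  finally show ?thesis .
qed

text \<open>Equivariance is given on rectangles, which generate the Borel sets of the product.\<close>

lemma equivariant2_invariant:
  assumes rad: "\<And>\<omega>. q \<omega> \<in> radon_measures" and eq: "equivariant2 G \<theta> q"
  shows "invariant diag q"
  unfolding invariant_def[OF action_diag]
proof (intro ballI allI)
  fix f \<omega> assume f: "f \<in> G"
  obtain V :: "nat \<Rightarrow> 'm set" where V: "\<forall>n. open (V n)" "\<forall>n. compact (closure (V n))" "incseq V"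
    "(\<Union>n. V n) = UNIV" "incseq (\<lambda>n. V n \<times> V n)" "(\<Union>n. V n \<times> V n) = UNIV" "\<forall>n. V n \<times> V n \<in> sets borel"
    by (rule exhaustion_Times)
  have s: "sets (q \<omega>) = sets borel" for \<omega> using rad by (simp add: radon_measure_sets)
  let ?E = "{A \<times> B | (A::'m set) (B::'m set). A \<in> sets borel \<and> B \<in> sets borel}"
  show "q (\<theta> f \<omega>) = distr (q \<omega>) borel (diag f)"
  proof (rule measure_eqI_generator_eq[where E="?E" and \<Omega>=UNIV and A="\<lambda>n. V n \<times> V n"])
    show "Int_stable ?E"
      unfolding Int_stable_def by (clarsimp simp: Times_Int_Times) (blast intro: sets.Int)
    show "sets (q (\<theta> f \<omega>)) = sigma_sets UNIV ?E" "sets (distr (q \<omega>) borel (diag f)) = sigma_sets UNIV ?E"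
      using s borel_rectangles by auto
    show "range (\<lambda>n. V n \<times> V n) \<subseteq> ?E" using V(1) by (auto intro!: exI)
    show "emeasure (q (\<theta> f \<omega>)) (V n \<times> V n) \<noteq> \<infinity>" for n
      using radon_rectangle_finite[OF rad, of "V n" "V n"] V(2) by (simp add: less_top)
    fix X assume "X \<in> ?E"
    then obtain A B where X: "X = A \<times> B" "A \<in> sets borel" "B \<in> sets borel" by blast
    have "f -` A \<in> sets borel" "f -` B \<in> sets borel" using X f by (auto intro!: vimage_borel G_measurable)
    then have "emeasure (q (\<theta> f \<omega>)) (f ` (f -` A) \<times> f ` (f -` B)) = emeasure (q \<omega>) (f -` A \<times> f -` B)"
      using eq f unfolding equivariant2_def by blast
    moreover have "f ` (f -` A) = A" "f ` (f -` B) = B" using G_bij[OF f] by (auto simp: bij_is_surj surj_image_vimage_eq)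
    moreover have "emeasure (distr (q \<omega>) borel (diag f)) X = emeasure (q \<omega>) (f -` A \<times> f -` B)"
      unfolding X(1) diag_vimage_Times[symmetric] using X f s
      by (intro emeasure_distr_borel action_measurable[OF action_diag] rectangle_borel)
    ultimately show "emeasure (q (\<theta> f \<omega>)) X = emeasure (distr (q \<omega>) borel (diag f)) X" using X(1) by simp
  qed (use V in auto)
qed

lemma invariant_equivariant2:
  assumes q: "borel_kernel P q" "invariant diag q" shows "equivariant2 G \<theta> q"
  unfolding equivariant2_def
proof (intro ballI allI)
  fix f \<omega> and A B :: "'m set" assume f: "f \<in> G" and AB: "A \<in> sets borel" "B \<in> sets borel"
  have "f ` A \<in> sets borel" "f ` B \<in> sets borel"
    unfolding image_eq_vimage_inv[OF f] by (intro vimage_borel G_measurable G_inv f AB)+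
  then have "emeasure (distr (q \<omega>) borel (diag f)) (f ` A \<times> f ` B) = emeasure (q \<omega>) (diag f -` (f ` A \<times> f ` B))"
    using kernel_sets[OF q(1)] f
    by (intro emeasure_distr_borel action_measurable[OF action_diag] rectangle_borel) (auto simp: space_P)
  also have "diag f -` (f ` A \<times> f ` B) = A \<times> B"
    unfolding diag_vimage_Times by (simp add: inj_vimage_image_eq bij_is_inj G_bij f)
  finally show "emeasure (q (\<theta> f \<omega>)) (f ` A \<times> f ` B) = emeasure (q \<omega>) (A \<times> B)"
    using q(2) f by (simp add: invariant_def[OF action_diag])
qed

text \<open>Only finitely many translates of a compact set meet a given compact set, so locally the
  periodization is a finite sum.\<close>

lemma per_locally_finite:
  assumes A: "borel_kernel P A" and K: "compact K" "\<And>\<omega>. emeasure (A \<omega>) (- K) = 0"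
    and fin: "\<And>\<omega>. emeasure (A \<omega>) UNIV < \<infinity>" and L: "compact L"
  shows "emeasure (per diag A \<omega>) L < (\<infinity>::ennreal)"
proof -
  have sA: "sets (A \<omega>) = sets borel" for \<omega> using kernel_sets[OF A] by (simp add: space_P)
  define F where "F = {f\<in>G. f ` fst ` K \<inter> fst ` L \<noteq> {}}"
  have F: "finite F" unfolding F_def
    by (intro finite_meets_compact compact_continuous_image K L continuous_intros)
  have bL: "L \<in> sets borel" "K \<in> sets borel" using K L by (auto intro: borel_compact)
  have z: "emeasure (A (\<theta> (inv f) \<omega>)) (diag f -` L) = 0" if f: "f \<in> G" "f \<notin> F" for f
  proof -
    have "diag f -` L \<subseteq> - K"
    proof
      fix z assume z: "z \<in> diag f -` L"
      then have "f (fst z) \<in> fst ` L" by (metis fst_map_prod image_eqI vimageD)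
      then show "z \<in> - K" using f by (auto simp: F_def)
    qed
    then have "emeasure (A (\<theta> (inv f) \<omega>)) (diag f -` L) \<le> emeasure (A (\<theta> (inv f) \<omega>)) (- K)"
      using bL sA by (intro emeasure_mono) (auto simp: Compl_eq_Diff_UNIV)
    then show ?thesis using K(2) by simp
  qed
  have "emeasure (per diag A \<omega>) L = (\<Sum>f\<in>F. emeasure (A (\<theta> (inv f) \<omega>)) (diag f -` L))"
    unfolding emeasure_per[OF action_diag A bL(1)]
    by (intro nn_integral_count_space' F) (use z in \<open>auto simp: F_def\<close>)
  also have "\<dots> \<le> (\<Sum>f\<in>F. emeasure (A (\<theta> (inv f) \<omega>)) UNIV)"
    using sA by (intro sum_mono emeasure_mono) (auto simp: sets_eq_imp_space_eq[OF sA])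
  also have "\<dots> < \<infinity>" using F fin by simp
  finally show ?thesis .
qed

end

section \<open>Perturbing an optimal semicoupling\<close>

locale transport_flow = stationary_flow G P \<theta>
  for G :: "('m::{metric_space, second_countable_topology} \<Rightarrow> 'm) set"
    and P :: "'w measure" and \<theta> +
  fixes \<rho> :: "real \<Rightarrow> real" and lam mu :: "'w \<Rightarrow> 'm measure" and B\<^sub>0 :: "'m set"
  assumes \<rho>_cont: "continuous_on {0..} \<rho>" and \<rho>_nonneg: "0 \<le> r \<Longrightarrow> 0 \<le> \<rho> r"
    and random: "random_measure P lam" "random_measure P mu"
    and equivariant: "equivariant G \<theta> lam"
    and region: "fundamental_region G B\<^sub>0"
begin

lemma continuous_cost: "continuous_on S (\<lambda>z::'m \<times> 'm. \<rho> (dist (fst z) (snd z)))"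
  by (rule continuous_on_compose2[OF \<rho>_cont]) (auto intro!: continuous_intros)

lemma cost_eq: "cost \<rho> z = ennreal (\<rho> (dist (fst z) (snd z)))"
  by (simp add: cost_def case_prod_beta)

lemma cost_measurable [measurable]: "(cost \<rho> :: 'm \<times> 'm \<Rightarrow> ennreal) \<in> borel_measurable borel"
proof -
  have "(\<lambda>z::'m \<times> 'm. ennreal (\<rho> (dist (fst z) (snd z)))) \<in> borel_measurable borel"
    by (intro measurable_compose[OF borel_measurable_continuous_onI[OF continuous_cost] measurable_ennreal])
  then show ?thesis by (simp add: cost_eq[abs_def])
qed

lemma lam_kernel: "borel_kernel P lam" and mu_kernel: "borel_kernel P mu"
  using random random_measure_kernel[OF lc] by auto

lemma lam_radon: "lam \<omega> \<in> radon_measures"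
  using random_measure_radon[OF random(1)] by (simp add: space_P)

lemma lam_equivariant:
  assumes "f \<in> G" "Z \<in> sets borel" shows "emeasure (lam (\<theta> (inv f) \<omega>)) (f -` Z) = emeasure (lam \<omega>) Z"
proof -
  have "f -` Z = inv f ` Z" using image_eq_vimage_inv[OF G_inv[OF assms(1)], of Z] assms(1) by simp
  then show ?thesis using equivariant assms G_inv unfolding equivariant_def by metis
qed

definition region_cost :: "('w \<Rightarrow> ('m \<times> 'm) measure) \<Rightarrow> 'm set \<Rightarrow> ennreal" where
  "region_cost q F = (\<integral>\<^sup>+\<omega>. (\<integral>\<^sup>+z\<in>UNIV \<times> F. cost \<rho> z \<partial>q \<omega>) \<partial>P)"

lemma region_measurable: "fundamental_region G F \<Longrightarrow> UNIV \<times> F \<in> sets (borel :: ('m \<times> 'm) measure)"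
  by (intro rectangle_borel) (auto simp: fundamental_region_def)

lemma region_cost_per:
  assumes A: "borel_kernel P A" and F: "fundamental_region G F"
  shows "region_cost (per diag A) F = (\<integral>\<^sup>+\<omega>. \<integral>\<^sup>+z. cost \<rho> z \<partial>A \<omega> \<partial>P)"
proof -
  note [measurable] = region_measurable[OF F]
  have "region_cost (per diag A) F
      = (\<integral>\<^sup>+\<omega>. \<integral>\<^sup>+z. (\<integral>\<^sup>+f. cost \<rho> (diag f z) * indicator (UNIV \<times> F) (diag f z) \<partial>count_space G) \<partial>A \<omega> \<partial>P)"
    unfolding region_cost_def by (rule nn_integral_per[OF action_diag A]) measurable
  also have "\<dots> = (\<integral>\<^sup>+\<omega>. \<integral>\<^sup>+z. cost \<rho> z * (\<integral>\<^sup>+f. indicator F (f (snd z)) \<partial>count_space G) \<partial>A \<omega> \<partial>P)"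
    by (intro nn_integral_cong, subst nn_integral_cmult[symmetric])
      (auto intro!: nn_integral_cong simp: cost_eq G_dist indicator_def)
  finally show ?thesis by (simp add: fundamental_count[OF F])
qed

text \<open>An invariant kernel is the periodization of its restriction to targets in one fundamental
  region; hence the cost per region does not depend on the region.\<close>

lemma region_cost_independent:
  assumes q: "borel_kernel P q" "invariant diag q" and F: "fundamental_region G F" "fundamental_region G F'"
  shows "region_cost q F' = region_cost q F"
proof -
  have sq: "sets (q \<omega>) = sets borel" for \<omega> using kernel_sets[OF q(1)] by (simp add: space_P)
  have cover: "(\<Union>f\<in>G. diag (inv f) -` (UNIV \<times> F)) = UNIV"
  proof -
    have "z \<in> (\<Union>f\<in>G. diag (inv f) -` (UNIV \<times> F))" for z :: "'m \<times> 'm"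
    proof -
      have "snd z \<in> (\<Union>f\<in>G. f ` F)" using F(1) by (simp add: fundamental_region_def)
      then obtain f where "f \<in> G" "snd z \<in> f ` F" by blast
      then show ?thesis unfolding image_eq_vimage_inv[OF \<open>f \<in> G\<close>] by (auto simp: mem_Times_iff)
    qed
    then show ?thesis by blast
  qed
  have "per diag (\<lambda>\<omega>. restr (q \<omega>) (UNIV \<times> F)) = q"
  proof
    fix \<omega>
    show "per diag (\<lambda>\<omega>. restr (q \<omega>) (UNIV \<times> F)) \<omega> = q \<omega>"
    proof (rule measure_eqI)
      fix Z assume "Z \<in> sets (per diag (\<lambda>\<omega>. restr (q \<omega>) (UNIV \<times> F)) \<omega>)"
      then have Z: "Z \<in> sets borel" by (simp add: sets_per[OF action_diag])
      then show "emeasure (per diag (\<lambda>\<omega>. restr (q \<omega>) (UNIV \<times> F)) \<omega>) Z = emeasure (q \<omega>) Z"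
        unfolding per_restr[OF action_diag q region_measurable[OF F(1)] moved_disjoint_diag(2)[OF fundamental_moved[OF F(1)]] Z] cover
        by simp
    qed (simp add: sets_per[OF action_diag] sq)
  qed
  then have "region_cost q F' = (\<integral>\<^sup>+\<omega>. \<integral>\<^sup>+z. cost \<rho> z \<partial>restr (q \<omega>) (UNIV \<times> F) \<partial>P)"
    using region_cost_per[OF kernel_restr[OF q(1) region_measurable[OF F(1)]] F(2)] by simp
  also have "\<dots> = region_cost q F"
    unfolding region_cost_def
    by (intro nn_integral_cong nn_integral_restr sq region_measurable F cost_measurable)
  finally show ?thesis .
qed

abbreviation "semicouplings \<equiv> equivariant_semicouplings G P \<theta> lam mu"

lemma semicouplingsD:
  assumes q: "q \<in> semicouplings"
  shows "q \<omega> \<in> radon_measures" "borel_kernel P q" "invariant diag q" "sets (q \<omega>) = sets borel"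
    "AE \<omega> in P. \<forall>Z\<in>sets borel. emeasure (q \<omega>) (Z \<times> UNIV) \<le> emeasure (lam \<omega>) Z"
    "AE \<omega> in P. \<forall>Z\<in>sets borel. emeasure (q \<omega>) (UNIV \<times> Z) = emeasure (mu \<omega>) Z"
proof -
  have r: "random_measure P q" and s: "AE \<omega> in P. semicoupling (lam \<omega>) (mu \<omega>) (q \<omega>)" and e: "equivariant2 G \<theta> q"
    using q by (auto simp: equivariant_semicouplings_def random_semicoupling_def)
  show rad: "q \<omega> \<in> radon_measures" for \<omega> using random_measure_radon[OF r] by (simp add: space_P)
  then show sq: "sets (q \<omega>) = sets borel" for \<omega> by (simp add: radon_measure_sets)
  show "borel_kernel P q" by (rule random_measure_kernel[OF lc2 r])
  show "invariant diag q" by (rule equivariant2_invariant[OF rad e])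
  have f: "fst -` Z = Z \<times> (UNIV :: 'm set)" "snd -` Z = (UNIV :: 'm set) \<times> Z" for Z :: "'m set" by auto
  have "emeasure (distr (q \<omega>) borel fst) Z = emeasure (q \<omega>) (Z \<times> UNIV)"
    "emeasure (distr (q \<omega>) borel snd) Z = emeasure (q \<omega>) (UNIV \<times> Z)" if "Z \<in> sets borel" for Z \<omega>
    unfolding f[symmetric] using that by (auto intro!: emeasure_distr_borel sq borel_measurable_continuous_onI continuous_intros)
  note d = this
  show "AE \<omega> in P. \<forall>Z\<in>sets borel. emeasure (q \<omega>) (Z \<times> UNIV) \<le> emeasure (lam \<omega>) Z"
    using s by eventually_elim (simp add: semicoupling_def d)
  show "AE \<omega> in P. \<forall>Z\<in>sets borel. emeasure (q \<omega>) (UNIV \<times> Z) = emeasure (mu \<omega>) Z"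
    using s by eventually_elim (simp add: semicoupling_def d(2)[symmetric])
qed

lemma semicouplingsI:
  assumes q: "borel_kernel P q" "invariant diag q" and fin: "\<And>\<omega> K. compact K \<Longrightarrow> emeasure (q \<omega>) K < \<infinity>"
    and fst: "AE \<omega> in P. \<forall>Z\<in>sets borel. emeasure (q \<omega>) (Z \<times> UNIV) \<le> emeasure (lam \<omega>) Z"
    and snd: "AE \<omega> in P. \<forall>Z\<in>sets borel. emeasure (q \<omega>) (UNIV \<times> Z) = emeasure (mu \<omega>) Z"
  shows "q \<in> semicouplings"
proof -
  have sq: "sets (q \<omega>) = sets borel" for \<omega> using kernel_sets[OF q(1)] by (simp add: space_P)
  have r: "random_measure P q"
    by (intro random_measureI lc2 locally_finite_imp_radon sq fin kernel_emeasure[OF q(1)])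
  have f: "fst -` Z = Z \<times> (UNIV :: 'm set)" "snd -` Z = (UNIV :: 'm set) \<times> Z" for Z :: "'m set" by auto
  have d: "emeasure (distr (q \<omega>) borel fst) Z = emeasure (q \<omega>) (Z \<times> UNIV)"
    "emeasure (distr (q \<omega>) borel snd) Z = emeasure (q \<omega>) (UNIV \<times> Z)" if "Z \<in> sets borel" for Z \<omega>
    unfolding f[symmetric] using that by (auto intro!: emeasure_distr_borel sq borel_measurable_continuous_onI continuous_intros)
  have "AE \<omega> in P. semicoupling (lam \<omega>) (mu \<omega>) (q \<omega>)"
    using fst snd
  proof eventually_elim
    case (elim \<omega>)
    have "distr (q \<omega>) borel snd = mu \<omega>"
      by (rule measure_eqI) (use kernel_sets[OF mu_kernel, of \<omega>] elim d in \<open>auto simp: space_P\<close>)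
    then show ?case using elim d sq by (simp add: semicoupling_def)
  qed
  then show ?thesis using r invariant_equivariant2[OF q]
    by (simp add: equivariant_semicouplings_def random_semicoupling_def)
qed

text \<open>The exchange step: the mass of \<open>per R\<close> is taken out of \<open>q\<close> and the mass of \<open>per A\<close> is put in.
  The result is again an equivariant semicoupling if \<open>A\<close> and \<open>R\<close> have the same targets and enough
  source mass is available, and unfolding computes its cost.\<close>

lemma exchange:
  assumes q: "q \<in> semicouplings" and R: "borel_kernel P R" and A: "borel_kernel P A"
    and le: "\<And>\<omega> Z. Z \<in> sets borel \<Longrightarrow> emeasure (per diag R \<omega>) Z \<le> emeasure (q \<omega>) Z"
    and fin: "\<And>\<omega> K. compact K \<Longrightarrow> emeasure (per diag A \<omega>) K < \<infinity>"
    and snd: "\<And>\<omega> Z. Z \<in> sets borel \<Longrightarrow> emeasure (A \<omega>) (UNIV \<times> Z) = emeasure (R \<omega>) (UNIV \<times> Z)"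
    and fst: "AE \<omega> in P. \<forall>Z\<in>sets borel. emeasure (per diag A \<omega>) (Z \<times> UNIV) + emeasure (q \<omega>) (Z \<times> UNIV)
                \<le> emeasure (lam \<omega>) Z + emeasure (per diag R \<omega>) (Z \<times> UNIV)"
  shows "\<exists>q'\<in>semicouplings. region_cost q' B\<^sub>0 + (\<integral>\<^sup>+\<omega>. \<integral>\<^sup>+z. cost \<rho> z \<partial>R \<omega> \<partial>P)
            = region_cost q B\<^sub>0 + (\<integral>\<^sup>+\<omega>. \<integral>\<^sup>+z. cost \<rho> z \<partial>A \<omega> \<partial>P)"
proof -
  note qD = semicouplingsD[OF q]
  obtain V :: "nat \<Rightarrow> 'm set" where V: "\<forall>n. open (V n)" "\<forall>n. compact (closure (V n))" "incseq V"
    "(\<Union>n. V n) = UNIV" "incseq (\<lambda>n. V n \<times> V n)" "(\<Union>n. V n \<times> V n) = UNIV" "\<forall>n. V n \<times> V n \<in> sets borel"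
    by (rule exhaustion_Times)
  have Vfin: "emeasure (q \<omega>) (V n \<times> V n) < \<infinity>" for n \<omega>
    using V(2) by (intro radon_rectangle_finite qD(1)) auto
  note sp [simp] = sets_per[OF action_diag]
  have kR: "borel_kernel P (per diag R)" and kA: "borel_kernel P (per diag A)"
    using R A by (auto intro: kernel_per[OF action_diag])
  have RV: "emeasure (per diag R \<omega>) (V n \<times> V n) < \<infinity>" for n \<omega>
    using le[of "V n \<times> V n" \<omega>] V(7) Vfin[of \<omega> n] by (meson le_less_trans)
  have "\<exists>D. sets D = sets borel \<and> (\<forall>Z\<in>sets borel. emeasure D Z + emeasure (per diag R \<omega>) Z = emeasure (q \<omega>) Z)" for \<omega>
    by (rule measure_difference[OF qD(4) sp le V(7)[rule_format] V(6) Vfin])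
  then obtain D where D': "\<forall>\<omega>. sets (D \<omega>) = sets borel \<and>
      (\<forall>Z\<in>sets borel. emeasure (D \<omega>) Z + emeasure (per diag R \<omega>) Z = emeasure (q \<omega>) Z)"
    using choice[of "\<lambda>\<omega> D. sets D = sets borel \<and>
      (\<forall>Z\<in>sets borel. emeasure D Z + emeasure (per diag R \<omega>) Z = emeasure (q \<omega>) Z)"] by blast
  have D: "sets (D \<omega>) = sets borel"
    "Z \<in> sets borel \<Longrightarrow> emeasure (D \<omega>) Z + emeasure (per diag R \<omega>) Z = emeasure (q \<omega>) Z" for \<omega> Z
    using D' by auto
  have kD: "borel_kernel P D"
    by (rule kernel_difference[OF qD(2) kR D(1) D(2) V(5) V(7)[rule_format] V(6) RV])
  have iD: "D (\<theta> f \<omega>) = distr (D \<omega>) borel (diag f)" if f: "f \<in> G" for f \<omega>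
  proof (rule measure_difference_unique[where N="per diag R (\<theta> f \<omega>)" and V="\<lambda>n. V n \<times> V n"])
    fix Z :: "('m \<times> 'm) set" assume Z: "Z \<in> sets borel"
    have m: "diag f \<in> borel_measurable borel" using f by (rule action_measurable[OF action_diag])
    have "emeasure (distr (D \<omega>) borel (diag f)) Z + emeasure (per diag R (\<theta> f \<omega>)) Z
       = emeasure (D \<omega>) (diag f -` Z) + emeasure (per diag R \<omega>) (diag f -` Z)"
      unfolding per_shift[OF action_diag R f] using D(1) Z m by (simp add: emeasure_distr_borel)
    also have "\<dots> = emeasure (q \<omega>) (diag f -` Z)" by (intro D vimage_borel m Z)
    also have "\<dots> = emeasure (q (\<theta> f \<omega>)) Z"
      using qD(3) f Z m qD(4) by (simp add: invariant_def[OF action_diag] emeasure_distr_borel)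
    finally show "emeasure (D (\<theta> f \<omega>)) Z + emeasure (per diag R (\<theta> f \<omega>)) Z
        = emeasure (distr (D \<omega>) borel (diag f)) Z + emeasure (per diag R (\<theta> f \<omega>)) Z" using D(2)[OF Z] by simp
  qed (use V RV D in auto)
  define q' where "q' \<omega> = add_measure (D \<omega>) (per diag A \<omega>)" for \<omega>
  have q'e: "emeasure (q' \<omega>) Z = emeasure (D \<omega>) Z + emeasure (per diag A \<omega>) Z" if "Z \<in> sets borel" for Z \<omega>
    unfolding q'_def using that D by (intro emeasure_add_measure) auto
  have kq': "borel_kernel P q'" unfolding q'_def by (intro kernel_add_measure kD kA)
  have iq': "invariant diag q'"
    unfolding invariant_def[OF action_diag]
  proof (intro ballI allI measure_eqI)
    fix f \<omega> Z assume f: "f \<in> G" and "Z \<in> sets (q' (\<theta> f \<omega>))"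
    then have Z: "Z \<in> sets borel" by (simp add: q'_def)
    have m: "diag f \<in> borel_measurable borel" using f by (rule action_measurable[OF action_diag])
    have "emeasure (distr (q' \<omega>) borel (diag f)) Z = emeasure (q' \<omega>) (diag f -` Z)"
      by (intro emeasure_distr_borel m Z) (simp add: q'_def)
    then show "emeasure (q' (\<theta> f \<omega>)) Z = emeasure (distr (q' \<omega>) borel (diag f)) Z"
      using Z m D(1) vimage_borel[OF m Z] by (simp add: q'e iD[OF f] per_shift[OF action_diag A f] emeasure_distr_borel)
  qed (simp add: q'_def)
  have snd': "emeasure (per diag A \<omega>) (UNIV \<times> Z) = emeasure (per diag R \<omega>) (UNIV \<times> Z)" if Z: "Z \<in> sets borel" for Z \<omega>
    using Z snd[OF vimage_borel[OF G_measurable Z]]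
    by (auto simp: emeasure_per[OF action_diag A] emeasure_per[OF action_diag R] rectangle_borel diag_vimage_Times
        intro!: nn_integral_cong)
  have "q' \<in> semicouplings"
  proof (rule semicouplingsI[OF kq' iq'])
    show "emeasure (q' \<omega>) K < \<infinity>" if K: "compact K" for \<omega> K
    proof -
      have "emeasure (D \<omega>) K \<le> emeasure (q \<omega>) K"
        using D(2)[of K \<omega>] K borel_compact[OF K] by (metis le_iff_add)
      then have "emeasure (D \<omega>) K < \<infinity>" using radon_measure_finite[OF qD(1) K, of \<omega>] by (rule le_less_trans)
      then show ?thesis using fin[OF K, of \<omega>] by (simp add: q'e borel_compact[OF K])
    qed
    show "AE \<omega> in P. \<forall>Z\<in>sets borel. emeasure (q' \<omega>) (Z \<times> UNIV) \<le> emeasure (lam \<omega>) Z"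
      using fst qD(5)
    proof eventually_elim
      case (elim \<omega>)
      show ?case
      proof
        fix Z :: "'m set" assume Z: "Z \<in> sets borel"
        have ZU: "Z \<times> UNIV \<in> sets (borel :: ('m \<times> 'm) measure)" by (intro rectangle_borel Z) simp
        show "emeasure (q' \<omega>) (Z \<times> UNIV) \<le> emeasure (lam \<omega>) Z"
        proof (cases "emeasure (lam \<omega>) Z = \<infinity>")
          case False
          have "emeasure (per diag R \<omega>) (Z \<times> UNIV) \<le> emeasure (lam \<omega>) Z"
            using le[OF ZU] elim(2) Z by (meson order_trans)
          then have fR: "emeasure (per diag R \<omega>) (Z \<times> UNIV) \<noteq> \<infinity>" using False by (auto simp: top_unique)
          have "emeasure (per diag R \<omega>) (Z \<times> UNIV) + emeasure (q' \<omega>) (Z \<times> UNIV)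
              = emeasure (per diag A \<omega>) (Z \<times> UNIV) + emeasure (q \<omega>) (Z \<times> UNIV)"
            unfolding q'e[OF ZU] D(2)[OF ZU, symmetric] by (simp add: ac_simps)
          also have "\<dots> \<le> emeasure (per diag R \<omega>) (Z \<times> UNIV) + emeasure (lam \<omega>) Z"
            using elim(1) Z by (simp add: add.commute)
          finally show ?thesis using fR by (simp add: ennreal_add_left_cancel_le)
        qed simp
      qed
    qed
    show "AE \<omega> in P. \<forall>Z\<in>sets borel. emeasure (q' \<omega>) (UNIV \<times> Z) = emeasure (mu \<omega>) Z"
      using qD(6)
    proof eventually_elim
      case (elim \<omega>)
      show ?case
      proof
        fix Z :: "'m set" assume Z: "Z \<in> sets borel"
        have ZU: "UNIV \<times> Z \<in> sets (borel :: ('m \<times> 'm) measure)" by (intro rectangle_borel Z) simp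
        show "emeasure (q' \<omega>) (UNIV \<times> Z) = emeasure (mu \<omega>) Z"
          using elim Z D(2)[OF ZU] by (simp add: q'e[OF ZU] snd')
      qed
    qed
  qed
  moreover have "region_cost q' B\<^sub>0 + (\<integral>\<^sup>+\<omega>. \<integral>\<^sup>+z. cost \<rho> z \<partial>R \<omega> \<partial>P)
            = region_cost q B\<^sub>0 + (\<integral>\<^sup>+\<omega>. \<integral>\<^sup>+z. cost \<rho> z \<partial>A \<omega> \<partial>P)"
  proof -
    let ?c = "\<lambda>z. cost \<rho> z * indicator (UNIV \<times> B\<^sub>0) z"
    have c: "?c \<in> borel_measurable borel" using region_measurable[OF region] by measurable
    have m: "(\<lambda>\<omega>. \<integral>\<^sup>+z. ?c z \<partial>K \<omega>) \<in> borel_measurable P" if "borel_kernel P K" for K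
      by (rule kernel_nn_integral[OF that c])
    have 1: "(\<integral>\<^sup>+z. ?c z \<partial>q' \<omega>) = (\<integral>\<^sup>+z. ?c z \<partial>D \<omega>) + (\<integral>\<^sup>+z. ?c z \<partial>per diag A \<omega>)" for \<omega>
      unfolding q'_def by (intro nn_integral_add_measure D c sp)
    have q_eq: "q \<omega> = add_measure (D \<omega>) (per diag R \<omega>)" for \<omega>
      by (rule measure_eqI) (use qD(4) D in \<open>auto simp: emeasure_add_measure\<close>)
    have 2: "(\<integral>\<^sup>+z. ?c z \<partial>q \<omega>) = (\<integral>\<^sup>+z. ?c z \<partial>D \<omega>) + (\<integral>\<^sup>+z. ?c z \<partial>per diag R \<omega>)" for \<omega>
      unfolding q_eq by (intro nn_integral_add_measure D c sp)
    have "region_cost q' B\<^sub>0 = region_cost D B\<^sub>0 + region_cost (per diag A) B\<^sub>0"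
      "region_cost q B\<^sub>0 = region_cost D B\<^sub>0 + region_cost (per diag R) B\<^sub>0"
      unfolding region_cost_def 1 2 by (intro nn_integral_add m kD kA kR)+
    then show ?thesis by (simp add: region_cost_per[OF _ region] R A ac_simps)
  qed
  ultimately show ?thesis by blast
qed

text \<open>Optimality in terms of one region. The finiteness of the cost allows it to be cancelled.\<close>

definition minimal :: "('w \<Rightarrow> ('m \<times> 'm) measure) \<Rightarrow> bool" where
  "minimal q \<longleftrightarrow> q \<in> semicouplings \<and> region_cost q B\<^sub>0 < \<infinity> \<and>
     (\<forall>q'\<in>semicouplings. region_cost q B\<^sub>0 \<le> region_cost q' B\<^sub>0)"

text \<open>Product measures are the new couplings that are put in by exchanges.\<close>

lemma pair_concentrated:
  fixes X Y :: "'m measure"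
  assumes X: "sets X = sets borel" "finite_measure X" "emeasure X (- U) = 0"
    and Y: "sets Y = sets borel" "finite_measure Y" "emeasure Y (- V) = 0"
    and UV: "U \<in> sets borel" "V \<in> sets borel"
  shows "sets (X \<Otimes>\<^sub>M Y) = sets borel"
    "A \<in> sets borel \<Longrightarrow> B \<in> sets borel \<Longrightarrow> emeasure (X \<Otimes>\<^sub>M Y) (A \<times> B) = emeasure X A * emeasure Y B"
    "emeasure (X \<Otimes>\<^sub>M Y) (- (U \<times> V)) = 0"
    "(\<And>x y. x \<in> U \<Longrightarrow> y \<in> V \<Longrightarrow> \<rho> (dist x y) \<le> r) \<Longrightarrow>
       (\<integral>\<^sup>+z. cost \<rho> z \<partial>(X \<Otimes>\<^sub>M Y)) \<le> ennreal r * (emeasure X UNIV * emeasure Y UNIV)"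
proof -
  interpret Y: finite_measure Y by fact
  show s: "sets (X \<Otimes>\<^sub>M Y) = sets borel"
    using sets_pair_measure_cong[OF X(1) Y(1)] borel_prod by metis
  show rect: "emeasure (X \<Otimes>\<^sub>M Y) (A \<times> B) = emeasure X A * emeasure Y B"
    if "A \<in> sets borel" "B \<in> sets borel" for A B
    using that X Y by (intro Y.emeasure_pair_measure_Times) auto
  have cU: "- U \<in> sets borel" "- V \<in> sets borel" using UV by (auto simp: Compl_eq_Diff_UNIV)
  have "emeasure (X \<Otimes>\<^sub>M Y) ((- U) \<times> UNIV) = 0" "emeasure (X \<Otimes>\<^sub>M Y) (UNIV \<times> (- V)) = 0"
    using rect[OF cU(1), of UNIV] rect[of UNIV, OF _ cU(2)] X(3) Y(3) by auto
  then have "(- U) \<times> UNIV \<union> UNIV \<times> (- V) \<in> null_sets (X \<Otimes>\<^sub>M Y)"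
    using cU by (intro null_sets.Un null_setsI) (auto simp: s intro!: rectangle_borel)
  moreover have "- (U \<times> V) = (- U) \<times> UNIV \<union> UNIV \<times> (- V)" by auto
  ultimately have null: "- (U \<times> V) \<in> null_sets (X \<Otimes>\<^sub>M Y)" by simp
  then show "emeasure (X \<Otimes>\<^sub>M Y) (- (U \<times> V)) = 0" by auto
  assume r: "\<And>x y. x \<in> U \<Longrightarrow> y \<in> V \<Longrightarrow> \<rho> (dist x y) \<le> r"
  have "AE z in X \<Otimes>\<^sub>M Y. cost \<rho> z \<le> ennreal r"
    using AE_not_in[OF null] by eventually_elim (auto simp: cost_eq mem_Times_iff intro!: ennreal_leI r)
  then have "(\<integral>\<^sup>+z. cost \<rho> z \<partial>(X \<Otimes>\<^sub>M Y)) \<le> (\<integral>\<^sup>+z. ennreal r \<partial>(X \<Otimes>\<^sub>M Y))"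
    by (rule nn_integral_mono_AE)
  also have "\<dots> = ennreal r * emeasure (X \<Otimes>\<^sub>M Y) (UNIV \<times> UNIV)"
    by (simp add: sets_eq_imp_space_eq[OF s])
  also have "\<dots> = ennreal r * (emeasure X UNIV * emeasure Y UNIV)" by (subst rect) auto
  finally show "(\<integral>\<^sup>+z. cost \<rho> z \<partial>(X \<Otimes>\<^sub>M Y)) \<le> ennreal r * (emeasure X UNIV * emeasure Y UNIV)" .
qed

end

lemma ennreal_divide_mult_cancel: "b \<noteq> 0 \<Longrightarrow> b \<noteq> top \<Longrightarrow> x / b * b = (x::ennreal)"
  by (metis ennreal_times_divide mult.commute mult_divide_eq_ennreal)

lemma half_double: "1/2 * (x + x) = (x::ennreal)"
proof -
  have "1/2 * (x + x) = x / 2 * 2" by (simp add: ennreal_times_divide mult_2_right[symmetric] mult.commute)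
  then show ?thesis by (simp add: ennreal_divide_mult_cancel)
qed

lemma nn_integral_restr_ge:
  assumes "sets M = sets borel" "A \<in> sets borel" "f \<in> borel_measurable borel" "\<And>z. z \<in> A \<Longrightarrow> c \<le> f z"
  shows "c * emeasure M A \<le> (\<integral>\<^sup>+z. f z \<partial>restr M A)"
proof -
  have [measurable]: "A \<in> sets M" using assms by simp
  have "c * emeasure M A = (\<integral>\<^sup>+z. c * indicator A z \<partial>M)" by (simp add: nn_integral_cmult_indicator)
  also have "\<dots> \<le> (\<integral>\<^sup>+z. f z * indicator A z \<partial>M)"
    using assms(4) by (intro nn_integral_mono) (auto simp: indicator_def)
  finally show ?thesis using assms by (simp add: nn_integral_restr)
qed

context transport_flow begin

text \<open>The local improvement. Mass \<open>s\<close> on each rectangle \<open>U i \<times> V i\<close> is given up, and its targets are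
  served instead by mass \<open>s\<close> from the sources \<open>X i\<close>, through a product measure. The factor \<open>n\<close> in the bound
  on \<open>s\<close> leaves room for overlaps of the rectangles; different translates of one rectangle are disjoint.
  The assumption \<open>fst\<close> says that the sources do not get overused. Each unit of mass saves at least the
  sum of the \<open>l i\<close> and costs at most the sum of the \<open>r i\<close>, so minimality forces \<open>s\<close> to vanish.\<close>

lemma transfer:
  fixes n :: nat and l r :: "nat \<Rightarrow> real" and s :: "'w \<Rightarrow> ennreal"
  assumes q: "minimal q" and n: "0 < n"
    and U: "\<And>i. i < n \<Longrightarrow> U i \<in> sets borel" "\<And>i. i < n \<Longrightarrow> moved (U i)" "\<And>i. i < n \<Longrightarrow> compact (closure (U i))"
    and V: "\<And>i. i < n \<Longrightarrow> V i \<in> sets borel" "\<And>i. i < n \<Longrightarrow> compact (closure (V i))"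
    and W: "\<And>i. i < n \<Longrightarrow> W i \<in> sets borel" "\<And>i. i < n \<Longrightarrow> compact (closure (W i))"
    and X: "\<And>i. i < n \<Longrightarrow> borel_kernel P (X i)" "\<And>i \<omega>. i < n \<Longrightarrow> finite_measure (X i \<omega>)"
      "\<And>i \<omega>. i < n \<Longrightarrow> emeasure (X i \<omega>) (- W i) = 0"
    and s: "s \<in> borel_measurable P" "\<And>\<omega>. s \<omega> \<le> 1" "\<And>i \<omega>. i < n \<Longrightarrow> of_nat n * s \<omega> \<le> emeasure (q \<omega>) (U i \<times> V i)"
      "\<And>i \<omega>. i < n \<Longrightarrow> emeasure (X i \<omega>) UNIV = 0 \<Longrightarrow> s \<omega> = 0"
    and fst: "AE \<omega> in P. \<forall>Z\<in>sets borel.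
      (\<integral>\<^sup>+f. (\<Sum>i<n. s (\<theta> (inv f) \<omega>) / emeasure (X i (\<theta> (inv f) \<omega>)) UNIV * emeasure (X i (\<theta> (inv f) \<omega>)) (f -` Z)) \<partial>count_space G)
        + emeasure (q \<omega>) (Z \<times> UNIV)
      \<le> emeasure (lam \<omega>) Z + (\<integral>\<^sup>+f. (\<Sum>i<n. s (\<theta> (inv f) \<omega>) / emeasure (q (\<theta> (inv f) \<omega>)) (U i \<times> V i)
            * emeasure (q (\<theta> (inv f) \<omega>)) (U i \<times> V i \<inter> (f -` Z) \<times> UNIV)) \<partial>count_space G)"
    and l: "\<And>i x y. i < n \<Longrightarrow> x \<in> U i \<Longrightarrow> y \<in> V i \<Longrightarrow> l i \<le> \<rho> (dist x y)" "\<And>i. i < n \<Longrightarrow> 0 \<le> l i"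
    and r: "\<And>i x y. i < n \<Longrightarrow> x \<in> W i \<Longrightarrow> y \<in> V i \<Longrightarrow> \<rho> (dist x y) \<le> r i" "\<And>i. i < n \<Longrightarrow> 0 \<le> r i"
    and rl: "(\<Sum>i<n. r i) < (\<Sum>i<n. l i)"
  shows "AE \<omega> in P. s \<omega> = 0"
proof -
  have qS: "q \<in> semicouplings" using q by (simp add: minimal_def)
  note qD = semicouplingsD[OF qS]
  define a where "a i \<omega> = emeasure (q \<omega>) (U i \<times> V i)" for i \<omega>
  define b where "b i \<omega> = emeasure (X i \<omega>) UNIV" for i \<omega>
  \<comment> \<open>Where \<open>a i\<close> or \<open>b i\<close> vanishes, so does \<open>s\<close>, and the weights are 0 because \<open>0 / 0 = 0\<close> in \<^typ>\<open>ennreal\<close>.\<close>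
  define w where "w i \<omega> = s \<omega> / a i \<omega>" for i \<omega>
  define v where "v i \<omega> = w i \<omega> / b i \<omega>" for i \<omega>
  define Y where "Y i \<omega> = distr (restr (q \<omega>) (U i \<times> V i)) borel snd" for i \<omega>
  define R where "R \<omega> = sum_measure {..<n} (\<lambda>i. scale_measure (w i \<omega>) (restr (q \<omega>) (U i \<times> V i)))" for \<omega>
  define A where "A \<omega> = sum_measure {..<n} (\<lambda>i. scale_measure (v i \<omega>) (X i \<omega> \<Otimes>\<^sub>M Y i \<omega>))" for \<omega>
  have UV: "U i \<times> V i \<in> sets borel" if "i < n" for i using that U V by (intro rectangle_borel)
  have a_fin: "a i \<omega> \<noteq> top" if "i < n" for i \<omega>
    using radon_rectangle_finite[OF qD(1), of "U i" "V i" \<omega>] U V that by (auto simp: a_def)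
  have b_fin: "b i \<omega> \<noteq> top" if "i < n" for i \<omega>
  proof -
    interpret finite_measure "X i \<omega>" using X(2)[OF that] .
    show ?thesis unfolding b_def using emeasure_finite by simp
  qed
  have a0: "s \<omega> = 0" if "i < n" "a i \<omega> = 0" for i \<omega> using s(3)[OF that(1), of \<omega>] that n by (auto simp: a_def)
  have b0: "s \<omega> = 0" if "i < n" "b i \<omega> = 0" for i \<omega> using s(4)[of i \<omega>] that by (auto simp: b_def)
  have wa: "w i \<omega> * a i \<omega> = s \<omega>" if "i < n" for i \<omega>
    using a0[OF that, of \<omega>] a_fin[OF that, of \<omega>] ennreal_divide_mult_cancel[of "a i \<omega>" "s \<omega>"]
    by (cases "a i \<omega> = 0") (auto simp: w_def)
  have vb: "v i \<omega> * b i \<omega> = w i \<omega>" if "i < n" for i \<omega>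
    using b0[OF that, of \<omega>] b_fin[OF that, of \<omega>] ennreal_divide_mult_cancel[of "b i \<omega>" "w i \<omega>"]
    by (cases "b i \<omega> = 0") (auto simp: v_def w_def)
  have va: "v i \<omega> * a i \<omega> = s \<omega> / b i \<omega>" if "i < n" for i \<omega>
    unfolding v_def using wa[OF that, of \<omega>] by (metis ennreal_times_divide mult.commute)
  have w_le: "w i \<omega> \<le> 1 / of_nat n" if "i < n" for i \<omega>
  proof -
    have "w i \<omega> = (of_nat n * s \<omega> / a i \<omega>) / of_nat n"
      using n by (simp add: w_def ennreal_times_divide[symmetric])
        (metis ennreal_times_divide mult.commute mult_divide_eq_ennreal of_nat_eq_0_iff ennreal_of_nat_neq_top not_gr_zero)
    also have "\<dots> \<le> 1 / of_nat n"
    proof (rule divide_right_mono_ennreal)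
      have "of_nat n * s \<omega> / a i \<omega> \<le> a i \<omega> / a i \<omega>"
        using s(3)[OF that, of \<omega>] by (intro divide_right_mono_ennreal) (simp add: a_def)
      also have "\<dots> \<le> 1" using a_fin[OF that, of \<omega>] by (cases "a i \<omega> = 0") (auto simp: ennreal_divide_self less_top)
      finally show "of_nat n * s \<omega> / a i \<omega> \<le> 1" .
    qed
    finally show ?thesis .
  qed
  have ka: "a i \<in> borel_measurable P" if "i < n" for i
    unfolding a_def[abs_def] using kernel_emeasure[OF qD(2) UV[OF that]] .
  have kb: "b i \<in> borel_measurable P" if "i < n" for i
    unfolding b_def[abs_def] by (rule kernel_emeasure[OF X(1)[OF that]]) simp
  have kw: "w i \<in> borel_measurable P" if "i < n" for i
    unfolding w_def[abs_def] using ka[OF that] s(1) by measurable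
  have kv: "v i \<in> borel_measurable P" if "i < n" for i
    unfolding v_def[abs_def] using kw[OF that] kb[OF that] by measurable
  have sX: "sets (X i \<omega>) = sets borel" if "i < n" for i \<omega> using kernel_sets[OF X(1)[OF that]] by (simp add: space_P)
  have Ye: "emeasure (Y i \<omega>) Z = emeasure (q \<omega>) (U i \<times> V i \<inter> UNIV \<times> Z)" if "i < n" "Z \<in> sets borel" for i \<omega> Z
  proof -
    have f: "snd -` Z = (UNIV :: 'm set) \<times> Z" by auto
    have "emeasure (Y i \<omega>) Z = emeasure (restr (q \<omega>) (U i \<times> V i)) (snd -` Z)"
      unfolding Y_def using that qD(4) by (intro emeasure_distr_borel borel_measurable_continuous_onI continuous_intros) auto
    also have "\<dots> = emeasure (q \<omega>) (U i \<times> V i \<inter> UNIV \<times> Z)"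
      unfolding f using that UV by (intro emeasure_restr qD rectangle_borel) (auto intro: U V)
    finally show ?thesis .
  qed
  have Ya: "emeasure (Y i \<omega>) UNIV = a i \<omega>" if "i < n" for i \<omega>
    using Ye[OF that, of UNIV \<omega>] by (simp add: a_def)
  have Yf: "finite_measure (Y i \<omega>)" if "i < n" for i \<omega>
    by (rule finite_measureI) (use a_fin[OF that, of \<omega>] Ya[OF that, of \<omega>] in \<open>simp add: Y_def\<close>)
  have Y0: "emeasure (Y i \<omega>) (- V i) = 0" if "i < n" for i \<omega>
  proof -
    have "- V i \<in> sets borel" using V(1)[OF that] by (simp add: Compl_eq_Diff_UNIV)
    moreover have "U i \<times> V i \<inter> UNIV \<times> (- V i) = {}" by auto
    ultimately show ?thesis using Ye[OF that, of "- V i" \<omega>] by simp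
  qed
  have sY: "sets (Y i \<omega>) = sets borel" for i \<omega> by (simp add: Y_def)
  note pair = pair_concentrated[OF sX X(2) X(3) sY Yf Y0 W(1) V(1)]
  have kR: "borel_kernel P R" unfolding R_def[abs_def]
    by (rule kernel_sum_measure) (auto intro!: kernel_scale kernel_restr qD(2) UV kw)
  have kY: "borel_kernel P (Y i)" if "i < n" for i unfolding Y_def[abs_def]
    using that by (intro kernel_distr kernel_restr qD(2) UV borel_measurable_continuous_onI continuous_intros)
  have kA: "borel_kernel P A" unfolding A_def[abs_def]
    by (rule kernel_sum_measure) (auto intro!: kernel_scale kernel_pair kv X Yf kY)
  have Re: "emeasure (R \<omega>) Z = (\<Sum>i<n. w i \<omega> * emeasure (q \<omega>) (U i \<times> V i \<inter> Z))" if "Z \<in> sets borel" for \<omega> Z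
    unfolding R_def using that qD(4) UV
    by (subst emeasure_sum_measure) (auto simp: nn_integral_count_space_finite emeasure_restr)
  have Ae: "emeasure (A \<omega>) (B \<times> C) = (\<Sum>i<n. v i \<omega> * (emeasure (X i \<omega>) B * emeasure (Y i \<omega>) C))"
    if "B \<in> sets borel" "C \<in> sets borel" for \<omega> B C
    unfolding A_def using that pair
    by (subst emeasure_sum_measure) (auto simp: nn_integral_count_space_finite rectangle_borel)
  have per_le: "emeasure (per diag R \<omega>) Z \<le> emeasure (q \<omega>) Z" if Z: "Z \<in> sets borel" for \<omega> Z
  proof -
    let ?R = "\<lambda>i \<omega>. scale_measure (w i \<omega>) (restr (q \<omega>) (U i \<times> V i))"
    have k: "borel_kernel P (?R i)" if "i < n" for i by (intro kernel_scale kernel_restr qD(2) UV kw that)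
    have "emeasure (per diag R \<omega>) Z = (\<integral>\<^sup>+f. (\<Sum>i<n. emeasure (?R i (\<theta> (inv f) \<omega>)) (diag f -` Z)) \<partial>count_space G)"
      unfolding emeasure_per[OF action_diag kR Z]
    proof (rule nn_integral_cong)
      fix f assume "f \<in> space (count_space G)"
      then have "diag f -` Z \<in> sets borel" using Z by (intro vimage_borel action_measurable[OF action_diag]) auto
      then show "emeasure (R (\<theta> (inv f) \<omega>)) (diag f -` Z) = (\<Sum>i<n. emeasure (?R i (\<theta> (inv f) \<omega>)) (diag f -` Z))"
        using qD(4) UV by (simp add: Re emeasure_restr)
    qed
    also have "\<dots> = (\<Sum>i<n. emeasure (per diag (?R i) \<omega>) Z)"
      by (subst nn_integral_sum) (auto simp: emeasure_per[OF action_diag k Z])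
    also have "\<dots> \<le> (\<Sum>i<n. 1 / of_nat n * emeasure (q \<omega>) Z)"
      by (intro sum_mono per_restr_le[OF action_diag qD(2,3) UV moved_disjoint_diag(1)] Z kw w_le U(2)) auto
    also have "\<dots> = of_nat n / of_nat n * emeasure (q \<omega>) Z"
      by (simp add: mult.assoc[symmetric] ennreal_times_divide)
    also have "of_nat n / of_nat n = (1::ennreal)"
      using n by (intro ennreal_divide_self) (auto simp: of_nat_less_top)
    also have "1 * emeasure (q \<omega>) Z = emeasure (q \<omega>) Z" by simp
    finally show ?thesis .
  qed
  define K where "K = (\<Union>i<n. closure (W i) \<times> closure (V i))"
  have K: "compact K" unfolding K_def using W V by (intro compact_UN compact_Times) auto
  have AK: "emeasure (A \<omega>) (- K) = 0" for \<omega>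
  proof -
    have mK: "- K \<in> sets borel" by (intro borel_comp borel_compact K)
    have "emeasure (X i \<omega> \<Otimes>\<^sub>M Y i \<omega>) (- K) = 0" if i: "i < n" for i
    proof -
      have "emeasure (X i \<omega> \<Otimes>\<^sub>M Y i \<omega>) (- K) \<le> emeasure (X i \<omega> \<Otimes>\<^sub>M Y i \<omega>) (- (W i \<times> V i))"
        using i closure_subset[of "W i"] closure_subset[of "V i"] W V
        by (intro emeasure_mono) (auto simp: K_def pair(1) Compl_eq_Diff_UNIV rectangle_borel intro!: sets.Diff)
      then show ?thesis using pair(3)[OF i i i i i i, of \<omega>] i by simp
    qed
    then show ?thesis
      unfolding A_def using mK pair(1)
      by (subst emeasure_sum_measure) (auto simp: nn_integral_count_space_finite)
  qed
  have A_fin: "emeasure (A \<omega>) UNIV < \<infinity>" for \<omega>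
  proof -
    have "emeasure (A \<omega>) (UNIV \<times> UNIV) = (\<Sum>i<n. s \<omega>)"
      by (subst Ae) (auto intro!: sum.cong simp: Ya b_def[symmetric] mult.assoc[symmetric] vb wa)
    also have "\<dots> \<le> (\<Sum>i<n. 1)" by (intro sum_mono s(2))
    also have "\<dots> < \<infinity>" by (simp add: of_nat_less_top)
    finally show ?thesis by simp
  qed
  have ex: "\<exists>q'\<in>semicouplings. region_cost q' B\<^sub>0 + (\<integral>\<^sup>+\<omega>. \<integral>\<^sup>+z. cost \<rho> z \<partial>R \<omega> \<partial>P)
            = region_cost q B\<^sub>0 + (\<integral>\<^sup>+\<omega>. \<integral>\<^sup>+z. cost \<rho> z \<partial>A \<omega> \<partial>P)"
  proof (rule exchange[OF qS kR kA per_le])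
    show "emeasure (per diag A \<omega>) L < \<infinity>" if "compact L" for L \<omega>
      by (rule per_locally_finite[OF kA K AK A_fin that])
    show "emeasure (A \<omega>) (UNIV \<times> Z) = emeasure (R \<omega>) (UNIV \<times> Z)" if "Z \<in> sets borel" for Z \<omega>
      using that
      by (auto simp: Ae Re rectangle_borel Ye b_def[symmetric] mult.assoc[symmetric] vb intro!: sum.cong)
    have AX: "emeasure (A \<omega>) (Z \<times> UNIV) = (\<Sum>i<n. s \<omega> / emeasure (X i \<omega>) UNIV * emeasure (X i \<omega>) Z)"
      if "Z \<in> sets borel" for Z \<omega>
      unfolding Ae[OF that borel_open[OF open_UNIV]]
    proof (rule sum.cong[OF refl])
      fix i assume "i \<in> {..<n}"
      then have i: "i < n" by simp
      show "v i \<omega> * (emeasure (X i \<omega>) Z * emeasure (Y i \<omega>) UNIV) = s \<omega> / emeasure (X i \<omega>) UNIV * emeasure (X i \<omega>) Z"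
        using va[OF i, of \<omega>] unfolding Ya[OF i] b_def by (metis mult.assoc mult.commute)
    qed
    have pA: "emeasure (per diag A \<omega>) (Z \<times> UNIV) = (\<integral>\<^sup>+f. (\<Sum>i<n. s (\<theta> (inv f) \<omega>) / emeasure (X i (\<theta> (inv f) \<omega>)) UNIV
          * emeasure (X i (\<theta> (inv f) \<omega>)) (f -` Z)) \<partial>count_space G)"
      if Z: "Z \<in> sets borel" for Z \<omega>
      using Z vimage_borel[OF G_measurable Z]
      by (auto simp: emeasure_per[OF action_diag kA] rectangle_borel diag_vimage_Times AX intro!: nn_integral_cong)
    have pR: "emeasure (per diag R \<omega>) (Z \<times> UNIV) = (\<integral>\<^sup>+f. (\<Sum>i<n. s (\<theta> (inv f) \<omega>) / emeasure (q (\<theta> (inv f) \<omega>)) (U i \<times> V i)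
            * emeasure (q (\<theta> (inv f) \<omega>)) (U i \<times> V i \<inter> (f -` Z) \<times> UNIV)) \<partial>count_space G)"
      if Z: "Z \<in> sets borel" for Z \<omega>
      using Z vimage_borel[OF G_measurable Z]
      by (auto simp: emeasure_per[OF action_diag kR] rectangle_borel diag_vimage_Times Re w_def a_def intro!: nn_integral_cong)
    show "AE \<omega> in P. \<forall>Z\<in>sets borel. emeasure (per diag A \<omega>) (Z \<times> UNIV) + emeasure (q \<omega>) (Z \<times> UNIV)
                \<le> emeasure (lam \<omega>) Z + emeasure (per diag R \<omega>) (Z \<times> UNIV)"
      using fst by eventually_elim (simp add: pA pR)
  qed
  have "(\<integral>\<^sup>+\<omega>. \<integral>\<^sup>+z. cost \<rho> z \<partial>R \<omega> \<partial>P) \<le> (\<integral>\<^sup>+\<omega>. \<integral>\<^sup>+z. cost \<rho> z \<partial>A \<omega> \<partial>P)"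
  proof -
    obtain q' where q': "q' \<in> semicouplings" "region_cost q' B\<^sub>0 + (\<integral>\<^sup>+\<omega>. \<integral>\<^sup>+z. cost \<rho> z \<partial>R \<omega> \<partial>P)
            = region_cost q B\<^sub>0 + (\<integral>\<^sup>+\<omega>. \<integral>\<^sup>+z. cost \<rho> z \<partial>A \<omega> \<partial>P)" using ex by blast
    have "region_cost q B\<^sub>0 + (\<integral>\<^sup>+\<omega>. \<integral>\<^sup>+z. cost \<rho> z \<partial>R \<omega> \<partial>P) \<le> region_cost q' B\<^sub>0 + (\<integral>\<^sup>+\<omega>. \<integral>\<^sup>+z. cost \<rho> z \<partial>R \<omega> \<partial>P)"
      using q q'(1) by (intro add_right_mono) (simp add: minimal_def)
    then show ?thesis using q unfolding q'(2) minimal_def by (auto simp: ennreal_add_left_cancel_le)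
  qed
  moreover have "s \<omega> * ennreal (\<Sum>i<n. l i) \<le> (\<integral>\<^sup>+z. cost \<rho> z \<partial>R \<omega>)" for \<omega>
  proof -
    have "s \<omega> * ennreal (\<Sum>i<n. l i) = (\<Sum>i<n. w i \<omega> * (ennreal (l i) * a i \<omega>))"
      using l(2) wa[of _ \<omega>] by (subst sum_ennreal[symmetric]) (auto simp: sum_distrib_left intro!: sum.cong simp flip: wa simp: ac_simps)
    also have "\<dots> \<le> (\<Sum>i<n. w i \<omega> * (\<integral>\<^sup>+z. cost \<rho> z \<partial>restr (q \<omega>) (U i \<times> V i)))"
      unfolding a_def using UV l(1)
      by (intro sum_mono mult_left_mono nn_integral_restr_ge qD(4) cost_measurable)
        (auto simp: cost_eq intro!: ennreal_leI)
    also have "\<dots> = (\<integral>\<^sup>+z. cost \<rho> z \<partial>R \<omega>)"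
      unfolding R_def using qD(4)
      by (subst nn_integral_sum_measure) (auto simp: nn_integral_count_space_finite nn_integral_scale_measure cong: measurable_cong_sets)
    finally show ?thesis .
  qed
  moreover have "(\<integral>\<^sup>+z. cost \<rho> z \<partial>A \<omega>) \<le> s \<omega> * ennreal (\<Sum>i<n. r i)" for \<omega>
  proof -
    have "(\<integral>\<^sup>+z. cost \<rho> z \<partial>A \<omega>) = (\<Sum>i<n. v i \<omega> * (\<integral>\<^sup>+z. cost \<rho> z \<partial>(X i \<omega> \<Otimes>\<^sub>M Y i \<omega>)))"
      unfolding A_def using pair(1)
      by (subst nn_integral_sum_measure) (auto simp: nn_integral_count_space_finite nn_integral_scale_measure cong: measurable_cong_sets)
    also have "\<dots> \<le> (\<Sum>i<n. v i \<omega> * (ennreal (r i) * (b i \<omega> * a i \<omega>)))"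
      unfolding b_def using pair(4)[where r="r _"] r(1)
      by (intro sum_mono mult_left_mono) (simp_all add: Ya[symmetric])
    also have "\<dots> = (\<Sum>i<n. s \<omega> * ennreal (r i))"
    proof (rule sum.cong[OF refl])
      fix i assume "i \<in> {..<n}"
      then have i: "i < n" by simp
      have "v i \<omega> * (ennreal (r i) * (b i \<omega> * a i \<omega>)) = ennreal (r i) * ((v i \<omega> * b i \<omega>) * a i \<omega>)" by (simp add: ac_simps)
      then show "v i \<omega> * (ennreal (r i) * (b i \<omega> * a i \<omega>)) = s \<omega> * ennreal (r i)"
        unfolding vb[OF i] wa[OF i] by (simp add: mult.commute)
    qed
    also have "\<dots> = s \<omega> * ennreal (\<Sum>i<n. r i)"
      using r(2) by (subst sum_ennreal[symmetric]) (auto simp: sum_distrib_left)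
    finally show ?thesis .
  qed
  ultimately have "(\<integral>\<^sup>+\<omega>. s \<omega> * ennreal (\<Sum>i<n. l i) \<partial>P) \<le> (\<integral>\<^sup>+\<omega>. s \<omega> * ennreal (\<Sum>i<n. r i) \<partial>P)"
    by (meson nn_integral_mono order_trans)
  then have le: "(\<integral>\<^sup>+\<omega>. s \<omega> \<partial>P) * ennreal (\<Sum>i<n. l i) \<le> (\<integral>\<^sup>+\<omega>. s \<omega> \<partial>P) * ennreal (\<Sum>i<n. r i)"
    using s(1) by (simp add: nn_integral_multc)
  interpret prob_space P by (rule prob)
  have "(\<integral>\<^sup>+\<omega>. s \<omega> \<partial>P) \<le> (\<integral>\<^sup>+\<omega>. 1 \<partial>P)" using s(2) by (intro nn_integral_mono)
  then have "(\<integral>\<^sup>+\<omega>. s \<omega> \<partial>P) \<noteq> top" by (auto simp: emeasure_space_1 top_unique)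
  then obtain e where e: "e \<ge> 0" "(\<integral>\<^sup>+\<omega>. s \<omega> \<partial>P) = ennreal e" by (cases "\<integral>\<^sup>+\<omega>. s \<omega> \<partial>P") auto
  have "0 \<le> (\<Sum>i<n. r i)" using r(2) by (intro sum_nonneg) auto
  then have "e * (\<Sum>i<n. l i) \<le> e * (\<Sum>i<n. r i)"
    using le e rl by (simp add: ennreal_mult[symmetric])
  then have "e = 0" using e(1) rl by (metis less_eq_real_def mult_le_cancel_left_pos not_le)
  then have "(\<integral>\<^sup>+\<omega>. s \<omega> \<partial>P) = 0" using e by simp
  then show ?thesis using s(1) by (simp add: nn_integral_0_iff_AE)
qed

end

section \<open>Cyclical monotonicity of minimal semicouplings\<close>

text \<open>Rectangles are used as neighbourhoods, because exchanges take place between rectangles.\<close>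

definition support :: "('a::topological_space \<times> 'b::topological_space) measure \<Rightarrow> ('a \<times> 'b) set" where
  "support q = {z. \<forall>U V. open U \<longrightarrow> open V \<longrightarrow> fst z \<in> U \<longrightarrow> snd z \<in> V \<longrightarrow> emeasure q (U \<times> V) \<noteq> 0}"

definition cyclically_monotone :: "('a \<Rightarrow> 'b \<Rightarrow> real) \<Rightarrow> ('a \<times> 'b) set \<Rightarrow> bool" where
  "cyclically_monotone h \<Gamma> \<longleftrightarrow> (\<forall>n z. (\<forall>i<n. z i \<in> \<Gamma>) \<longrightarrow>
     (\<Sum>i<n. h (fst (z i)) (snd (z i))) \<le> (\<Sum>i<n. h (fst (z (Suc i mod n))) (snd (z i))))"

text \<open>The points near which \<open>q\<close> leaves some of the mass of \<open>\<nu>\<close> unused. Relatively compact neighbourhoods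
  keep the comparison between finite masses.\<close>

definition unused :: "'a::topological_space measure \<Rightarrow> ('a \<times> 'b) measure \<Rightarrow> 'a set" where
  "unused \<nu> q = {x. \<forall>U. open U \<longrightarrow> compact (closure U) \<longrightarrow> x \<in> U \<longrightarrow> emeasure q (U \<times> UNIV) < emeasure \<nu> U}"

lemma uniform_radius:
  fixes n :: nat
  assumes "\<And>i. i < n \<Longrightarrow> \<exists>e>0. Q i e" "\<And>i d e. Q i e \<Longrightarrow> d \<le> e \<Longrightarrow> Q i d"
  shows "\<exists>e>0::real. \<forall>i<n. Q i e"
  using assms(1)
proof (induction n)
  case 0 then show ?case by (intro exI[of _ 1]) auto
next
  case (Suc n)
  then obtain e where e: "e > 0" "\<forall>i<n. Q i e" by auto
  obtain d where d: "d > 0" "Q n d" using Suc.prems by auto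
  show ?case
    by (rule exI[of _ "min d e"]) (use e d assms(2) in \<open>auto simp: less_Suc_eq intro: assms(2)[of _ e] assms(2)[of _ d]\<close>)
qed

lemma bij_betw_Suc_mod: "0 < n \<Longrightarrow> bij_betw (\<lambda>i. Suc i mod n) {..<n} {..<n}"
proof -
  assume n: "0 < n"
  have "inj_on (\<lambda>i. Suc i mod n) {..<n}"
    by (rule inj_onI) (auto simp: mod_Suc split: if_splits)
  moreover have "(\<lambda>i. Suc i mod n) ` {..<n} \<subseteq> {..<n}" using n by auto
  ultimately show ?thesis by (simp add: bij_betw_def endo_inj_surj)
qed

context transport_flow begin

abbreviation h :: "'m \<Rightarrow> 'm \<Rightarrow> real" where "h x y \<equiv> \<rho> (dist x y)"

lemma h_near:
  assumes "0 < \<delta>"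
  shows "\<exists>e>0. \<forall>x' y'. dist x x' < e \<longrightarrow> dist y y' < e \<longrightarrow> \<bar>h x' y' - h x y\<bar> < \<delta>"
proof -
  have "isCont (\<lambda>z::'m \<times> 'm. \<rho> (dist (fst z) (snd z))) (x, y)"
    using continuous_cost[of UNIV] by (simp add: continuous_on_eq_continuous_at)
  then obtain d where d: "d > 0" "\<And>z. dist z (x, y) < d \<Longrightarrow> \<bar>h (fst z) (snd z) - h x y\<bar> < \<delta>"
    using assms unfolding continuous_at_eps_delta dist_real_def by force
  show ?thesis
  proof (intro exI[of _ "d / 2"] conjI allI impI)
    fix x' y' assume "dist x x' < d / 2" "dist y y' < d / 2"
    then have "dist (x', y') (x, y) < d"
      unfolding dist_Pair_Pair by (intro le_less_trans[OF sqrt_sum_squares_le_sum]) (auto simp: dist_commute)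
    then show "\<bar>h x' y' - h x y\<bar> < \<delta>" using d(2)[of "(x', y')"] by simp
  qed (use d in simp)
qed

text \<open>A countable supply of neighbourhoods between which mass can be exchanged.\<close>

lemma small_base:
  obtains \<B> :: "'m set set" where "countable \<B>" "\<forall>U\<in>\<B>. open U \<and> moved U \<and> compact (closure U)"
    "\<forall>x W. open W \<longrightarrow> x \<in> W \<longrightarrow> (\<exists>U\<in>\<B>. x \<in> U \<and> U \<subseteq> W)"
proof -
  show thesis
  proof (rule countable_base_small[of "\<lambda>U::'m set. moved U \<and> compact (closure U)"])
    fix x :: 'm
    obtain U where "open U" "x \<in> U" "moved U" using moved_nbhd by blast
    moreover obtain V where "open V" "x \<in> V" "compact (closure V)" using open_rel_compact_nbhd[OF lc] by blast
    moreover have "moved (U \<inter> V)" using \<open>moved U\<close> unfolding moved_def by blast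
    moreover have "compact (closure (U \<inter> V))" using \<open>compact (closure V)\<close> by (rule compact_closure_subset) auto
    ultimately show "\<exists>U. open U \<and> x \<in> U \<and> moved U \<and> compact (closure U)" by (intro exI[of _ "U \<inter> V"]) auto
  next
    fix U V :: "'m set" assume "moved U \<and> compact (closure U)" "V \<subseteq> U"
    then show "moved V \<and> compact (closure V)" using compact_closure_subset unfolding moved_def by blast
  next
    fix \<B> :: "'m set set"
    assume "countable \<B>" "\<And>U. U \<in> \<B> \<Longrightarrow> open U" "\<And>U. U \<in> \<B> \<Longrightarrow> moved U \<and> compact (closure U)"
      "\<And>x W. open W \<Longrightarrow> x \<in> W \<Longrightarrow> \<exists>U\<in>\<B>. x \<in> U \<and> U \<subseteq> W"
    then show thesis by (intro that[of \<B>]) auto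
  qed
qed

text \<open>The sources of the rectangles are rotated, which leaves both marginals unchanged. The largest
  possible mass \<open>s\<close> vanishes only if one of the rectangles carries no mass.\<close>

lemma cyclic_exchange:
  fixes n :: nat and l r :: "nat \<Rightarrow> real"
  assumes q: "minimal q" and n: "0 < n"
    and U: "\<And>i. i < n \<Longrightarrow> open (U i) \<and> moved (U i) \<and> compact (closure (U i))"
    and V: "\<And>i. i < n \<Longrightarrow> open (V i) \<and> compact (closure (V i))"
    and l: "\<And>i x y. i < n \<Longrightarrow> x \<in> U i \<Longrightarrow> y \<in> V i \<Longrightarrow> l i \<le> h x y" "\<And>i. i < n \<Longrightarrow> 0 \<le> l i"
    and r: "\<And>i x y. i < n \<Longrightarrow> x \<in> U (Suc i mod n) \<Longrightarrow> y \<in> V i \<Longrightarrow> h x y \<le> r i" "\<And>i. i < n \<Longrightarrow> 0 \<le> r i"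
    and rl: "(\<Sum>i<n. r i) < (\<Sum>i<n. l i)"
  shows "AE \<omega> in P. \<exists>i<n. emeasure (q \<omega>) (U i \<times> V i) = 0"
proof -
  have qS: "q \<in> semicouplings" using q by (simp add: minimal_def)
  note qD = semicouplingsD[OF qS]
  define j where "j i = Suc i mod n" for i
  have j: "j i < n" for i using n by (simp add: j_def)
  have bU: "U i \<in> sets borel" and bV: "V i \<in> sets borel" if "i < n" for i using U[OF that] V[OF that] by auto
  have UV: "U i \<times> V i \<in> sets borel" if "i < n" for i using that bU bV by (intro rectangle_borel)
  define a where "a i \<omega> = emeasure (q \<omega>) (U i \<times> V i)" for i \<omega>
  have ka: "a i \<in> borel_measurable P" if "i < n" for i
    unfolding a_def[abs_def] using kernel_emeasure[OF qD(2) UV[OF that]] .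
  have a_fin: "a i \<omega> \<noteq> top" if "i < n" for i \<omega>
    using radon_rectangle_finite[OF qD(1), of "U i" "V i" \<omega>] U V that by (auto simp: a_def)
  define t where "t \<omega> = (INF i\<in>{..<n}. min 1 (a i \<omega>))" for \<omega>
  have t_le: "t \<omega> \<le> min 1 (a i \<omega>)" if "i < n" for i \<omega> unfolding t_def using that by (intro INF_lower) auto
  define s where "s \<omega> = t \<omega> / of_nat n" for \<omega>
  have kt: "t \<in> borel_measurable P" unfolding t_def[abs_def]
    by (intro borel_measurable_INF borel_measurable_min measurable_const ka) auto
  have ns: "of_nat n * s \<omega> = t \<omega>" for \<omega>
    unfolding s_def using n ennreal_divide_mult_cancel[of "of_nat n" "t \<omega>"] by (simp add: mult.commute)
  define X where "X i \<omega> = distr (restr (q \<omega>) (U (j i) \<times> V (j i))) borel fst" for i \<omega>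
  have Xe: "emeasure (X i \<omega>) Z = emeasure (q \<omega>) (U (j i) \<times> V (j i) \<inter> Z \<times> UNIV)" if "Z \<in> sets borel" for i \<omega> Z
  proof -
    have f: "fst -` Z = Z \<times> (UNIV :: 'm set)" by auto
    have "emeasure (X i \<omega>) Z = emeasure (restr (q \<omega>) (U (j i) \<times> V (j i))) (fst -` Z)"
      unfolding X_def using that qD(4) by (intro emeasure_distr_borel borel_measurable_continuous_onI continuous_intros) auto
    also have "\<dots> = emeasure (q \<omega>) (U (j i) \<times> V (j i) \<inter> Z \<times> UNIV)"
      unfolding f using that by (intro emeasure_restr qD rectangle_borel bU bV j) auto
    finally show ?thesis .
  qed
  have XU: "emeasure (X i \<omega>) UNIV = a (j i) \<omega>" for i \<omega> by (simp add: Xe a_def)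
  have "AE \<omega> in P. s \<omega> = 0"
  proof (rule transfer[OF q n, where U=U and V=V and W="\<lambda>i. U (j i)" and X=X and l=l and r=r])
    show "borel_kernel P (X i)" for i unfolding X_def[abs_def]
      by (intro kernel_distr kernel_restr qD(2) UV j borel_measurable_continuous_onI continuous_intros)
    show "finite_measure (X i \<omega>)" for i \<omega>
      by (rule finite_measureI) (use a_fin[OF j[of i], of \<omega>] XU[of i \<omega>] in \<open>simp add: X_def\<close>)
    show "emeasure (X i \<omega>) (- U (j i)) = 0" for i \<omega>
    proof -
      have "- U (j i) \<in> sets borel" using bU[OF j] by (rule borel_comp)
      moreover have "U (j i) \<times> V (j i) \<inter> (- U (j i)) \<times> UNIV = {}" by auto
      ultimately show ?thesis using Xe[of "- U (j i)" i \<omega>] by simp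
    qed
    show "s \<in> borel_measurable P" unfolding s_def[abs_def] using kt by measurable
    show "s \<omega> \<le> 1" for \<omega>
    proof -
      have "1 * s \<omega> \<le> of_nat n * s \<omega>" using n by (intro mult_right_mono) auto
      also have "\<dots> \<le> 1" using ns t_le[OF n] by simp
      finally show ?thesis by simp
    qed
    show "of_nat n * s \<omega> \<le> emeasure (q \<omega>) (U i \<times> V i)" if "i < n" for i \<omega>
      using t_le[OF that, of \<omega>] by (simp add: ns a_def)
    show "s \<omega> = 0" if "emeasure (X i \<omega>) UNIV = 0" for i \<omega>
      using t_le[OF j[of i], of \<omega>] that by (simp add: XU s_def)
    have eq: "(\<Sum>i<n. s \<omega> / emeasure (X i \<omega>) UNIV * emeasure (X i \<omega>) Z)
        = (\<Sum>i<n. s \<omega> / emeasure (q \<omega>) (U i \<times> V i) * emeasure (q \<omega>) (U i \<times> V i \<inter> Z \<times> UNIV))"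
      if "Z \<in> sets borel" for \<omega> Z
      unfolding XU Xe[OF that] a_def
      using sum.reindex_bij_betw[OF bij_betw_Suc_mod[OF n],
        of "\<lambda>i. s \<omega> / emeasure (q \<omega>) (U i \<times> V i) * emeasure (q \<omega>) (U i \<times> V i \<inter> Z \<times> UNIV)"]
      by (simp add: j_def)
    show "AE \<omega> in P. \<forall>Z\<in>sets borel.
      (\<integral>\<^sup>+f. (\<Sum>i<n. s (\<theta> (inv f) \<omega>) / emeasure (X i (\<theta> (inv f) \<omega>)) UNIV * emeasure (X i (\<theta> (inv f) \<omega>)) (f -` Z)) \<partial>count_space G)
        + emeasure (q \<omega>) (Z \<times> UNIV)
      \<le> emeasure (lam \<omega>) Z + (\<integral>\<^sup>+f. (\<Sum>i<n. s (\<theta> (inv f) \<omega>) / emeasure (q (\<theta> (inv f) \<omega>)) (U i \<times> V i)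
            * emeasure (q (\<theta> (inv f) \<omega>)) (U i \<times> V i \<inter> (f -` Z) \<times> UNIV)) \<partial>count_space G)"
      using qD(5)
    proof eventually_elim
      case (elim \<omega>)
      show ?case
      proof
        fix Z :: "'m set" assume Z: "Z \<in> sets borel"
        have "(\<integral>\<^sup>+f. (\<Sum>i<n. s (\<theta> (inv f) \<omega>) / emeasure (X i (\<theta> (inv f) \<omega>)) UNIV * emeasure (X i (\<theta> (inv f) \<omega>)) (f -` Z)) \<partial>count_space G)
          = (\<integral>\<^sup>+f. (\<Sum>i<n. s (\<theta> (inv f) \<omega>) / emeasure (q (\<theta> (inv f) \<omega>)) (U i \<times> V i)
            * emeasure (q (\<theta> (inv f) \<omega>)) (U i \<times> V i \<inter> (f -` Z) \<times> UNIV)) \<partial>count_space G)"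
          by (intro nn_integral_cong eq vimage_borel G_measurable Z) simp
        then show "(\<integral>\<^sup>+f. (\<Sum>i<n. s (\<theta> (inv f) \<omega>) / emeasure (X i (\<theta> (inv f) \<omega>)) UNIV * emeasure (X i (\<theta> (inv f) \<omega>)) (f -` Z)) \<partial>count_space G)
          + emeasure (q \<omega>) (Z \<times> UNIV)
          \<le> emeasure (lam \<omega>) Z + (\<integral>\<^sup>+f. (\<Sum>i<n. s (\<theta> (inv f) \<omega>) / emeasure (q (\<theta> (inv f) \<omega>)) (U i \<times> V i)
            * emeasure (q (\<theta> (inv f) \<omega>)) (U i \<times> V i \<inter> (f -` Z) \<times> UNIV)) \<partial>count_space G)"
          using elim Z by (simp add: add.commute add_left_mono)
      qed
    qed
    show "\<And>i x y. i < n \<Longrightarrow> x \<in> U (j i) \<Longrightarrow> y \<in> V i \<Longrightarrow> h x y \<le> r i" using r(1) by (simp add: j_def)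
  qed (use U V bU bV j l r rl in auto)
  then show ?thesis
  proof eventually_elim
    case (elim \<omega>)
    then have "t \<omega> = 0" using ns[of \<omega>] by simp
    have "t \<omega> = Min ((\<lambda>i. min 1 (a i \<omega>)) ` {..<n})" unfolding t_def using n by (intro cInf_eq_Min) auto
    then have "t \<omega> \<in> (\<lambda>i. min 1 (a i \<omega>)) ` {..<n}" using n by (metis Min_in finite_imageI finite_lessThan image_is_empty lessThan_empty_iff not_gr_zero)
    then obtain i where "i < n" "min 1 (a i \<omega>) = 0" using \<open>t \<omega> = 0\<close> by auto
    then show ?case by (auto simp: a_def min_def split: if_splits)
  qed
qed

text \<open>By continuity of the cost, a violating cycle in the support is surrounded by rectangles from the
  countable base to which \<open>cyclic_exchange\<close> applies. Hence the exceptional event is a countable union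
  of null sets.\<close>

lemma minimal_cyclically_monotone:
  assumes q: "minimal q"
  shows "AE \<omega> in P. cyclically_monotone h (support (q \<omega>))"
proof -
  obtain \<B> :: "'m set set" where B: "countable \<B>" "\<forall>U\<in>\<B>. open U \<and> moved U \<and> compact (closure U)"
    "\<forall>x W. open W \<longrightarrow> x \<in> W \<longrightarrow> (\<exists>U\<in>\<B>. x \<in> U \<and> U \<subseteq> W)" by (rule small_base)
  define bad where "bad L \<longleftrightarrow> (\<exists>l r. L \<noteq> [] \<and>
      (\<forall>i<length L. 0 \<le> l i \<and> 0 \<le> r i \<and> (\<forall>x\<in>fst (L ! i). \<forall>y\<in>snd (L ! i). l i \<le> h x y) \<and>
         (\<forall>x\<in>fst (L ! (Suc i mod length L)). \<forall>y\<in>snd (L ! i). h x y \<le> r i)) \<and>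
      (\<Sum>i<length L. r i) < (\<Sum>i<length L. l i))" for L :: "('m set \<times> 'm set) list"
  have "AE \<omega> in P. \<forall>L\<in>{L\<in>lists (\<B> \<times> \<B>). bad L}. \<exists>i<length L. emeasure (q \<omega>) (fst (L ! i) \<times> snd (L ! i)) = 0"
  proof (rule AE_ball_countable')
    show "countable {L\<in>lists (\<B> \<times> \<B>). bad L}"
      by (rule countable_subset[of _ "lists (\<B> \<times> \<B>)"]) (use B(1) in auto)
    fix L assume "L \<in> {L\<in>lists (\<B> \<times> \<B>). bad L}"
    then have L: "L \<in> lists (\<B> \<times> \<B>)" and "bad L" by auto
    then obtain l r where lr: "L \<noteq> []" "\<forall>i<length L. 0 \<le> l i \<and> 0 \<le> r i \<and> (\<forall>x\<in>fst (L ! i). \<forall>y\<in>snd (L ! i). l i \<le> h x y) \<and>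
         (\<forall>x\<in>fst (L ! (Suc i mod length L)). \<forall>y\<in>snd (L ! i). h x y \<le> r i)"
      "(\<Sum>i<length L. r i) < (\<Sum>i<length L. l i)" unfolding bad_def by blast
    have "L ! i \<in> \<B> \<times> \<B>" if "i < length L" for i
      using L nth_mem[OF that] by (rule in_listsD[THEN bspec])
    then have Li: "fst (L ! i) \<in> \<B>" "snd (L ! i) \<in> \<B>" if "i < length L" for i
      using that by (auto simp: mem_Times_iff)
    show "AE \<omega> in P. \<exists>i<length L. emeasure (q \<omega>) (fst (L ! i) \<times> snd (L ! i)) = 0"
      by (rule cyclic_exchange[OF q, where l=l and r=r]) (use lr B(2) Li in auto)
  qed
  then show ?thesis
  proof eventually_elim
    case (elim \<omega>)
    show ?case unfolding cyclically_monotone_def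
    proof (intro allI impI, rule ccontr)
      fix n and z :: "nat \<Rightarrow> 'm \<times> 'm" assume z: "\<forall>i<n. z i \<in> support (q \<omega>)"
        and less: "\<not> (\<Sum>i<n. h (fst (z i)) (snd (z i))) \<le> (\<Sum>i<n. h (fst (z (Suc i mod n))) (snd (z i)))"
      have n: "0 < n" using less by (cases n) auto
      define d where "d = (\<Sum>i<n. h (fst (z i)) (snd (z i))) - (\<Sum>i<n. h (fst (z (Suc i mod n))) (snd (z i)))"
      define \<delta> where "\<delta> = d / (4 * real n)"
      have \<delta>: "\<delta> > 0" "2 * (real n * \<delta>) < d" using less n by (auto simp: \<delta>_def d_def)
      define near where "near e i k \<longleftrightarrow> (\<forall>x y. dist (fst (z i)) x < e \<longrightarrow> dist (snd (z k)) y < e \<longrightarrow>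
          \<bar>h x y - h (fst (z i)) (snd (z k))\<bar> < \<delta>)" for e i k
      have near_ex: "\<exists>e>0. near e i k" for i k unfolding near_def by (rule h_near[OF \<delta>(1)])
      have near_mono: "near e i k \<Longrightarrow> d \<le> e \<Longrightarrow> near d i k" for d e i k unfolding near_def by force
      have "\<exists>e>0. \<forall>i<n. near e i i \<and> near e (Suc i mod n) i"
      proof (rule uniform_radius)
        show "\<exists>e>0. near e i i \<and> near e (Suc i mod n) i" for i
        proof -
          obtain d e where "d > 0" "near d i i" "e > 0" "near e (Suc i mod n) i" using near_ex by meson
          then show ?thesis by (intro exI[of _ "min d e"]) (auto intro: near_mono)
        qed
      qed (auto intro: near_mono)
      then obtain e where e: "e > 0" "\<And>i. i < n \<Longrightarrow> near e i i" "\<And>i. i < n \<Longrightarrow> near e (Suc i mod n) i" by blast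
      have "\<exists>U\<in>\<B>. x \<in> U \<and> U \<subseteq> ball x e" for x using B(3) e(1) by auto
      then obtain N where N: "\<And>x. N x \<in> \<B>" "\<And>x. x \<in> N x" "\<And>x. N x \<subseteq> ball x e" by metis
      define L where "L = map (\<lambda>i. (N (fst (z i)), N (snd (z i)))) [0..<n]"
      have lL: "length L = n" and Li: "\<And>i. i < n \<Longrightarrow> L ! i = (N (fst (z i)), N (snd (z i)))"
        by (auto simp: L_def)
      define l where "l i = max 0 (h (fst (z i)) (snd (z i)) - \<delta>)" for i
      define r where "r i = h (fst (z (Suc i mod n))) (snd (z i)) + \<delta>" for i
      have "L \<in> lists (\<B> \<times> \<B>)" using N(1) by (auto simp: L_def)
      moreover have "bad L" unfolding bad_def lL
      proof (rule exI[of _ l], rule exI[of _ r], intro conjI allI impI)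
        show "L \<noteq> []" using lL n by auto
        fix i assume i: "i < n"
        have i': "Suc i mod n < n" using n by simp
        show "0 \<le> l i" by (simp add: l_def)
        show "0 \<le> r i" using \<delta>(1) \<rho>_nonneg[of "dist (fst (z (Suc i mod n))) (snd (z i))"] by (simp add: r_def)
        show "\<forall>x\<in>fst (L ! i). \<forall>y\<in>snd (L ! i). l i \<le> h x y"
        proof (intro ballI)
          fix x y assume "x \<in> fst (L ! i)" "y \<in> snd (L ! i)"
          then have "x \<in> ball (fst (z i)) e" "y \<in> ball (snd (z i)) e"
            using N(3)[of "fst (z i)"] N(3)[of "snd (z i)"] by (auto simp: Li[OF i])
          then have "\<bar>h x y - h (fst (z i)) (snd (z i))\<bar> < \<delta>" using e(2)[OF i] by (simp add: near_def)
          then show "l i \<le> h x y" using \<rho>_nonneg[of "dist x y"] unfolding l_def by auto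
        qed
        show "\<forall>x\<in>fst (L ! (Suc i mod n)). \<forall>y\<in>snd (L ! i). h x y \<le> r i"
        proof (intro ballI)
          fix x y assume "x \<in> fst (L ! (Suc i mod n))" "y \<in> snd (L ! i)"
          then have "x \<in> ball (fst (z (Suc i mod n))) e" "y \<in> ball (snd (z i)) e"
            using N(3)[of "fst (z (Suc i mod n))"] N(3)[of "snd (z i)"] by (auto simp: Li[OF i] Li[OF i'])
          then have "\<bar>h x y - h (fst (z (Suc i mod n))) (snd (z i))\<bar> < \<delta>" using e(3)[OF i] by (simp add: near_def)
          then show "h x y \<le> r i" unfolding r_def by auto
        qed
      next
        have "(\<Sum>i<n. r i) = (\<Sum>i<n. h (fst (z (Suc i mod n))) (snd (z i))) + real n * \<delta>"
          by (simp add: r_def sum.distrib)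
        also have "\<dots> < (\<Sum>i<n. h (fst (z i)) (snd (z i))) - real n * \<delta>" using \<delta>(2) unfolding d_def by linarith
        also have "\<dots> = (\<Sum>i<n. h (fst (z i)) (snd (z i)) - \<delta>)" by (simp add: sum_subtractf)
        also have "\<dots> \<le> (\<Sum>i<n. l i)" by (intro sum_mono) (simp add: l_def)
        finally show "(\<Sum>i<n. r i) < (\<Sum>i<n. l i)" .
      qed
      ultimately obtain i where i: "i < n" "emeasure (q \<omega>) (fst (L ! i) \<times> snd (L ! i)) = 0"
        using elim lL by auto
      moreover have "emeasure (q \<omega>) (N (fst (z i)) \<times> N (snd (z i))) \<noteq> 0"
        using z i(1) N(1,2) B(2) by (auto simp: support_def)
      ultimately show False using Li by simp
    qed
  qed
qed

text \<open>The targets in \<open>V\<close> are served from the mass that \<open>q\<close> leaves unused in \<open>W\<close>. The unused mass is a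
  difference of measures only outside a null set \<open>N\<close>, on which the new source is set to 0.\<close>

lemma unused_exchange:
  fixes l r :: real
  assumes q: "minimal q" and U: "open U" "moved U" "compact (closure U)" and V: "open V" "compact (closure V)"
    and W: "open W" "moved W" "compact (closure W)"
    and l: "\<And>x y. x \<in> U \<Longrightarrow> y \<in> V \<Longrightarrow> l \<le> h x y" and r: "\<And>x y. x \<in> W \<Longrightarrow> y \<in> V \<Longrightarrow> h x y \<le> r"
    and rl: "0 \<le> r" "r < l"
  shows "AE \<omega> in P. emeasure (q \<omega>) (U \<times> V) = 0 \<or> emeasure (lam \<omega>) W \<le> emeasure (q \<omega>) (W \<times> UNIV)"
proof -
  have qS: "q \<in> semicouplings" using q by (simp add: minimal_def)
  note qD = semicouplingsD[OF qS]
  obtain N where N: "N \<in> null_sets P" "\<And>\<omega> Z. \<omega> \<notin> N \<Longrightarrow> Z \<in> sets borel \<Longrightarrow> emeasure (q \<omega>) (Z \<times> UNIV) \<le> emeasure (lam \<omega>) Z"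
    using qD(5) unfolding eventually_ae_filter by (auto simp: space_P)
  have bW: "W \<in> sets borel" and bU: "U \<in> sets borel" and bV: "V \<in> sets borel" using U V W by auto
  have sl: "sets (lam \<omega>) = sets borel" for \<omega> using kernel_sets[OF lam_kernel] by (simp add: space_P)
  have lamW: "emeasure (lam \<omega>) W < \<infinity>" for \<omega>
  proof -
    have "emeasure (lam \<omega>) W \<le> emeasure (lam \<omega>) (closure W)" using closure_subset sl by (intro emeasure_mono) auto
    also have "\<dots> < \<infinity>" by (rule radon_measure_finite[OF lam_radon W(3)])
    finally show ?thesis .
  qed
  define Q where "Q \<omega> = distr (q \<omega>) borel fst" for \<omega>
  have sQ: "sets (Q \<omega>) = sets borel" for \<omega> by (simp add: Q_def)
  have Qe: "emeasure (Q \<omega>) Z = emeasure (q \<omega>) (Z \<times> UNIV)" if "Z \<in> sets borel" for \<omega> Z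
  proof -
    have "fst -` Z = Z \<times> (UNIV :: 'm set)" by auto
    then show ?thesis unfolding Q_def using that qD(4)
      by (subst emeasure_distr_borel) (auto intro!: borel_measurable_continuous_onI continuous_intros)
  qed
  define X where "X \<omega> = (if \<omega> \<in> N then null_measure borel else diff_measure (restr (lam \<omega>) W) (restr (Q \<omega>) W))" for \<omega>
  have sX: "sets (X \<omega>) = sets borel" for \<omega> by (simp add: X_def sl)
  have Xe: "emeasure (X \<omega>) Z = emeasure (lam \<omega>) (W \<inter> Z) - emeasure (q \<omega>) ((W \<inter> Z) \<times> UNIV)"
    if w: "\<omega> \<notin> N" and Z: "Z \<in> sets borel" for \<omega> Z
  proof -
    have le: "emeasure (Q \<omega>) Z \<le> emeasure (lam \<omega>) Z" if "Z \<in> sets borel" for Z using N(2)[OF w that] Qe[OF that] by simp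
    have "emeasure (X \<omega>) Z = emeasure (restr (lam \<omega>) W) Z - emeasure (restr (Q \<omega>) W) Z"
      unfolding X_def using w
    proof (simp, intro emeasure_diff_measure)
      show "finite_measure (restr (lam \<omega>) W)"
        by (rule finite_measureI) (use lamW[of \<omega>] in \<open>simp add: emeasure_restr sl bW sets_eq_imp_space_eq[OF sl]\<close>)
      show "finite_measure (restr (Q \<omega>) W)"
        by (rule finite_measureI) (use lamW[of \<omega>] le[OF bW] in \<open>auto simp: emeasure_restr sQ bW sets_eq_imp_space_eq[OF sQ] top_unique\<close>)
    qed (use Z le bW in \<open>auto simp: emeasure_restr sl sQ\<close>)
    then show ?thesis using Z bW by (simp add: emeasure_restr sl sQ Qe)
  qed
  have kX: "borel_kernel P X"
  proof -
    have "(\<lambda>\<omega>. emeasure (X \<omega>) Z) \<in> borel_measurable P" if Z: "Z \<in> sets borel" for Z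
    proof -
      have [measurable]: "N \<in> sets P" using N(1) by auto
      have "(\<lambda>\<omega>. emeasure (lam \<omega>) (W \<inter> Z)) \<in> borel_measurable P" "(\<lambda>\<omega>. emeasure (q \<omega>) ((W \<inter> Z) \<times> UNIV)) \<in> borel_measurable P"
        using Z bW by (auto intro!: kernel_emeasure[OF lam_kernel] kernel_emeasure[OF qD(2)] rectangle_borel)
      then have "(\<lambda>\<omega>. if \<omega> \<in> N then 0 else emeasure (lam \<omega>) (W \<inter> Z) - emeasure (q \<omega>) ((W \<inter> Z) \<times> UNIV)) \<in> borel_measurable P"
        by (intro measurable_If_set) (auto simp: space_P)
      moreover have "emeasure (X \<omega>) Z = (if \<omega> \<in> N then 0 else emeasure (lam \<omega>) (W \<inter> Z) - emeasure (q \<omega>) ((W \<inter> Z) \<times> UNIV))" for \<omega>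
        using Xe[of \<omega> Z] Z by (auto simp: X_def)
      ultimately show ?thesis by simp
    qed
    then show ?thesis by (simp add: borel_kernel_def sX)
  qed
  have X_le: "emeasure (X \<omega>) UNIV \<le> emeasure (lam \<omega>) W" for \<omega>
    using Xe[of \<omega> UNIV] diff_le_self_ennreal[of "emeasure (lam \<omega>) W"] by (cases "\<omega> \<in> N") (auto simp: X_def)
  have UV: "U \<times> V \<in> sets borel" using bU bV by (rule rectangle_borel)
  define s where "s \<omega> = min 1 (min (emeasure (q \<omega>) (U \<times> V)) (emeasure (X \<omega>) UNIV))" for \<omega>
  have "AE \<omega> in P. s \<omega> = 0"
  proof (rule transfer[OF q, where n=1 and U="\<lambda>_. U" and V="\<lambda>_. V" and W="\<lambda>_. W" and X="\<lambda>_. X" and l="\<lambda>_. l" and r="\<lambda>_. r"])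
    show "finite_measure (X \<omega>)" for \<omega>
      by (rule finite_measureI) (use X_le[of \<omega>] lamW[of \<omega>] in \<open>auto simp: sets_eq_imp_space_eq[OF sX] top_unique\<close>)
    show "emeasure (X \<omega>) (- W) = 0" for \<omega>
    proof -
      have "- W \<in> sets borel" using bW by (rule borel_comp)
      then show ?thesis using Xe[of \<omega> "- W"] by (cases "\<omega> \<in> N") (auto simp: X_def)
    qed
    show "s \<in> borel_measurable P" unfolding s_def[abs_def]
      by (intro borel_measurable_min measurable_const kernel_emeasure[OF qD(2) UV] kernel_emeasure[OF kX]) simp_all
    have "AE \<omega> in P. \<forall>f\<in>G. \<theta> (inv f) \<omega> \<notin> N"
    proof (rule AE_ball_countable'[OF _ countable_G])
      fix f assume f: "f \<in> G"
      have "AE \<omega> in distr P P (\<theta> (inv f)). \<omega> \<notin> N"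
        unfolding \<theta>_stationary[OF G_inv[OF f]] by (rule AE_not_in[OF N(1)])
      then show "AE \<omega> in P. \<theta> (inv f) \<omega> \<notin> N" by (rule AE_distrD[OF \<theta>_measurable[OF G_inv[OF f]]])
    qed
    then show "AE \<omega> in P. \<forall>Z\<in>sets borel.
      (\<integral>\<^sup>+f. (\<Sum>i<1::nat. s (\<theta> (inv f) \<omega>) / emeasure (X (\<theta> (inv f) \<omega>)) UNIV * emeasure (X (\<theta> (inv f) \<omega>)) (f -` Z)) \<partial>count_space G)
        + emeasure (q \<omega>) (Z \<times> UNIV)
      \<le> emeasure (lam \<omega>) Z + (\<integral>\<^sup>+f. (\<Sum>i<1::nat. s (\<theta> (inv f) \<omega>) / emeasure (q (\<theta> (inv f) \<omega>)) (U \<times> V)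
            * emeasure (q (\<theta> (inv f) \<omega>)) (U \<times> V \<inter> (f -` Z) \<times> UNIV)) \<partial>count_space G)"
    proof eventually_elim
      case (elim \<omega>)
      have w: "\<omega> \<notin> N" using elim G_id \<theta>_id[of \<omega>] by (metis inv_id)
      have le: "emeasure (Q \<omega>) Z \<le> emeasure (lam \<omega>) Z" if "Z \<in> sets borel" for Z using N(2)[OF w that] Qe[OF that] by simp
      obtain E :: "nat \<Rightarrow> 'm set" where E: "\<forall>n. open (E n)" "\<forall>n. compact (closure (E n))" "(\<Union>n. E n) = UNIV"
        using open_exhaustion[OF lc] by metis
      have "\<exists>D. sets D = sets borel \<and> (\<forall>A\<in>sets borel. emeasure D A + emeasure (Q \<omega>) A = emeasure (lam \<omega>) A)"
      proof (rule measure_difference[OF sl sQ le _ E(3)])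
        show "E n \<in> sets borel" for n using E(1) by auto
        show "emeasure (lam \<omega>) (E n) < \<infinity>" for n
        proof -
          have "emeasure (lam \<omega>) (E n) \<le> emeasure (lam \<omega>) (closure (E n))" using closure_subset sl by (intro emeasure_mono) auto
          also have "\<dots> < \<infinity>" using E(2) by (intro radon_measure_finite[OF lam_radon]) auto
          finally show ?thesis .
        qed
      qed
      then obtain D where D: "sets D = sets borel" "\<And>A. A \<in> sets borel \<Longrightarrow> emeasure D A + emeasure (Q \<omega>) A = emeasure (lam \<omega>) A" by blast
      show ?case
      proof
        fix Z :: "'m set" assume Z: "Z \<in> sets borel"
        have W': "inv f -` W \<in> sets borel" if "f \<in> G" for f using vimage_borel[OF G_measurable[OF G_inv[OF that]] bW] .
        have "(\<integral>\<^sup>+f. (\<Sum>i<1::nat. s (\<theta> (inv f) \<omega>) / emeasure (X (\<theta> (inv f) \<omega>)) UNIV * emeasure (X (\<theta> (inv f) \<omega>)) (f -` Z)) \<partial>count_space G)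
          \<le> (\<integral>\<^sup>+f. emeasure D (inv f -` W \<inter> Z) \<partial>count_space G)"
        proof (rule nn_integral_mono)
          fix f assume "f \<in> space (count_space G)"
          then have f: "f \<in> G" by simp
          let ?w = "\<theta> (inv f) \<omega>" and ?Z = "inv f -` W \<inter> Z"
          have bZ: "?Z \<in> sets borel" using W'[OF f] Z by auto
          have fZ: "f -` Z \<in> sets borel" using vimage_borel[OF G_measurable[OF f] Z] .
          have eq: "W \<inter> f -` Z = f -` ?Z" using f by auto
          have "s ?w / emeasure (X ?w) UNIV \<le> emeasure (X ?w) UNIV / emeasure (X ?w) UNIV"
            by (intro divide_right_mono_ennreal) (auto simp: s_def min_le_iff_disj)
          also have "\<dots> \<le> 1"
            using X_le[of ?w] lamW[of ?w] by (cases "emeasure (X ?w) UNIV = 0") (auto simp: ennreal_divide_self)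
          finally have "s ?w / emeasure (X ?w) UNIV * emeasure (X ?w) (f -` Z) \<le> 1 * emeasure (X ?w) (f -` Z)"
            by (rule mult_right_mono) simp
          also have "\<dots> = emeasure (lam ?w) (f -` ?Z) - emeasure (q ?w) (diag f -` (?Z \<times> UNIV))"
            using Xe[OF _ fZ, of ?w] elim f unfolding eq by (simp add: diag_vimage_Times)
          also have "\<dots> = emeasure (lam \<omega>) ?Z - emeasure (q \<omega>) (?Z \<times> UNIV)"
            using lam_equivariant[OF f bZ] invariant_emeasure[OF action_diag qD(2,3) f rectangle_borel[OF bZ, of UNIV]] by simp
          also have "\<dots> = emeasure (lam \<omega>) ?Z - emeasure (Q \<omega>) ?Z" using Qe[OF bZ] by simp
          also have "\<dots> = emeasure D ?Z"
          proof -
            have "emeasure (lam \<omega>) ?Z = emeasure (lam ?w) (f -` ?Z)" using lam_equivariant[OF f bZ] by simp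
            also have "\<dots> \<le> emeasure (lam ?w) W" unfolding eq[symmetric] using sl bW by (intro emeasure_mono) auto
            finally have "emeasure (lam \<omega>) ?Z < \<infinity>" using lamW[of ?w] by (rule le_less_trans)
            then have "emeasure (Q \<omega>) ?Z \<noteq> top" using le[OF bZ] by (auto simp: top_unique)
            then show ?thesis unfolding D(2)[OF bZ, symmetric] by simp
          qed
          finally show "(\<Sum>i<1::nat. s ?w / emeasure (X ?w) UNIV * emeasure (X ?w) (f -` Z)) \<le> emeasure D ?Z" by simp
        qed
        also have "\<dots> = emeasure D (\<Union>f\<in>G. inv f -` W \<inter> Z)"
          using moved_disjoint_diag(3)[OF W(2)] W' Z D(1) countable_G
          by (intro emeasure_UN_countable[symmetric]) (auto simp: disjoint_family_on_def)
        also have "\<dots> \<le> emeasure D Z" using D(1) Z by (intro emeasure_mono) auto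
        finally have "(\<integral>\<^sup>+f. (\<Sum>i<1::nat. s (\<theta> (inv f) \<omega>) / emeasure (X (\<theta> (inv f) \<omega>)) UNIV * emeasure (X (\<theta> (inv f) \<omega>)) (f -` Z)) \<partial>count_space G)
            + emeasure (q \<omega>) (Z \<times> UNIV) \<le> emeasure D Z + emeasure (Q \<omega>) Z"
          unfolding Qe[OF Z] by (rule add_right_mono)
        also have "\<dots> = emeasure (lam \<omega>) Z" by (rule D(2)[OF Z])
        finally show "(\<integral>\<^sup>+f. (\<Sum>i<1::nat. s (\<theta> (inv f) \<omega>) / emeasure (X (\<theta> (inv f) \<omega>)) UNIV * emeasure (X (\<theta> (inv f) \<omega>)) (f -` Z)) \<partial>count_space G)
            + emeasure (q \<omega>) (Z \<times> UNIV)
          \<le> emeasure (lam \<omega>) Z + (\<integral>\<^sup>+f. (\<Sum>i<1::nat. s (\<theta> (inv f) \<omega>) / emeasure (q (\<theta> (inv f) \<omega>)) (U \<times> V)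
            * emeasure (q (\<theta> (inv f) \<omega>)) (U \<times> V \<inter> (f -` Z) \<times> UNIV)) \<partial>count_space G)"
          by (rule order_trans) simp
      qed
    qed
  qed (use U V W bU bV bW kX l r rl in \<open>auto simp: s_def min_le_iff_disj\<close>)
  then show ?thesis using AE_not_in[OF N(1)]
  proof eventually_elim
    case (elim \<omega>)
    then have "emeasure (q \<omega>) (U \<times> V) = 0 \<or> emeasure (X \<omega>) UNIV = 0" by (auto simp: s_def min_def split: if_splits)
    then show ?case
    proof
      assume "emeasure (X \<omega>) UNIV = 0"
      then have "emeasure (lam \<omega>) W - emeasure (q \<omega>) (W \<times> UNIV) = 0" using Xe[OF elim(2), of UNIV] by simp
      then show ?thesis by (simp add: diff_eq_0_iff_ennreal)
    qed simp
  qed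
qed

text \<open>A closer unused source persists in small neighbourhoods, as in the case of cycles.\<close>

lemma minimal_unused_farther:
  assumes q: "minimal q"
  shows "AE \<omega> in P. \<forall>z\<in>support (q \<omega>). \<forall>x\<in>unused (lam \<omega>) (q \<omega>). h (fst z) (snd z) \<le> h x (snd z)"
proof -
  obtain \<B> :: "'m set set" where B: "countable \<B>" "\<forall>U\<in>\<B>. open U \<and> moved U \<and> compact (closure U)"
    "\<forall>x W. open W \<longrightarrow> x \<in> W \<longrightarrow> (\<exists>U\<in>\<B>. x \<in> U \<and> U \<subseteq> W)" by (rule small_base)
  define bad where "bad T \<longleftrightarrow> (\<exists>l r. 0 \<le> r \<and> r < l \<and> (\<forall>x\<in>fst T. \<forall>y\<in>fst (snd T). l \<le> h x y) \<and>
      (\<forall>x\<in>snd (snd T). \<forall>y\<in>fst (snd T). h x y \<le> r))" for T :: "'m set \<times> 'm set \<times> 'm set"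
  have "AE \<omega> in P. \<forall>T\<in>{T\<in>\<B> \<times> \<B> \<times> \<B>. bad T}. emeasure (q \<omega>) (fst T \<times> fst (snd T)) = 0 \<or>
      emeasure (lam \<omega>) (snd (snd T)) \<le> emeasure (q \<omega>) (snd (snd T) \<times> UNIV)"
  proof (rule AE_ball_countable')
    show "countable {T\<in>\<B> \<times> \<B> \<times> \<B>. bad T}"
      by (rule countable_subset[of _ "\<B> \<times> \<B> \<times> \<B>"]) (use B(1) in auto)
    fix T assume "T \<in> {T\<in>\<B> \<times> \<B> \<times> \<B>. bad T}"
    then obtain U V W l r where T: "T = (U, V, W)" "U \<in> \<B>" "V \<in> \<B>" "W \<in> \<B>" "0 \<le> r" "r < l"
      "\<forall>x\<in>U. \<forall>y\<in>V. l \<le> h x y" "\<forall>x\<in>W. \<forall>y\<in>V. h x y \<le> r" by (auto simp: bad_def)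
    have "AE \<omega> in P. emeasure (q \<omega>) (U \<times> V) = 0 \<or> emeasure (lam \<omega>) W \<le> emeasure (q \<omega>) (W \<times> UNIV)"
      by (rule unused_exchange[OF q, where l=l and r=r]) (use T B(2) in auto)
    then show "AE \<omega> in P. emeasure (q \<omega>) (fst T \<times> fst (snd T)) = 0 \<or>
      emeasure (lam \<omega>) (snd (snd T)) \<le> emeasure (q \<omega>) (snd (snd T) \<times> UNIV)" by (simp add: T(1))
  qed
  then show ?thesis
  proof eventually_elim
    case (elim \<omega>)
    show ?case
    proof (intro ballI, rule ccontr)
      fix z x assume z: "z \<in> support (q \<omega>)" and x: "x \<in> unused (lam \<omega>) (q \<omega>)"
        and "\<not> h (fst z) (snd z) \<le> h x (snd z)"
      define \<delta> where "\<delta> = (h (fst z) (snd z) - h x (snd z)) / 3"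
      have \<delta>: "\<delta> > 0" "h x (snd z) + \<delta> < h (fst z) (snd z) - \<delta>"
        using \<open>\<not> h (fst z) (snd z) \<le> h x (snd z)\<close> by (auto simp: \<delta>_def field_simps)
      obtain d where d: "d > 0" "\<And>x' y'. dist (fst z) x' < d \<Longrightarrow> dist (snd z) y' < d \<Longrightarrow> \<bar>h x' y' - h (fst z) (snd z)\<bar> < \<delta>"
        using h_near[OF \<delta>(1)] by blast
      obtain e where e: "e > 0" "\<And>x' y'. dist x x' < e \<Longrightarrow> dist (snd z) y' < e \<Longrightarrow> \<bar>h x' y' - h x (snd z)\<bar> < \<delta>"
        using h_near[OF \<delta>(1)] by blast
      obtain U where U: "U \<in> \<B>" "fst z \<in> U" "U \<subseteq> ball (fst z) d" using B(3) d(1) by (metis centre_in_ball open_ball)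
      obtain V where V: "V \<in> \<B>" "snd z \<in> V" "V \<subseteq> ball (snd z) (min d e)" using B(3) d(1) e(1) by (metis centre_in_ball open_ball min_less_iff_conj)
      obtain W where W: "W \<in> \<B>" "x \<in> W" "W \<subseteq> ball x e" using B(3) e(1) by (metis centre_in_ball open_ball)
      have "bad (U, V, W)"
        unfolding bad_def
      proof (rule exI[of _ "h (fst z) (snd z) - \<delta>"], rule exI[of _ "h x (snd z) + \<delta>"], intro conjI ballI)
        show "0 \<le> h x (snd z) + \<delta>" using \<delta>(1) \<rho>_nonneg[of "dist x (snd z)"] by simp
        fix x' y' assume "x' \<in> fst (U, V, W)" "y' \<in> fst (snd (U, V, W))"
        then have "\<bar>h x' y' - h (fst z) (snd z)\<bar> < \<delta>" using U V by (intro d(2)) auto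
        then show "h (fst z) (snd z) - \<delta> \<le> h x' y'" by linarith
      next
        fix x' y' assume "x' \<in> snd (snd (U, V, W))" "y' \<in> fst (snd (U, V, W))"
        then have "\<bar>h x' y' - h x (snd z)\<bar> < \<delta>" using W V by (intro e(2)) auto
        then show "h x' y' \<le> h x (snd z) + \<delta>" by linarith
      qed (use \<delta> in simp)
      then have "emeasure (q \<omega>) (U \<times> V) = 0 \<or> emeasure (lam \<omega>) W \<le> emeasure (q \<omega>) (W \<times> UNIV)"
        using elim U V W by fastforce
      moreover have "emeasure (q \<omega>) (U \<times> V) \<noteq> 0" using z U V B(2) by (auto simp: support_def)
      moreover have "emeasure (q \<omega>) (W \<times> UNIV) < emeasure (lam \<omega>) W" using x W B(2) by (auto simp: unused_def)
      ultimately show False by auto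
    qed
  qed
qed

end

section \<open>Optimal transport between fixed measures\<close>

lemma support_compl_open:
  fixes q :: "('a::second_countable_topology \<times> 'b::second_countable_topology) measure"
  assumes s: "sets q = sets borel"
  shows "closed (support q)" "emeasure q (- support q) = 0"
proof -
  obtain \<A> :: "'a set set" where A: "countable \<A>" "\<And>U. U \<in> \<A> \<Longrightarrow> open U" "\<And>x W. open W \<Longrightarrow> x \<in> W \<Longrightarrow> \<exists>U\<in>\<A>. x \<in> U \<and> U \<subseteq> W"
    using countable_base by metis
  obtain \<B> :: "'b set set" where B: "countable \<B>" "\<And>U. U \<in> \<B> \<Longrightarrow> open U" "\<And>x W. open W \<Longrightarrow> x \<in> W \<Longrightarrow> \<exists>U\<in>\<B>. x \<in> U \<and> U \<subseteq> W"
    using countable_base by metis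
  define I where "I = {(U, V). U \<in> \<A> \<and> V \<in> \<B> \<and> emeasure q (U \<times> V) = 0}"
  have I: "countable I" by (rule countable_subset[of _ "\<A> \<times> \<B>"]) (use A(1) B(1) in \<open>auto simp: I_def\<close>)
  have eq: "- support q = (\<Union>(U, V)\<in>I. U \<times> V)"
  proof (intro equalityI subsetI)
    fix z assume "z \<in> - support q"
    then obtain U V where UV: "open U" "open V" "fst z \<in> U" "snd z \<in> V" "emeasure q (U \<times> V) = 0"
      by (auto simp: support_def)
    obtain U' where U': "U' \<in> \<A>" "fst z \<in> U'" "U' \<subseteq> U" using A(3) UV by blast
    obtain V' where V': "V' \<in> \<B>" "snd z \<in> V'" "V' \<subseteq> V" using B(3) UV by blast
    have "emeasure q (U' \<times> V') \<le> emeasure q (U \<times> V)"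
      using U' V' UV s by (intro emeasure_mono) (auto intro: borel_open open_Times)
    then have "(U', V') \<in> I" using UV(5) U' V' by (simp add: I_def)
    then show "z \<in> (\<Union>(U, V)\<in>I. U \<times> V)" using U' V' by (auto simp: mem_Times_iff intro!: bexI[of _ "(U', V')"])
  next
    fix z assume "z \<in> (\<Union>(U, V)\<in>I. U \<times> V)"
    then obtain U V where "U \<in> \<A>" "V \<in> \<B>" "emeasure q (U \<times> V) = 0" "fst z \<in> U" "snd z \<in> V" by (auto simp: I_def)
    then show "z \<in> - support q" using A(2) B(2) by (auto simp: support_def)
  qed
  have "open (- support q)" unfolding eq using A(2) B(2) by (intro open_UN) (auto simp: I_def intro!: open_Times)
  then show "closed (support q)" by (simp add: closed_def)
  have "(\<Union>(U, V)\<in>I. U \<times> V) \<in> null_sets q"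
    by (intro null_sets_UN' I) (use s A(2) B(2) in \<open>auto simp: I_def intro!: null_setsI borel_open open_Times\<close>)
  then show "emeasure q (- support q) = 0" unfolding eq by auto
qed

lemma cyclically_monotone_subset: "cyclically_monotone h \<Gamma> \<Longrightarrow> \<Delta> \<subseteq> \<Gamma> \<Longrightarrow> cyclically_monotone h \<Delta>"
  unfolding cyclically_monotone_def by (meson subsetD)

text \<open>Rockafellar's construction: \<open>r\<close> is the price of a chain of reassignments from \<open>z0\<close> to \<open>z\<close>, in which
  each target is served by the source of the next pair. The potential at \<open>x\<close> is the infimum of the
  prices of the chains that end by serving the last target from \<open>x\<close>.\<close>

inductive chain :: "('a \<Rightarrow> 'b \<Rightarrow> real) \<Rightarrow> ('a \<times> 'b) set \<Rightarrow> 'a \<times> 'b \<Rightarrow> 'a \<times> 'b \<Rightarrow> real \<Rightarrow> bool"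
  for h \<Gamma> z0 where
  start: "chain h \<Gamma> z0 z0 0"
| step: "chain h \<Gamma> z0 z r \<Longrightarrow> z' \<in> \<Gamma> \<Longrightarrow> chain h \<Gamma> z0 z' (r + h (fst z') (snd z) - h (fst z) (snd z))"

lemma chain_sum:
  assumes "chain h \<Gamma> z0 z r" "z0 \<in> \<Gamma>"
  shows "\<exists>n w. w 0 = z0 \<and> w n = z \<and> (\<forall>i\<le>n. w i \<in> \<Gamma>) \<and>
    r = (\<Sum>i<n. h (fst (w (Suc i))) (snd (w i)) - h (fst (w i)) (snd (w i)))"
  using assms
proof induction
  case start then show ?case by (intro exI[of _ 0] exI[of _ "\<lambda>_. z0"]) auto
next
  case (step z r z')
  then obtain n w where w: "w 0 = z0" "w n = z" "\<forall>i\<le>n. w i \<in> \<Gamma>"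
    "r = (\<Sum>i<n. h (fst (w (Suc i))) (snd (w i)) - h (fst (w i)) (snd (w i)))" by blast
  show ?case
    by (rule exI[of _ "Suc n"], rule exI[of _ "w(Suc n := z')"]) (use w step(2) in \<open>auto intro!: sum.cong\<close>)
qed

text \<open>Serving the last target from the first source closes the chain to a cycle.\<close>

lemma chain_closed:
  assumes c: "chain h \<Gamma> z0 z r" and z0: "z0 \<in> \<Gamma>" and mono: "cyclically_monotone h \<Gamma>"
  shows "0 \<le> r + h (fst z0) (snd z) - h (fst z) (snd z)"
proof -
  obtain n w where w: "w 0 = z0" "w n = z" "\<forall>i\<le>n. w i \<in> \<Gamma>"
    "r = (\<Sum>i<n. h (fst (w (Suc i))) (snd (w i)) - h (fst (w i)) (snd (w i)))"
    using chain_sum[OF c z0] by blast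
  have "\<forall>i<Suc n. w i \<in> \<Gamma>" using w(3) by (simp add: less_Suc_eq_le)
  then have "(\<Sum>i<Suc n. h (fst (w i)) (snd (w i))) \<le> (\<Sum>i<Suc n. h (fst (w (Suc i mod Suc n))) (snd (w i)))"
    by (rule mono[unfolded cyclically_monotone_def, THEN spec, THEN spec, THEN mp])
  moreover have "(\<Sum>i<n. h (fst (w (Suc i mod Suc n))) (snd (w i))) = (\<Sum>i<n. h (fst (w (Suc i))) (snd (w i)))"
    by (intro sum.cong) auto
  ultimately show ?thesis using w by (simp add: sum_subtractf)
qed

lemma continuous_on_INF_equicontinuous:
  fixes F :: "'i \<Rightarrow> 'a::metric_space \<Rightarrow> real"
  assumes I: "I \<noteq> {}" and bdd: "\<And>x. x \<in> S \<Longrightarrow> bdd_below ((\<lambda>i. F i x) ` I)"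
    and eq: "\<And>e. e > 0 \<Longrightarrow> \<exists>d>0. \<forall>i\<in>I. \<forall>x\<in>S. \<forall>y\<in>S. dist x y < d \<longrightarrow> F i x \<le> F i y + e"
  shows "continuous_on S (\<lambda>x. INF i\<in>I. F i x)"
  unfolding continuous_on_iff dist_real_def
proof (intro ballI allI impI)
  fix x e assume x: "x \<in> S" and e: "(0::real) < e"
  obtain d where d: "d > 0" "\<And>i x y. i \<in> I \<Longrightarrow> x \<in> S \<Longrightarrow> y \<in> S \<Longrightarrow> dist x y < d \<Longrightarrow> F i x \<le> F i y + e/2"
    using eq[of "e/2"] e by auto
  have le: "(INF i\<in>I. F i x) \<le> (INF i\<in>I. F i y) + e/2" if "x \<in> S" "y \<in> S" "dist x y < d" for x y
  proof -
    have "(INF i\<in>I. F i x) - e/2 \<le> (INF i\<in>I. F i y)"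
    proof (rule cINF_greatest[OF I])
      fix i assume i: "i \<in> I"
      have "(INF i\<in>I. F i x) \<le> F i x" by (rule cINF_lower[OF bdd[OF that(1)] i])
      then show "(INF i\<in>I. F i x) - e/2 \<le> F i y" using d(2)[OF i that] by simp
    qed
    then show ?thesis by simp
  qed
  show "\<exists>d>0. \<forall>x'\<in>S. dist x' x < d \<longrightarrow> \<bar>(INF i\<in>I. F i x') - (INF i\<in>I. F i x)\<bar> < e"
  proof (intro exI[of _ d] conjI ballI impI)
    fix x' assume "x' \<in> S" "dist x' x < d"
    then show "\<bar>(INF i\<in>I. F i x') - (INF i\<in>I. F i x)\<bar> < e"
      using le[of x x'] le[of x' x] x e by (auto simp: dist_commute abs_if)
  qed (rule d(1))
qed

locale unique_transport =
  fixes \<rho> :: "real \<Rightarrow> real" and m :: "'m::{metric_space, second_countable_topology} measure"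
  assumes lc: "locally compact (UNIV :: 'm set)"
    and \<rho>_cont: "continuous_on {0..} \<rho>" and \<rho>_mono: "strict_mono_on {0..} \<rho>" and \<rho>_0: "\<rho> 0 = 0"
    and unique: "unique_optimal_transport \<rho> m"
begin

abbreviation h :: "'m \<Rightarrow> 'm \<Rightarrow> real" where "h x y \<equiv> \<rho> (dist x y)"

lemma \<rho>_le: "0 \<le> a \<Longrightarrow> a \<le> b \<Longrightarrow> \<rho> a \<le> \<rho> b"
  using strict_mono_on_leD[OF \<rho>_mono, of a b] by simp

lemma \<rho>_nonneg: "0 \<le> a \<Longrightarrow> 0 \<le> \<rho> a"
  using \<rho>_le[of 0 a] \<rho>_0 by simp

lemma continuous_h: "continuous_on S (\<lambda>z::'m \<times> 'm. h (fst z) (snd z))"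
  by (rule continuous_on_compose2[OF \<rho>_cont]) (auto intro!: continuous_intros)

lemma cost_eq: "cost \<rho> z = ennreal (h (fst z) (snd z))"
  by (simp add: cost_def case_prod_beta)

lemma cost_measurable [measurable]: "(cost \<rho> :: 'm \<times> 'm \<Rightarrow> ennreal) \<in> borel_measurable borel"
proof -
  have "(\<lambda>z::'m \<times> 'm. ennreal (h (fst z) (snd z))) \<in> borel_measurable borel"
    by (intro measurable_compose[OF borel_measurable_continuous_onI[OF continuous_h] measurable_ennreal])
  then show ?thesis by (simp add: cost_eq[abs_def])
qed

lemma fst_borel [measurable]: "(fst :: 'm \<times> 'm \<Rightarrow> 'm) \<in> borel_measurable borel"
  and snd_borel [measurable]: "(snd :: 'm \<times> 'm \<Rightarrow> 'm) \<in> borel_measurable borel"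
  by (intro borel_measurable_continuous_onI continuous_intros)+

lemma vimage_fst_snd: "fst -` Z = Z \<times> (UNIV :: 'm set)" "snd -` Z = (UNIV :: 'm set) \<times> Z" for Z :: "'m set"
  by auto

lemma emeasure_fst_snd:
  fixes q :: "('m \<times> 'm) measure"
  assumes "sets q = sets borel" "Z \<in> sets borel"
  shows "emeasure (distr q borel fst) Z = emeasure q (Z \<times> UNIV)" "emeasure (distr q borel snd) Z = emeasure q (UNIV \<times> Z)"
  unfolding vimage_fst_snd[symmetric] using assms by (auto intro!: emeasure_distr_borel)

lemma uniform_h:
  assumes X: "compact X" and Y: "compact Y" and e: "e > 0"
  shows "\<exists>d>0. \<forall>x\<in>X. \<forall>x'\<in>X. \<forall>y\<in>Y. \<forall>y'\<in>Y. dist x x' < d \<longrightarrow> dist y y' < d \<longrightarrow> h x y \<le> h x' y' + e"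
proof -
  have "uniformly_continuous_on (X \<times> Y) (\<lambda>z. h (fst z) (snd z))"
    by (intro compact_uniformly_continuous continuous_h compact_Times X Y)
  then obtain d where d: "d > 0" "\<And>z z'. z \<in> X \<times> Y \<Longrightarrow> z' \<in> X \<times> Y \<Longrightarrow> dist z' z < d \<Longrightarrow> \<bar>h (fst z') (snd z') - h (fst z) (snd z)\<bar> < e"
    using e unfolding uniformly_continuous_on_def dist_real_def by metis
  show ?thesis
  proof (intro exI[of _ "d/2"] conjI ballI impI)
    fix x x' y y' assume *: "x \<in> X" "x' \<in> X" "y \<in> Y" "y' \<in> Y" "dist x x' < d/2" "dist y y' < d/2"
    then have "dist (x, y) (x', y') < d"
      unfolding dist_Pair_Pair by (intro le_less_trans[OF sqrt_sum_squares_le_sum]) auto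
    then show "h x y \<le> h x' y' + e" using d(2)[of "(x', y')" "(x, y)"] * by simp
  qed (use d in simp)
qed

text \<open>Kantorovich potentials. Cyclical monotonicity bounds the chain prices from below, so that the
  infimum is finite on the projection of \<open>\<Gamma>\<close>. There it is continuous, because the cost is uniformly
  continuous on compact sets. The second potential is the cost transform of the first one.\<close>

lemma potentials:
  assumes \<Gamma>: "compact \<Gamma>" "\<Gamma> \<noteq> {}" "cyclically_monotone h \<Gamma>"
  obtains \<phi> \<psi> :: "'m \<Rightarrow> real" where "continuous_on (fst ` \<Gamma>) \<phi>" "continuous_on (snd ` \<Gamma>) \<psi>"
    "\<forall>x\<in>fst ` \<Gamma>. \<forall>y\<in>snd ` \<Gamma>. \<phi> x + \<psi> y \<le> h x y" "\<forall>z\<in>\<Gamma>. \<phi> (fst z) + \<psi> (snd z) = h (fst z) (snd z)"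
proof -
  obtain z0 where z0: "z0 \<in> \<Gamma>" using \<Gamma>(2) by blast
  define X where "X = fst ` \<Gamma>" define Y where "Y = snd ` \<Gamma>"
  have XY: "compact X" "compact Y" unfolding X_def Y_def using \<Gamma>(1) by (auto intro!: compact_continuous_image continuous_intros)
  define C where "C = {(z, r). chain h \<Gamma> z0 z r}"
  have C: "z \<in> \<Gamma>" if "(z, r) \<in> C" for z r using that z0 by (auto simp: C_def elim: chain.cases)
  have "(z0, 0) \<in> C" using chain.start[of h \<Gamma> z0] by (simp add: C_def)
  then have Cne: "C \<noteq> {}" by blast
  define F where "F c x = snd c + h x (snd (fst c)) - h (fst (fst c)) (snd (fst c))" for c :: "('m \<times> 'm) \<times> real" and x
  define \<phi> where "\<phi> x = (INF c\<in>C. F c x)" for x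
  have stepC: "(z', F c (fst z')) \<in> C" if "c \<in> C" "z' \<in> \<Gamma>" for c z'
    using that chain.step[of h \<Gamma> z0 "fst c" "snd c" z'] by (auto simp: C_def F_def)
  have bdd: "bdd_below ((\<lambda>c. F c x) ` C)" if x: "x \<in> X" for x
  proof -
    obtain z' where z': "z' \<in> \<Gamma>" "x = fst z'" using x by (auto simp: X_def)
    have "h (fst z') (snd z') - h (fst z0) (snd z') \<le> F c x" if "c \<in> C" for c
      using chain_closed[OF _ z0 \<Gamma>(3), of z' "F c (fst z')"] stepC[OF that z'(1)] z' by (auto simp: C_def)
    then show ?thesis by (intro bdd_belowI2)
  qed
  have c\<phi>: "continuous_on X \<phi>"
    unfolding \<phi>_def[abs_def]
  proof (rule continuous_on_INF_equicontinuous[OF Cne bdd])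
    fix e :: real assume "e > 0"
    then obtain d where d: "d > 0" "\<And>x x' y. x \<in> X \<Longrightarrow> x' \<in> X \<Longrightarrow> y \<in> Y \<Longrightarrow> dist x x' < d \<Longrightarrow> h x y \<le> h x' y + e"
      using uniform_h[OF XY, of e] by (metis dist_self)
    have "F c x \<le> F c x' + e" if "c \<in> C" "x \<in> X" "x' \<in> X" "dist x x' < d" for c x x'
    proof -
      have "snd (fst c) \<in> Y" using C[of "fst c" "snd c"] that by (auto simp: Y_def)
      then show ?thesis using d(2)[of x x' "snd (fst c)"] that by (simp add: F_def)
    qed
    then show "\<exists>d>0. \<forall>c\<in>C. \<forall>x\<in>X. \<forall>x'\<in>X. dist x x' < d \<longrightarrow> F c x \<le> F c x' + e" using d(1) by blast
  qed
  have key: "\<phi> x' - h x' (snd z) \<le> \<phi> (fst z) - h (fst z) (snd z)" if z: "z \<in> \<Gamma>" and x': "x' \<in> X" for z x'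
  proof -
    have "\<phi> x' - h x' (snd z) + h (fst z) (snd z) \<le> \<phi> (fst z)"
      unfolding \<phi>_def[of "fst z"]
    proof (rule cINF_greatest[OF Cne])
      fix c assume c: "c \<in> C"
      have "\<phi> x' \<le> F (z, F c (fst z)) x'" unfolding \<phi>_def by (rule cINF_lower[OF bdd[OF x'] stepC[OF c z]])
      then show "\<phi> x' - h x' (snd z) + h (fst z) (snd z) \<le> F c (fst z)" by (simp add: F_def[of "(z, F c (fst z))"])
    qed
    then show ?thesis by simp
  qed
  define \<psi> where "\<psi> y = (INF x\<in>X. h x y - \<phi> x)" for y
  have Xne: "X \<noteq> {}" using z0 by (auto simp: X_def)
  have bdd': "bdd_below ((\<lambda>x. h x y - \<phi> x) ` X)" if "y \<in> Y" for y
  proof -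
    obtain z where "z \<in> \<Gamma>" "y = snd z" using \<open>y \<in> Y\<close> by (auto simp: Y_def)
    then show ?thesis using key[of z] by (intro bdd_belowI2[of _ "h (fst z) (snd z) - \<phi> (fst z)"]) force
  qed
  have c\<psi>: "continuous_on Y \<psi>"
    unfolding \<psi>_def[abs_def]
  proof (rule continuous_on_INF_equicontinuous[OF Xne bdd'])
    fix e :: real assume "e > 0"
    then obtain d where d: "d > 0" "\<And>x y y'. x \<in> X \<Longrightarrow> y \<in> Y \<Longrightarrow> y' \<in> Y \<Longrightarrow> dist y y' < d \<Longrightarrow> h x y \<le> h x y' + e"
      using uniform_h[OF XY, of e] by (metis dist_self)
    then show "\<exists>d>0. \<forall>x\<in>X. \<forall>y\<in>Y. \<forall>y'\<in>Y. dist y y' < d \<longrightarrow> h x y - \<phi> x \<le> h x y' - \<phi> x + e" by force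
  qed
  have le: "\<phi> x + \<psi> y \<le> h x y" if "x \<in> X" "y \<in> Y" for x y
    using cINF_lower[OF bdd'[OF that(2)] that(1)] by (simp add: \<psi>_def)
  have eq: "\<phi> (fst z) + \<psi> (snd z) = h (fst z) (snd z)" if z: "z \<in> \<Gamma>" for z
  proof (rule antisym)
    show "\<phi> (fst z) + \<psi> (snd z) \<le> h (fst z) (snd z)" using z by (intro le) (auto simp: X_def Y_def)
    have "h (fst z) (snd z) - \<phi> (fst z) \<le> \<psi> (snd z)"
      unfolding \<psi>_def
    proof (rule cINF_greatest[OF Xne])
      fix x assume "x \<in> X"
      then show "h (fst z) (snd z) - \<phi> (fst z) \<le> h x (snd z) - \<phi> x" using key[OF z, of x] by linarith
    qed
    then show "h (fst z) (snd z) \<le> \<phi> (fst z) + \<psi> (snd z)" by simp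
  qed
  show thesis
    by (rule that[of \<phi> \<psi>]) (use c\<phi> c\<psi> le eq in \<open>auto simp: X_def Y_def\<close>)
qed

lemma coupling_emeasure:
  fixes q :: "('m \<times> 'm) measure"
  assumes "coupling \<nu>\<^sub>1 \<nu>\<^sub>2 q" "Z \<in> sets borel"
  shows "emeasure q (Z \<times> UNIV) = emeasure \<nu>\<^sub>1 Z" "emeasure q (UNIV \<times> Z) = emeasure \<nu>\<^sub>2 Z"
  using assms emeasure_fst_snd[of q Z] by (auto simp: coupling_def)

lemma coupling_nn_integral:
  fixes q :: "('m \<times> 'm) measure"
  assumes "coupling \<nu>\<^sub>1 \<nu>\<^sub>2 q" "f \<in> borel_measurable borel"
  shows "(\<integral>\<^sup>+z. f (fst z) \<partial>q) = (\<integral>\<^sup>+x. f x \<partial>\<nu>\<^sub>1)" "(\<integral>\<^sup>+z. f (snd z) \<partial>q) = (\<integral>\<^sup>+x. f x \<partial>\<nu>\<^sub>2)"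
proof -
  have s: "sets q = sets borel" and 1: "\<nu>\<^sub>1 = distr q borel fst" "\<nu>\<^sub>2 = distr q borel snd" using assms(1) by (auto simp: coupling_def)
  show "(\<integral>\<^sup>+z. f (fst z) \<partial>q) = (\<integral>\<^sup>+x. f x \<partial>\<nu>\<^sub>1)" "(\<integral>\<^sup>+z. f (snd z) \<partial>q) = (\<integral>\<^sup>+x. f x \<partial>\<nu>\<^sub>2)"
    unfolding 1 using nn_integral_distr_borel[OF s fst_borel assms(2)] nn_integral_distr_borel[OF s snd_borel assms(2)] by auto
qed

lemma AE_not_in_emeasure0:
  assumes "sets q = sets borel" "A \<in> sets borel" "emeasure q (- A) = 0" shows "AE z in q. z \<in> A"
proof -
  have "- A \<in> null_sets q" using assms borel_comp[of A] by (intro null_setsI) auto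
  then show ?thesis by (auto dest: AE_not_in)
qed

text \<open>The easy half of duality. The potentials have to be bounded from below only; the constant \<open>C\<close>
  compensates for the shift that makes them nonnegative.\<close>

lemma optimal_by_potentials:
  fixes \<phi> \<psi> :: "'m \<Rightarrow> ennreal" and C :: real
  assumes \<pi>: "coupling \<nu>\<^sub>1 \<nu>\<^sub>2 \<pi>" "prob_space \<pi>" and C: "C \<ge> 0"
    and m: "\<phi> \<in> borel_measurable borel" "\<psi> \<in> borel_measurable borel" "X \<in> sets borel" "Y \<in> sets borel"
    and XY: "emeasure \<pi> ((- X) \<times> UNIV) = 0" "emeasure \<pi> (UNIV \<times> (- Y)) = 0"
    and eq: "AE z in \<pi>. cost \<rho> z + ennreal C \<le> \<phi> (fst z) + \<psi> (snd z)"
    and le: "\<And>x y. x \<in> X \<Longrightarrow> y \<in> Y \<Longrightarrow> \<phi> x + \<psi> y \<le> cost \<rho> (x, y) + ennreal C"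
  shows "optimal_coupling \<rho> \<nu>\<^sub>1 \<nu>\<^sub>2 \<pi>"
  unfolding optimal_coupling_def
proof (intro conjI allI impI \<pi>(1))
  fix q' assume q': "coupling \<nu>\<^sub>1 \<nu>\<^sub>2 q'"
  have s: "sets \<pi> = sets borel" "sets q' = sets borel" using \<pi>(1) q' by (auto simp: coupling_def)
  have U: "(UNIV :: ('m \<times> 'm) set) = UNIV \<times> UNIV" by simp
  have one: "emeasure \<pi> UNIV = 1" using prob_space.emeasure_space_1[OF \<pi>(2)] by (simp add: sets_eq_imp_space_eq[OF s(1)])
  have one': "emeasure q' UNIV = 1"
    using coupling_emeasure(1)[OF q', of UNIV] coupling_emeasure(1)[OF \<pi>(1), of UNIV] one by simp
  have cX: "- X \<in> sets borel" "- Y \<in> sets borel" using m by (auto intro: borel_comp)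
  have "AE z in q'. z \<in> X \<times> UNIV" "AE z in q'. z \<in> UNIV \<times> Y"
  proof -
    have "- (X \<times> UNIV) = (- X) \<times> (UNIV :: 'm set)" "- (UNIV \<times> Y) = (UNIV :: 'm set) \<times> (- Y)" by auto
    then have "emeasure q' (- (X \<times> UNIV)) = 0" "emeasure q' (- (UNIV \<times> Y)) = 0"
      using coupling_emeasure[OF q' cX(1)] coupling_emeasure[OF q' cX(2)] coupling_emeasure[OF \<pi>(1) cX(1)] coupling_emeasure[OF \<pi>(1) cX(2)] XY
      by auto
    then show "AE z in q'. z \<in> X \<times> UNIV" "AE z in q'. z \<in> UNIV \<times> Y"
      using s m by (auto intro!: AE_not_in_emeasure0 rectangle_borel)
  qed
  then have le': "AE z in q'. \<phi> (fst z) + \<psi> (snd z) \<le> cost \<rho> z + ennreal C"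
    by eventually_elim (use le in auto)
  have meas: "(\<lambda>z :: 'm \<times> 'm. \<phi> (fst z)) \<in> borel_measurable borel" "(\<lambda>z :: 'm \<times> 'm. \<psi> (snd z)) \<in> borel_measurable borel"
    using measurable_compose[OF fst_borel m(1)] measurable_compose[OF snd_borel m(2)] by auto
  have int: "(\<integral>\<^sup>+z. \<phi> (fst z) + \<psi> (snd z) \<partial>q) = (\<integral>\<^sup>+x. \<phi> x \<partial>\<nu>\<^sub>1) + (\<integral>\<^sup>+y. \<psi> y \<partial>\<nu>\<^sub>2)" if "coupling \<nu>\<^sub>1 \<nu>\<^sub>2 q" for q
  proof -
    have "sets q = sets borel" using that by (simp add: coupling_def)
    then show ?thesis using meas coupling_nn_integral[OF that m(1)] coupling_nn_integral[OF that m(2)]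
      by (subst nn_integral_add) (simp_all cong: measurable_cong_sets)
  qed
  have cst: "(\<integral>\<^sup>+z. cost \<rho> z + ennreal C \<partial>q) = (\<integral>\<^sup>+z. cost \<rho> z \<partial>q) + ennreal C"
    if "sets q = sets borel" "emeasure q UNIV = 1" for q :: "('m \<times> 'm) measure"
    using that cost_measurable by (subst nn_integral_add) (simp_all add: sets_eq_imp_space_eq[OF that(1)] cong: measurable_cong_sets)
  have "(\<integral>\<^sup>+z. cost \<rho> z \<partial>\<pi>) + ennreal C \<le> (\<integral>\<^sup>+z. \<phi> (fst z) + \<psi> (snd z) \<partial>\<pi>)"
    unfolding cst[OF s(1) one, symmetric] by (rule nn_integral_mono_AE[OF eq])
  also have "\<dots> = (\<integral>\<^sup>+z. \<phi> (fst z) + \<psi> (snd z) \<partial>q')" using int[OF \<pi>(1)] int[OF q'] by simp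
  also have "\<dots> \<le> (\<integral>\<^sup>+z. cost \<rho> z \<partial>q') + ennreal C"
    unfolding cst[OF s(2) one', symmetric] by (rule nn_integral_mono_AE[OF le'])
  finally show "(\<integral>\<^sup>+z. cost \<rho> z \<partial>\<pi>) \<le> (\<integral>\<^sup>+z. cost \<rho> z \<partial>q')"
    by (simp add: add.commute[of _ "ennreal C"] ennreal_add_left_cancel_le)
qed

text \<open>The potentials are bounded by \<open>A\<close> and \<open>B\<close> on the compact projections. Outside of these they are set
  to 0; every coupling of the same marginals is concentrated inside.\<close>

lemma cyclically_monotone_optimal:
  assumes \<pi>: "coupling \<nu>\<^sub>1 \<nu>\<^sub>2 \<pi>" "prob_space \<pi>" and \<Gamma>: "compact \<Gamma>" "cyclically_monotone h \<Gamma>" "emeasure \<pi> (- \<Gamma>) = 0"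
  shows "optimal_coupling \<rho> \<nu>\<^sub>1 \<nu>\<^sub>2 \<pi>"
proof -
  have s: "sets \<pi> = sets borel" using \<pi>(1) by (simp add: coupling_def)
  have ne: "\<Gamma> \<noteq> {}" using \<Gamma>(3) prob_space.emeasure_space_1[OF \<pi>(2)] by (auto simp: sets_eq_imp_space_eq[OF s])
  obtain \<phi> \<psi> where p: "continuous_on (fst ` \<Gamma>) \<phi>" "continuous_on (snd ` \<Gamma>) \<psi>"
    "\<forall>x\<in>fst ` \<Gamma>. \<forall>y\<in>snd ` \<Gamma>. \<phi> x + \<psi> y \<le> h x y" "\<forall>z\<in>\<Gamma>. \<phi> (fst z) + \<psi> (snd z) = h (fst z) (snd z)"
    by (rule potentials[OF \<Gamma>(1) ne \<Gamma>(2)])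
  have XY: "compact (fst ` \<Gamma>)" "compact (snd ` \<Gamma>)" using \<Gamma>(1) by (auto intro!: compact_continuous_image continuous_intros)
  note bXY = borel_compact[OF XY(1)] borel_compact[OF XY(2)]
  obtain A where A: "\<And>x. x \<in> fst ` \<Gamma> \<Longrightarrow> \<bar>\<phi> x\<bar> \<le> A"
    using compact_imp_bounded[OF compact_continuous_image[OF p(1) XY(1)]] unfolding bounded_iff real_norm_def by blast
  obtain B where B: "\<And>y. y \<in> snd ` \<Gamma> \<Longrightarrow> \<bar>\<psi> y\<bar> \<le> B"
    using compact_imp_bounded[OF compact_continuous_image[OF p(2) XY(2)]] unfolding bounded_iff real_norm_def by blast
  define \<Phi> where "\<Phi> x = ennreal (indicator (fst ` \<Gamma>) x *\<^sub>R \<phi> x + A)" for x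
  define \<Psi> where "\<Psi> y = ennreal (indicator (snd ` \<Gamma>) y *\<^sub>R \<psi> y + B)" for y
  have AB: "A \<ge> 0" "B \<ge> 0" using ne A B by (metis abs_ge_zero order_trans ex_in_conv image_eqI)+
  have sum: "\<Phi> (fst z) + \<Psi> (snd z) = ennreal (\<phi> (fst z) + \<psi> (snd z) + (A + B))" if "fst z \<in> fst ` \<Gamma>" "snd z \<in> snd ` \<Gamma>" for z
  proof -
    have "0 \<le> \<phi> (fst z) + A" "0 \<le> \<psi> (snd z) + B" using A[OF that(1)] B[OF that(2)] by auto
    then show ?thesis using that by (simp add: \<Phi>_def \<Psi>_def ennreal_plus[symmetric] ac_simps del: ennreal_plus)
  qed
  have b\<Gamma>: "\<Gamma> \<in> sets borel" using \<Gamma>(1) by (rule borel_compact)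
  have null: "emeasure \<pi> Z = 0" if "Z \<subseteq> - \<Gamma>" for Z
    using emeasure_mono[OF that, of \<pi>] borel_comp[OF b\<Gamma>] s \<Gamma>(3) by simp
  show ?thesis
  proof (rule optimal_by_potentials[OF \<pi>, of "A + B" \<Phi> \<Psi> "fst ` \<Gamma>" "snd ` \<Gamma>"])
    show "\<Phi> \<in> borel_measurable borel" "\<Psi> \<in> borel_measurable borel"
      unfolding \<Phi>_def[abs_def] \<Psi>_def[abs_def]
      by (intro measurable_compose[OF _ measurable_ennreal] borel_measurable_add borel_measurable_const
          borel_measurable_continuous_on_indicator bXY p)+
    show "emeasure \<pi> ((- fst ` \<Gamma>) \<times> UNIV) = 0" "emeasure \<pi> (UNIV \<times> (- snd ` \<Gamma>)) = 0"
      by (rule null; force)+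
    show "AE z in \<pi>. cost \<rho> z + ennreal (A + B) \<le> \<Phi> (fst z) + \<Psi> (snd z)"
      using AE_not_in_emeasure0[OF s b\<Gamma> \<Gamma>(3)]
    proof eventually_elim
      case (elim z)
      then have "\<phi> (fst z) + \<psi> (snd z) = h (fst z) (snd z)" using p(4) by blast
      then show ?case using elim AB \<rho>_nonneg by (simp add: sum cost_eq ennreal_plus[symmetric] del: ennreal_plus)
    qed
    show "\<Phi> x + \<Psi> y \<le> cost \<rho> (x, y) + ennreal (A + B)" if "x \<in> fst ` \<Gamma>" "y \<in> snd ` \<Gamma>" for x y
      using sum[of "(x, y)"] p(3)[rule_format, OF that] that AB \<rho>_nonneg
      by (simp add: cost_eq ennreal_plus[symmetric] ennreal_leI del: ennreal_plus)
  qed (use bXY AB in auto)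
qed

text \<open>The hypothesis on transport problems applies to the marginals of \<open>\<pi>\<close>, and its unique solution must be
  \<open>\<pi>\<close>.\<close>

lemma optimal_coupling_map:
  assumes \<pi>: "optimal_coupling \<rho> (distr \<pi> borel fst) (distr \<pi> borel snd) \<pi>" "prob_space \<pi>" "sets \<pi> = sets borel"
    and K: "compact K" "emeasure \<pi> (- K) = 0" and ac: "\<And>Z. Z \<in> sets borel \<Longrightarrow> emeasure m Z = 0 \<Longrightarrow> emeasure \<pi> (Z \<times> UNIV) = 0"
    and sm: "sets m = sets borel"
  shows "\<exists>T\<in>borel_measurable borel. AE z in \<pi>. snd z = T (fst z)"
proof -
  let ?\<nu>1 = "distr \<pi> borel fst" and ?\<nu>2 = "distr \<pi> borel snd"
  have bK: "K \<in> sets borel" "fst ` K \<in> sets borel" "snd ` K \<in> sets borel" and cK: "compact (fst ` K)" "compact (snd ` K)"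
    using K(1) by (auto intro!: borel_compact compact_continuous_image continuous_intros)
  have null: "emeasure \<pi> Z = 0" if "Z \<subseteq> - K" for Z
    using emeasure_mono[OF that, of \<pi>] borel_comp[OF bK(1)] \<pi>(3) K(2) by simp
  have fm: "fst \<in> measurable \<pi> borel" "snd \<in> measurable \<pi> borel" using \<pi>(3) fst_borel snd_borel by (simp_all cong: measurable_cong_sets)
  have "emeasure ?\<nu>1 (- fst ` K) = 0"
    unfolding emeasure_fst_snd(1)[OF \<pi>(3) borel_comp[OF bK(2)]] by (rule null) force
  then have "compactly_supported_prob ?\<nu>1"
    unfolding compactly_supported_prob_def using cK(1) prob_space.prob_space_distr[OF \<pi>(2) fm(1)] by auto
  moreover have "emeasure ?\<nu>2 (- snd ` K) = 0"
    unfolding emeasure_fst_snd(2)[OF \<pi>(3) borel_comp[OF bK(3)]] by (rule null) force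
  then have "compactly_supported_prob ?\<nu>2"
    unfolding compactly_supported_prob_def using cK(2) prob_space.prob_space_distr[OF \<pi>(2) fm(2)] by auto
  moreover have "absolutely_continuous m ?\<nu>1"
    unfolding absolutely_continuous_def using ac sm emeasure_fst_snd(1)[OF \<pi>(3)] by (auto simp: null_sets_def)
  ultimately obtain T where T: "T \<in> borel_measurable borel" "\<pi> = distr ?\<nu>1 borel (\<lambda>x. (x, T x))"
    using unique \<pi>(1) unfolding unique_optimal_transport_def by blast
  have g: "{z. snd z = T (fst z)} \<in> sets borel"
  proof -
    have "(\<lambda>z. dist (snd z) (T (fst z))) \<in> borel_measurable borel"
      by (intro borel_measurable_dist snd_borel measurable_compose[OF fst_borel T(1)])
    then have "(\<lambda>z. dist (snd z) (T (fst z))) -` {0} \<in> sets borel" by (rule vimage_borel) simp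
    moreover have "(\<lambda>z. dist (snd z) (T (fst z))) -` {0} = {z. snd z = T (fst z)}" by auto
    ultimately show ?thesis by simp
  qed
  have p: "(\<lambda>x. (x, T x)) \<in> borel_measurable borel" by (intro borel_measurable_Pair T(1)) simp
  have "AE z in distr ?\<nu>1 borel (\<lambda>x. (x, T x)). snd z = T (fst z)"
    using g p by (subst AE_distr_iff) auto
  then have "AE z in \<pi>. snd z = T (fst z)" by (subst T(2))
  then show ?thesis using T(1) by blast
qed

lemma normalized_prob:
  fixes M :: "'b::topological_space measure"
  assumes s: "sets M = sets borel" and "emeasure M UNIV \<noteq> 0" "emeasure M UNIV \<noteq> \<infinity>"
  shows "prob_space (scale_measure (1 / emeasure M UNIV) M)"
  by (rule prob_spaceI) (use assms in \<open>simp add: space_scale_measure sets_eq_imp_space_eq[OF s] ennreal_divide_mult_cancel\<close>)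

lemma AE_scale_measure: "c \<noteq> 0 \<Longrightarrow> (AE z in scale_measure c M. Q z) \<longleftrightarrow> (AE z in M. Q z)"
  unfolding eventually_ae_filter by (auto simp: null_sets_def space_scale_measure)

lemma AE_restr:
  assumes "sets M = sets borel" "A \<in> sets borel" shows "(AE z in restr M A. Q z) \<longleftrightarrow> (AE z in M. z \<in> A \<longrightarrow> Q z)"
proof -
  have "indicator A \<in> borel_measurable M" using assms by simp
  then show ?thesis by (subst AE_density) (auto simp: indicator_def)
qed

text \<open>The restriction to \<open>K\<close>, normalized, is an optimal coupling of its marginals and hence induced by a
  map. The maps for different \<open>K\<close> need not be compatible.\<close>

lemma local_graph:
  fixes q :: "('m \<times> 'm) measure"
  assumes q: "q \<in> radon_measures" and mono: "cyclically_monotone h (support q)" and K: "compact K"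
    and ac: "\<And>Z. Z \<in> sets borel \<Longrightarrow> emeasure m Z = 0 \<Longrightarrow> emeasure q (Z \<times> UNIV) = 0" and sm: "sets m = sets borel"
  shows "\<exists>T\<in>borel_measurable borel. AE z in q. z \<in> K \<longrightarrow> snd z = T (fst z)"
proof (cases "emeasure q K = 0")
  case True
  have s: "sets q = sets borel" using q by (rule radon_measure_sets)
  have "K \<in> null_sets q" using True s borel_compact[OF K] by (intro null_setsI) auto
  then have "AE z in q. z \<notin> K" by (rule AE_not_in)
  then show ?thesis by (intro bexI[of _ "\<lambda>x. x"]) auto
next
  case False
  have s: "sets q = sets borel" using q by (rule radon_measure_sets)
  have bK: "K \<in> sets borel" using K by (rule borel_compact)
  define \<pi> where "\<pi> = scale_measure (1 / emeasure (restr q K) UNIV) (restr q K)"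
  have s\<pi>: "sets \<pi> = sets borel" by (simp add: \<pi>_def s)
  have rK: "emeasure (restr q K) Z = emeasure q (K \<inter> Z)" if "Z \<in> sets borel" for Z using emeasure_restr[OF s bK that] .
  have qK: "emeasure q K \<noteq> \<infinity>" using radon_measure_finite[OF q K] by auto
  then have pr: "prob_space \<pi>" unfolding \<pi>_def using False rK[of UNIV] s by (intro normalized_prob) auto
  have e\<pi>: "emeasure \<pi> Z = 1 / emeasure q K * emeasure q (K \<inter> Z)" if "Z \<in> sets borel" for Z
    using that rK[of UNIV] rK[of Z] by (simp add: \<pi>_def)
  define \<Gamma> where "\<Gamma> = support q \<inter> K"
  note sup = support_compl_open[OF s]
  have c\<Gamma>: "compact \<Gamma>" unfolding \<Gamma>_def using K sup(1) by (simp add: closed_Int_compact)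
  have "emeasure q (K \<inter> (- \<Gamma>)) \<le> emeasure q (- support q)"
    using s borel_comp[OF borel_closed[OF sup(1)]] by (intro emeasure_mono) (auto simp: \<Gamma>_def)
  then have "emeasure \<pi> (- \<Gamma>) = 0" using e\<pi>[OF borel_comp[OF borel_compact[OF c\<Gamma>]]] sup(2) by simp
  moreover have "cyclically_monotone h \<Gamma>" by (rule cyclically_monotone_subset[OF mono]) (auto simp: \<Gamma>_def)
  moreover have "coupling (distr \<pi> borel fst) (distr \<pi> borel snd) \<pi>" by (simp add: coupling_def s\<pi>)
  ultimately have opt: "optimal_coupling \<rho> (distr \<pi> borel fst) (distr \<pi> borel snd) \<pi>"
    using cyclically_monotone_optimal pr c\<Gamma> by blast
  have "\<exists>T\<in>borel_measurable borel. AE z in \<pi>. snd z = T (fst z)"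
  proof (rule optimal_coupling_map[OF opt pr s\<pi> K])
    show "emeasure \<pi> (- K) = 0" using e\<pi>[OF borel_comp[OF bK]] by simp
    show "emeasure \<pi> (Z \<times> UNIV) = 0" if Z: "Z \<in> sets borel" "emeasure m Z = 0" for Z
    proof -
      have ZU: "Z \<times> (UNIV :: 'm set) \<in> sets borel" using Z by (intro rectangle_borel) auto
      have "emeasure q (K \<inter> Z \<times> UNIV) \<le> emeasure q (Z \<times> UNIV)" using ZU s by (intro emeasure_mono) auto
      then show ?thesis using e\<pi>[OF ZU] ac[OF Z] by simp
    qed
  qed (rule sm)
  moreover have ne: "1 / emeasure (restr q K) UNIV \<noteq> 0" using rK[of UNIV] qK by (simp add: ennreal_divide_eq_0_iff)
  ultimately show ?thesis unfolding \<pi>_def AE_scale_measure[OF ne] AE_restr[OF s bK] by blast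
qed

end

lemma ennreal_gt_one: "1 < (y::ennreal) \<Longrightarrow> \<exists>j. 1 + ennreal (1 / real (Suc j)) < y"
proof -
  assume y: "1 < y"
  show ?thesis
  proof (cases y)
    case (real r)
    then have "0 < r - 1" using y by (simp add: ennreal_less_iff flip: ennreal_1)
    then obtain j where "1 / real (Suc j) < r - 1" using nat_approx_posE by blast
    then have "1 + 1 / real (Suc j) < r" by linarith
    then have "ennreal (1 + 1 / real (Suc j)) < ennreal r" using \<open>0 < r - 1\<close> by (intro ennreal_lessI) linarith+
    then have "ennreal (1 + 1 / real (Suc j)) < y" using real by simp
    moreover have "ennreal (1 + 1 / real (Suc j)) = 1 + ennreal (1 / real (Suc j))" by (subst ennreal_plus) auto
    ultimately show ?thesis by (intro exI[of _ j]) (simp only:)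
  next
    case top
    then show ?thesis by (intro exI[of _ 0]) (simp add: less_top[symmetric])
  qed
qed

definition average :: "'a::topological_space measure \<Rightarrow> 'a measure \<Rightarrow> 'a measure" where
  "average q1 q2 = scale_measure (1/2) (add_measure q1 q2)"

context unique_transport begin

lemma sigma_finite_radon:
  fixes q :: "('m \<times> 'm) measure"
  assumes q: "q \<in> radon_measures" shows "sigma_finite_measure q"
proof -
  have s: "sets q = sets borel" using q by (rule radon_measure_sets)
  obtain V :: "nat \<Rightarrow> ('m \<times> 'm) set" where V: "\<And>n. compact (closure (V n))" "(\<Union>n. V n) = UNIV"
    using open_exhaustion[OF locally_compact_Times[OF lc lc]] by metis
  have "(\<Union>n. V n) \<subseteq> (\<Union>n. closure (V n))" by (intro UN_mono closure_subset) auto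
  then have "(\<Union>n. closure (V n)) = UNIV" using V(2) by auto
  then show ?thesis
    by (intro sigma_finite_measure.intro exI[of _ "range (\<lambda>n. closure (V n))"])
      (use radon_measure_finite[OF q V(1)] s in \<open>auto simp: sets_eq_imp_space_eq[OF s] less_top\<close>)
qed

lemma closed_unused: "closed (unused (\<nu> :: 'm measure) (q :: ('m \<times> 'm) measure))"
proof -
  have "- unused \<nu> q = \<Union> {U. open U \<and> compact (closure U) \<and> \<not> emeasure q (U \<times> UNIV) < emeasure \<nu> U}"
    by (auto simp: unused_def)
  then have "open (- unused \<nu> q)" by (metis (no_types, lifting) mem_Collect_eq open_Union)
  then show ?thesis by (simp add: closed_def)
qed

text \<open>If \<open>q\<close> exhausts \<open>\<nu>\<close> in \<open>U\<close>, while in \<open>U \<inter> E\<close> there is at least \<open>1 + e\<close> times as much mass as \<open>q\<close> uses, then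
  \<open>q\<close> uses nothing of \<open>U \<inter> E\<close>. Countably many such \<open>U\<close> cover the sources in \<open>E\<close> outside of
  \<^term>\<open>unused \<nu> q\<close>.\<close>

lemma surplus_sources_unused:
  fixes q :: "('m \<times> 'm) measure"
  assumes s: "sets q = sets borel" "sets \<nu> = sets borel" and le: "\<And>Z. Z \<in> sets borel \<Longrightarrow> emeasure q (Z \<times> UNIV) \<le> emeasure \<nu> Z"
    and fin: "\<And>K. compact K \<Longrightarrow> emeasure \<nu> K < \<infinity>"
    and E: "E \<in> sets borel" and e: "0 < e"
    and surplus: "\<And>Z. Z \<in> sets borel \<Longrightarrow> Z \<subseteq> E \<Longrightarrow> (1 + ennreal e) * emeasure q (Z \<times> UNIV) \<le> emeasure \<nu> Z"
  shows "AE z in q. fst z \<in> E \<longrightarrow> fst z \<in> unused \<nu> q"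
proof -
  have R: "Z \<times> UNIV \<in> sets (borel :: ('m \<times> 'm) measure)" if "Z \<in> sets borel" for Z :: "'m set"
    using that by (intro rectangle_borel) auto
  have zero: "emeasure q ((U \<inter> E) \<times> UNIV) = 0"
    if U: "open U" "compact (closure U)" and n: "\<not> emeasure q (U \<times> UNIV) < emeasure \<nu> U" for U :: "'m set"
  proof -
    let ?t = "emeasure q ((U \<inter> E) \<times> UNIV)" and ?u = "emeasure q ((U - E) \<times> UNIV)"
    have b: "U \<in> sets borel" "U \<inter> E \<in> sets borel" "U - E \<in> sets borel" using U E by auto
    have "emeasure \<nu> U \<le> emeasure \<nu> (closure U)" using s closure_subset by (intro emeasure_mono) auto
    then have fU: "emeasure \<nu> U < \<infinity>" using fin[OF U(2)] by (rule le_less_trans)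
    have "emeasure q (U \<times> UNIV) = ?t + ?u"
      using R[OF b(2)] R[OF b(3)] s by (subst plus_emeasure) (auto intro: arg_cong[where f="emeasure q"])
    then have tu: "emeasure \<nu> U \<le> ?t + ?u" using n by simp
    have "(1 + ennreal e) * ?t + ?u \<le> emeasure \<nu> (U \<inter> E) + emeasure \<nu> (U - E)"
      by (intro add_mono surplus le b) auto
    also have "\<dots> = emeasure \<nu> U" using b s by (subst plus_emeasure) (auto intro: arg_cong[where f="emeasure \<nu>"])
    finally have le1: "(1 + ennreal e) * ?t + ?u \<le> emeasure \<nu> U" .
    have "?u \<le> emeasure \<nu> U" using le1 by (metis add.commute le_iff_add order_trans)
    then have fu: "?u \<noteq> top" using fU by (auto simp: top_unique)
    have "?t \<le> emeasure \<nu> (U \<inter> E)" by (rule le[OF b(2)])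
    also have "\<dots> \<le> emeasure \<nu> U" using b s by (intro emeasure_mono) auto
    finally have ft: "?t \<noteq> top" using fU by (auto simp: top_unique)
    have "?u + (?t + ennreal e * ?t) \<le> ?u + ?t" using order_trans[OF le1 tu] by (simp add: distrib_right ac_simps)
    then have "?t + ennreal e * ?t \<le> ?t + 0" using fu by (simp add: ennreal_add_left_cancel_le)
    then have "ennreal e * ?t = 0" using ft by (subst (asm) ennreal_add_left_cancel_le) auto
    then show ?thesis using e by simp
  qed
  obtain \<B> :: "'m set set" where B: "countable \<B>" "\<And>U. U \<in> \<B> \<Longrightarrow> open U" "\<And>x W. open W \<Longrightarrow> x \<in> W \<Longrightarrow> \<exists>U\<in>\<B>. x \<in> U \<and> U \<subseteq> W"
    using countable_base by metis
  have "(\<Union>U\<in>{U\<in>\<B>. emeasure q ((U \<inter> E) \<times> UNIV) = 0}. (U \<inter> E) \<times> UNIV) \<in> null_sets q"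
    using B(1,2) E s by (intro null_sets_UN') (auto intro!: null_setsI R)
  then have "AE z in q. z \<notin> (\<Union>U\<in>{U\<in>\<B>. emeasure q ((U \<inter> E) \<times> UNIV) = 0}. (U \<inter> E) \<times> UNIV)" by (rule AE_not_in)
  then show ?thesis
  proof eventually_elim
    case (elim z)
    show ?case
    proof (intro impI, rule ccontr)
      assume z: "fst z \<in> E" "fst z \<notin> unused \<nu> q"
      then obtain U where U: "open U" "compact (closure U)" "fst z \<in> U" "\<not> emeasure q (U \<times> UNIV) < emeasure \<nu> U"
        by (auto simp: unused_def)
      obtain U' where U': "U' \<in> \<B>" "fst z \<in> U'" "U' \<subseteq> U" using B(3) U by blast
      have "emeasure q ((U' \<inter> E) \<times> UNIV) \<le> emeasure q ((U \<inter> E) \<times> UNIV)"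
        using U U' s E by (intro emeasure_mono) (auto intro!: R)
      then have "emeasure q ((U' \<inter> E) \<times> UNIV) = 0" using zero[OF U(1,2,4)] by simp
      then show False using elim U' z by (auto simp: mem_Times_iff)
    qed
  qed
qed

text \<open>Here \<open>S\<close> stands for the unused sources. If sources in \<open>S\<close> are sent elsewhere, consider the coupling that
  sends half of their mass to the target and leaves half in place. The cost of the distance to \<open>S\<close> is a
  dual potential for it: by assumption each target is at its distance from \<open>S\<close> to its own source. So
  the coupling is optimal although it is not induced by a map.\<close>

lemma unused_sources_stay:
  fixes q :: "('m \<times> 'm) measure"
  assumes q: "q \<in> radon_measures" and S: "closed S"
    and near: "\<And>z x. z \<in> support q \<Longrightarrow> x \<in> S \<Longrightarrow> h (fst z) (snd z) \<le> h x (snd z)"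
    and ac: "\<And>Z. Z \<in> sets borel \<Longrightarrow> emeasure m Z = 0 \<Longrightarrow> emeasure q (Z \<times> UNIV) = 0" and sm: "sets m = sets borel"
  shows "AE z in q. fst z \<in> S \<longrightarrow> fst z = snd z"
proof -
  have s: "sets q = sets borel" using q by (rule radon_measure_sets)
  define D where "D = {z :: 'm \<times> 'm. fst z \<in> S \<and> fst z \<noteq> snd z \<and> z \<in> support q}"
  have bD: "D \<in> sets borel"
  proof -
    have "D = (fst -` S \<inter> support q) - {z. fst z = snd z}" by (auto simp: D_def)
    moreover have "closed (fst -` S :: ('m \<times> 'm) set)" using S by (intro closed_vimage continuous_intros) auto
    moreover have "closed {z :: 'm \<times> 'm. fst z = snd z}" by (intro closed_Collect_eq continuous_intros)
    ultimately show ?thesis using support_compl_open(1)[OF s] by (auto intro!: sets.Diff borel_closed)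
  qed
  obtain V :: "nat \<Rightarrow> ('m \<times> 'm) set" where V: "\<And>n. open (V n)" "\<And>n. compact (closure (V n))" "(\<Union>n. V n) = UNIV"
    using open_exhaustion[OF locally_compact_Times[OF lc lc]] by metis
  have bV: "closure (V n) \<in> sets borel" for n by auto
  have null: "emeasure q (D \<inter> closure (V n)) = 0" for n
  proof (rule ccontr)
    assume pos: "emeasure q (D \<inter> closure (V n)) \<noteq> 0"
    define E where "E = D \<inter> closure (V n)"
    have bE: "E \<in> sets borel" using bD bV by (auto simp: E_def)
    have "emeasure q E \<le> emeasure q (closure (V n))" using s by (intro emeasure_mono) (auto simp: E_def)
    then have fE: "emeasure q E \<noteq> \<infinity>" using radon_measure_finite[OF q V(2), of n] by (auto simp: top_unique)
    define \<pi>E where "\<pi>E = scale_measure (1 / emeasure (restr q E) UNIV) (restr q E)"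
    have sE: "sets \<pi>E = sets borel" by (simp add: \<pi>E_def s)
    have rE: "emeasure (restr q E) Z = emeasure q (E \<inter> Z)" if "Z \<in> sets borel" for Z using emeasure_restr[OF s bE that] .
    have c0: "1 / emeasure (restr q E) UNIV \<noteq> 0" using rE[of UNIV] fE by (simp add: ennreal_divide_eq_0_iff)
    have prE: "prob_space \<pi>E" unfolding \<pi>E_def using pos fE rE[of UNIV] s by (intro normalized_prob) (auto simp: E_def)
    have e\<pi>E: "emeasure \<pi>E Z = 1 / emeasure q E * emeasure q (E \<inter> Z)" if "Z \<in> sets borel" for Z
      using that rE[of UNIV] rE[of Z] by (simp add: \<pi>E_def)
    have AE_E: "AE z in \<pi>E. z \<in> E" unfolding \<pi>E_def AE_scale_measure[OF c0] AE_restr[OF s bE] by simp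
    define K where "K = closure (V n)"
    have K: "compact K" by (simp add: K_def V)
    define K' where "K' = fst ` K \<union> snd ` K"
    have cfK: "compact (fst ` K)" using K by (auto intro!: compact_continuous_image continuous_intros)
    have cK': "compact K'" unfolding K'_def using K by (auto intro!: compact_Un compact_continuous_image continuous_intros)
    have one: "emeasure \<pi>E UNIV = 1" using prob_space.emeasure_space_1[OF prE] by (simp add: sets_eq_imp_space_eq[OF sE])
    \<comment> \<open>the coupling that splits each source in \<open>S\<close>\<close>
    define stay where "stay = distr \<pi>E borel (\<lambda>z. (fst z, fst z))"
    have pm: "(\<lambda>z :: 'm \<times> 'm. (fst z, fst z)) \<in> borel_measurable borel" by (intro borel_measurable_Pair fst_borel)
    have sst: "sets stay = sets borel" by (simp add: stay_def)
    define \<pi> where "\<pi> = scale_measure (1/2) (add_measure \<pi>E stay)"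
    have s\<pi>: "sets \<pi> = sets borel" by (simp add: \<pi>_def)
    have e\<pi>: "emeasure \<pi> Z = 1/2 * (emeasure \<pi>E Z + emeasure \<pi>E {z. (fst z, fst z) \<in> Z})" if Z: "Z \<in> sets borel" for Z
      using emeasure_distr_borel[OF sE pm Z] Z sE sst
      by (simp add: \<pi>_def emeasure_add_measure stay_def vimage_def)
    have pr: "prob_space \<pi>"
      by (rule prob_spaceI) (use e\<pi>[of UNIV] one half_double[of 1] in \<open>simp add: sets_eq_imp_space_eq[OF s\<pi>]\<close>)
    have AE_\<pi>: "(AE z in \<pi>. Q z) \<longleftrightarrow> (AE z in \<pi>E. Q z \<and> Q (fst z, fst z))" if Q: "{z. Q z} \<in> sets borel" for Q :: "'m \<times> 'm \<Rightarrow> bool"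
    proof -
      have nQ: "{z. \<not> Q z} \<in> sets borel" using borel_comp[OF Q] by (simp add: Collect_neg_eq)
      have nQ': "{z :: 'm \<times> 'm. \<not> Q (fst z, fst z)} \<in> sets borel" using vimage_borel[OF pm nQ] by (simp add: vimage_def)
      have "(AE z in \<pi>. Q z) \<longleftrightarrow> emeasure \<pi> {z. \<not> Q z} = 0"
        using nQ s\<pi> by (subst AE_iff_measurable[where N="{z. \<not> Q z}"]) (auto simp: sets_eq_imp_space_eq[OF s\<pi>])
      also have "\<dots> \<longleftrightarrow> emeasure \<pi>E {z. \<not> Q z} = 0 \<and> emeasure \<pi>E {z. \<not> Q (fst z, fst z)} = 0"
        using e\<pi>[OF nQ] by (simp add: ennreal_divide_eq_0_iff)
      also have "\<dots> \<longleftrightarrow> (AE z in \<pi>E. Q z) \<and> (AE z in \<pi>E. Q (fst z, fst z))"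
        using nQ nQ' sE
        by (subst (1 2) AE_iff_measurable[OF _ refl]) (auto simp: sets_eq_imp_space_eq[OF sE])
      finally show ?thesis by simp
    qed
    define X where "X = S \<inter> fst ` K"
    have cX: "compact X" unfolding X_def using S cfK by (simp add: closed_Int_compact)
    have bX: "X \<in> sets borel" using cX by (rule borel_compact)
    have EX: "fst z \<in> X" "z \<in> K' \<times> K'" "(fst z, fst z) \<in> K' \<times> K'" if "z \<in> E" for z
      using that by (auto simp: E_def D_def X_def K_def K'_def mem_Times_iff)
    define \<psi> where "\<psi> y = ennreal (\<rho> (infdist y X))" for y
    have m\<psi>: "\<psi> \<in> borel_measurable borel"
    proof -
      have "continuous_on UNIV (\<lambda>y. \<rho> (infdist y X))"
        by (rule continuous_on_compose2[OF \<rho>_cont]) (auto intro!: continuous_intros simp: infdist_nonneg)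
      then show ?thesis unfolding \<psi>_def[abs_def]
        by (intro measurable_compose[OF borel_measurable_continuous_onI measurable_ennreal])
    qed
    have opt: "optimal_coupling \<rho> (distr \<pi> borel fst) (distr \<pi> borel snd) \<pi>"
    proof (rule optimal_by_potentials[where C=0 and \<phi>="\<lambda>_. 0" and \<psi>=\<psi> and X=X and Y=UNIV])
      show "coupling (distr \<pi> borel fst) (distr \<pi> borel snd) \<pi>" by (simp add: coupling_def s\<pi>)
      have "AE z in \<pi>. fst z \<in> X"
        by (subst AE_\<pi>) (use vimage_borel[OF fst_borel bX] AE_E EX(1) in \<open>auto simp: vimage_def elim!: eventually_mono\<close>)
      then show "emeasure \<pi> ((- X) \<times> UNIV) = 0"
        using borel_comp[OF bX] s\<pi>
        by (subst (asm) AE_iff_measurable[where N="(- X) \<times> UNIV"]) (auto simp: sets_eq_imp_space_eq[OF s\<pi>] intro!: rectangle_borel)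
      have le: "cost \<rho> z \<le> \<psi> (snd z)" "cost \<rho> (fst z, fst z) \<le> \<psi> (fst z)" if z: "z \<in> E" for z
      proof -
        have "X \<noteq> {}" using EX(1)[OF z] by auto
        then obtain x where x: "x \<in> X" "\<forall>x'\<in>X. dist (snd z) x \<le> dist (snd z) x'"
          using continuous_attains_inf[OF cX _ continuous_on_dist[OF continuous_on_const continuous_on_id], of "snd z"] by auto
        then have "dist (snd z) x \<le> infdist (snd z) X"
          using \<open>X \<noteq> {}\<close> unfolding infdist_notempty[OF \<open>X \<noteq> {}\<close>] by (intro cINF_greatest) auto
        then have hx: "h x (snd z) \<le> \<rho> (infdist (snd z) X)" by (intro \<rho>_le) (auto simp: dist_commute)
        have "z \<in> support q" "x \<in> S" using z x by (auto simp: E_def D_def X_def)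
        then have "h (fst z) (snd z) \<le> h x (snd z)" by (rule near)
        then show "cost \<rho> z \<le> \<psi> (snd z)" using hx unfolding cost_eq \<psi>_def by (intro ennreal_leI) linarith
        show "cost \<rho> (fst z, fst z) \<le> \<psi> (fst z)" using \<rho>_0 by (simp add: cost_eq)
      qed
      have meas: "{z. cost \<rho> z \<le> \<psi> (snd z)} \<in> sets (borel :: ('m \<times> 'm) measure)"
      proof -
        have "(\<lambda>z :: 'm \<times> 'm. \<psi> (snd z)) \<in> borel_measurable borel" by (rule measurable_compose[OF snd_borel m\<psi>])
        from borel_measurable_le[OF cost_measurable this] show ?thesis by simp
      qed
      have "AE z in \<pi>. cost \<rho> z \<le> \<psi> (snd z)"
        by (subst AE_\<pi>[OF meas]) (use AE_E le in \<open>auto elim!: eventually_mono\<close>)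
      then show "AE z in \<pi>. cost \<rho> z + ennreal 0 \<le> 0 + \<psi> (snd z)" by simp
      show "0 + \<psi> y \<le> cost \<rho> (x, y) + ennreal 0" if "x \<in> X" for x y
        using infdist_le[OF that, of y] \<rho>_le[OF infdist_nonneg[of y X], of "dist y x"]
        by (auto simp: cost_eq \<psi>_def dist_commute intro!: ennreal_leI)
    qed (use pr m\<psi> bX in auto)
    obtain T where T: "T \<in> borel_measurable borel" "AE z in \<pi>. snd z = T (fst z)"
    proof -
      have "\<exists>T\<in>borel_measurable borel. AE z in \<pi>. snd z = T (fst z)"
      proof (rule optimal_coupling_map[OF opt pr s\<pi> compact_Times[OF cK' cK']])
        have bK: "K' \<times> K' \<in> sets borel" using cK' by (intro rectangle_borel borel_compact)
        have "AE z in \<pi>. z \<in> K' \<times> K'"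
          by (subst AE_\<pi>) (use bK AE_E EX(2,3) in \<open>auto elim!: eventually_mono\<close>)
        then show "emeasure \<pi> (- (K' \<times> K')) = 0"
          using borel_comp[OF bK] s\<pi>
          by (subst (asm) AE_iff_measurable[where N="- (K' \<times> K')"]) (auto simp: sets_eq_imp_space_eq[OF s\<pi>])
        show "emeasure \<pi> (Z \<times> UNIV) = 0" if Z: "Z \<in> sets borel" "emeasure m Z = 0" for Z
        proof -
          have ZU: "Z \<times> (UNIV :: 'm set) \<in> sets borel" using Z by (intro rectangle_borel) auto
          have "emeasure q (E \<inter> Z \<times> UNIV) \<le> emeasure q (Z \<times> UNIV)" using ZU s by (intro emeasure_mono) auto
          then have "emeasure \<pi>E (Z \<times> UNIV) = 0" using e\<pi>E[OF ZU] ac[OF Z] by simp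
          moreover have "{z :: 'm \<times> 'm. (fst z, fst z) \<in> Z \<times> UNIV} = Z \<times> UNIV" by auto
          ultimately show ?thesis using e\<pi>[OF ZU] by simp
        qed
      qed (rule sm)
      then show thesis using that by blast
    qed
    have g: "{z :: 'm \<times> 'm. snd z = T (fst z)} \<in> sets borel"
    proof -
      have "(\<lambda>z. dist (snd z) (T (fst z))) \<in> borel_measurable borel"
        by (intro borel_measurable_dist snd_borel measurable_compose[OF fst_borel T(1)])
      then have "(\<lambda>z. dist (snd z) (T (fst z))) -` {0} \<in> sets borel" by (rule vimage_borel) simp
      moreover have "(\<lambda>z. dist (snd z) (T (fst z))) -` {0} = {z. snd z = T (fst z)}" by auto
      ultimately show ?thesis by simp
    qed
    have "AE z in \<pi>E. False"
      using T(2)[unfolded AE_\<pi>[OF g]] AE_E by eventually_elim (auto simp: E_def D_def)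
    then show False using prob_space.AE_False[OF prE] by simp
  qed
  have "(\<Union>n. D \<inter> closure (V n)) \<in> null_sets q"
    using null bD s by (intro null_sets_UN) (auto intro!: null_setsI)
  moreover have "(\<Union>n. V n) \<subseteq> (\<Union>n. closure (V n))" by (intro UN_mono closure_subset) auto
  then have "D \<subseteq> (\<Union>n. D \<inter> closure (V n))" using V(3) by auto
  ultimately have "D \<in> null_sets q" using bD s by (metis null_sets_subset sets_eq_imp_space_eq)
  then have "AE z in q. z \<notin> D" by (rule AE_not_in)
  moreover have "AE z in q. z \<in> support q"
    using support_compl_open[OF s] s by (intro AE_not_in_emeasure0) auto
  ultimately show ?thesis by eventually_elim (auto simp: D_def)
qed

text \<open>Since \<open>q\<close> sits on a graph, the density of \<open>q1\<close> is a function of the source. Where it exceeds a constant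
  \<open>c > 1\<close>, the source measure \<open>\<nu>\<close>, which dominates the use by \<open>q1\<close>, exceeds the use by \<open>q\<close> by this factor.
  So the sources there are unused ones in the sense of \<^const>\<open>unused\<close>, and stay where they are.\<close>

lemma excess_off_diagonal:
  fixes q q1 :: "('m \<times> 'm) measure"
  assumes q: "q \<in> radon_measures" and s1: "sets q1 = sets borel" and s\<nu>: "sets \<nu> = sets borel" and sm: "sets m = sets borel"
    and fin: "\<And>K. compact K \<Longrightarrow> emeasure \<nu> K < \<infinity>"
    and dom: "\<And>Z. Z \<in> sets borel \<Longrightarrow> emeasure q Z = 0 \<Longrightarrow> emeasure q1 Z = 0"
    and le: "\<And>Z. Z \<in> sets borel \<Longrightarrow> emeasure q (Z \<times> UNIV) \<le> emeasure \<nu> Z"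
      "\<And>Z. Z \<in> sets borel \<Longrightarrow> emeasure q1 (Z \<times> UNIV) \<le> emeasure \<nu> Z"
    and ac: "absolutely_continuous m \<nu>"
    and mono: "cyclically_monotone h (support q)"
    and far: "\<And>z x. z \<in> support q \<Longrightarrow> x \<in> unused \<nu> q \<Longrightarrow> h (fst z) (snd z) \<le> h x (snd z)"
    and Z: "Z \<in> sets borel" "\<And>x. (x, x) \<notin> Z"
  shows "emeasure q1 Z \<le> emeasure q Z"
proof -
  have s: "sets q = sets borel" using q by (rule radon_measure_sets)
  have acq: "emeasure q (Z \<times> UNIV) = 0" if "Z \<in> sets borel" "emeasure m Z = 0" for Z
  proof -
    have "Z \<in> null_sets m" using that sm by (intro null_setsI) auto
    then have "emeasure \<nu> Z = 0" using ac by (auto simp: absolutely_continuous_def)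
    then show ?thesis using le(1)[OF that(1)] by simp
  qed
  interpret sigma_finite_measure q by (rule sigma_finite_radon[OF q])
  obtain f where f: "f \<in> borel_measurable q" "density q f = q1"
    using Radon_Nikodym[of q1] dom s s1 by (auto simp: absolutely_continuous_def null_sets_def)
  have fb: "f \<in> borel_measurable borel" using f(1) s by (simp cong: measurable_cong_sets)
  obtain V :: "nat \<Rightarrow> ('m \<times> 'm) set" where V: "\<And>n. open (V n)" "\<And>n. compact (closure (V n))" "incseq V" "(\<Union>n. V n) = UNIV"
    using open_exhaustion[OF locally_compact_Times[OF lc lc]] by metis
  have "\<forall>n. \<exists>T. T \<in> borel_measurable borel \<and> (AE z in q. z \<in> closure (V n) \<longrightarrow> snd z = T (fst z))"
    using local_graph[OF q mono V(2) acq sm] by blast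
  from choice[OF this] obtain T where T: "\<And>n. T n \<in> borel_measurable borel" "\<And>n. AE z in q. z \<in> closure (V n) \<longrightarrow> snd z = T n (fst z)"
    by blast
  \<comment> \<open>at almost every point of the graph, \<open>f (x, T n x)\<close> does not depend on \<open>n\<close> for large \<open>n\<close>\<close>
  define F where "F x = limsup (\<lambda>n. f (x, T n x))" for x
  have mF: "F \<in> borel_measurable borel" unfolding F_def[abs_def]
    by (intro borel_measurable_limsup measurable_compose[OF _ fb] borel_measurable_Pair T) simp
  have "AE z in q. \<forall>n. z \<in> closure (V n) \<longrightarrow> snd z = T n (fst z)" using T(2) by (simp add: AE_all_countable)
  then have fF: "AE z in q. f z = F (fst z)"
  proof eventually_elim
    case (elim z)
    obtain n where n: "z \<in> V n" using V(4) by blast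
    have "f (fst z, T k (fst z)) = f z" if "n \<le> k" for k
    proof -
      have "z \<in> closure (V k)" using incseqD[OF V(3) that] n closure_subset by blast
      then have "snd z = T k (fst z)" using elim by blast
      then show ?thesis by (metis prod.collapse)
    qed
    then have "\<forall>\<^sub>F k in sequentially. f (fst z, T k (fst z)) = f z" by (auto simp: eventually_sequentially)
    then have "(\<lambda>k. f (fst z, T k (fst z))) \<longlonglongrightarrow> f z" by (rule tendsto_eventually)
    then show ?case unfolding F_def by (simp add: lim_imp_Limsup)
  qed
  have "AE z in q. \<forall>j. 1 + ennreal (1 / real (Suc j)) < F (fst z) \<longrightarrow> fst z = snd z"
    unfolding AE_all_countable
  proof
    fix j
    let ?c = "1 + ennreal (1 / real (Suc j))"
    define E where "E = {x. ?c < F x}"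
    have bE: "E \<in> sets borel" unfolding E_def using borel_measurable_less[OF borel_measurable_const mF, of ?c] by simp
    have "AE z in q. fst z \<in> E \<longrightarrow> fst z \<in> unused \<nu> q"
    proof (rule surplus_sources_unused[OF s s\<nu> le(1) fin bE])
      show "0 < 1 / real (Suc j)" by simp
      show "?c * emeasure q (Y \<times> UNIV) \<le> emeasure \<nu> Y" if Y: "Y \<in> sets borel" "Y \<subseteq> E" for Y
      proof -
        have bY: "Y \<times> (UNIV :: 'm set) \<in> sets borel" using Y by (intro rectangle_borel) auto
        have bY': "Y \<times> (UNIV :: 'm set) \<in> sets q" using bY s by simp
        have "?c * emeasure q (Y \<times> UNIV) = (\<integral>\<^sup>+z. ?c * indicator (Y \<times> UNIV) z \<partial>q)"
          using bY' by (simp add: nn_integral_cmult_indicator)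
        also have "\<dots> \<le> (\<integral>\<^sup>+z. f z * indicator (Y \<times> UNIV) z \<partial>q)"
          by (rule nn_integral_mono_AE) (use fF in \<open>eventually_elim, use Y(2) in \<open>auto simp: indicator_def E_def subset_iff intro: less_imp_le\<close>\<close>)
        also have "\<dots> = emeasure q1 (Y \<times> UNIV)" unfolding f(2)[symmetric] using f(1) bY' by (simp add: emeasure_density)
        also have "\<dots> \<le> emeasure \<nu> Y" by (rule le(2)[OF Y(1)])
        finally show ?thesis .
      qed
    qed
    moreover have "AE z in q. fst z \<in> unused \<nu> q \<longrightarrow> fst z = snd z"
      by (rule unused_sources_stay[OF q closed_unused far acq sm])
    ultimately show "AE z in q. ?c < F (fst z) \<longrightarrow> fst z = snd z"
      by eventually_elim (auto simp: E_def)
  qed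
  then have "AE z in q. f z * indicator Z z \<le> indicator Z z"
    using fF
  proof eventually_elim
    case (elim z)
    show ?case
    proof (cases "z \<in> Z")
      case True
      then have "fst z \<noteq> snd z" using Z(2)[of "fst z"] by (metis prod.collapse)
      then have "\<not> 1 < F (fst z)" using elim(1) ennreal_gt_one by blast
      then show ?thesis using elim(2) True by simp
    qed simp
  qed
  then have "(\<integral>\<^sup>+z. f z * indicator Z z \<partial>q) \<le> (\<integral>\<^sup>+z. indicator Z z \<partial>q)" by (rule nn_integral_mono_AE)
  then show ?thesis using f Z(1) s by (metis emeasure_density nn_integral_indicator)
qed

text \<open>Off the diagonal, neither of the two measures exceeds their average, so they agree there. What
  remains of a target's mass comes from the target itself, and is determined by the second marginal.\<close>

lemma semicoupling_unique:
  fixes q1 q2 :: "('m \<times> 'm) measure"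
  assumes q12: "q1 \<in> radon_measures" "q2 \<in> radon_measures" and \<nu>: "\<nu> \<in> radon_measures" and sm: "sets m = sets borel"
    and le: "\<And>Z. Z \<in> sets borel \<Longrightarrow> emeasure q1 (Z \<times> UNIV) \<le> emeasure \<nu> Z"
      "\<And>Z. Z \<in> sets borel \<Longrightarrow> emeasure q2 (Z \<times> UNIV) \<le> emeasure \<nu> Z"
    and eq: "\<And>Z. Z \<in> sets borel \<Longrightarrow> emeasure q1 (UNIV \<times> Z) = emeasure \<mu> Z"
      "\<And>Z. Z \<in> sets borel \<Longrightarrow> emeasure q2 (UNIV \<times> Z) = emeasure \<mu> Z"
    and \<mu>: "\<And>K. compact K \<Longrightarrow> emeasure \<mu> K < \<infinity>"
    and ac: "absolutely_continuous m \<nu>"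
    and mono: "cyclically_monotone h (support (average q1 q2))"
    and far: "\<And>z x. z \<in> support (average q1 q2) \<Longrightarrow> x \<in> unused \<nu> (average q1 q2) \<Longrightarrow> h (fst z) (snd z) \<le> h x (snd z)"
  shows "q1 = q2"
proof -
  let ?q = "average q1 q2"
  have s: "sets q1 = sets borel" "sets q2 = sets borel" "sets \<nu> = sets borel" "sets ?q = sets borel"
    using q12 \<nu> by (auto simp: radon_measure_sets average_def)
  have qe: "emeasure ?q Z = 1/2 * (emeasure q1 Z + emeasure q2 Z)" if "Z \<in> sets borel" for Z
    using that s by (simp add: average_def emeasure_add_measure)
  have rq: "?q \<in> radon_measures"
  proof (rule locally_finite_imp_radon[OF locally_compact_Times[OF lc lc] s(4)])
    fix K :: "('m \<times> 'm) set" assume K: "compact K"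
    let ?t = "emeasure q1 K + emeasure q2 K"
    have "emeasure ?q K \<le> 1/2 * (?t + ?t)" unfolding qe[OF borel_compact[OF K]] by (intro mult_left_mono) auto
    then show "emeasure ?q K < \<infinity>"
      using radon_measure_finite[OF q12(1) K] radon_measure_finite[OF q12(2) K]
      unfolding half_double by (auto intro: le_less_trans)
  qed
  have le': "emeasure ?q (Z \<times> UNIV) \<le> emeasure \<nu> Z" if Z: "Z \<in> sets borel" for Z
  proof -
    have "emeasure ?q (Z \<times> UNIV) \<le> 1/2 * (emeasure \<nu> Z + emeasure \<nu> Z)"
      using Z by (subst qe) (auto intro!: rectangle_borel mult_left_mono add_mono le)
    then show ?thesis by (simp add: half_double)
  qed
  have dom: "emeasure q1 Z = 0 \<and> emeasure q2 Z = 0" if "Z \<in> sets borel" "emeasure ?q Z = 0" for Z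
    using qe[OF that(1)] that(2) by (simp add: ennreal_divide_eq_0_iff)
  have off: "emeasure q1 Z = emeasure q2 Z" if Z: "Z \<in> sets borel" "\<And>x. (x, x) \<notin> Z" "emeasure q1 Z < \<infinity>" "emeasure q2 Z < \<infinity>" for Z
  proof -
    have 1: "emeasure q1 Z \<le> emeasure ?q Z"
      by (rule excess_off_diagonal[OF rq s(1) s(3) sm radon_measure_finite[OF \<nu>] _ le' le(1) ac mono far Z(1,2)])
        (use dom in auto)
    have 2: "emeasure q2 Z \<le> emeasure ?q Z"
      by (rule excess_off_diagonal[OF rq s(2) s(3) sm radon_measure_finite[OF \<nu>] _ le' le(2) ac mono far Z(1,2)])
        (use dom in auto)
    obtain a b where ab: "a \<ge> 0" "b \<ge> 0" "emeasure q1 Z = ennreal a" "emeasure q2 Z = ennreal b"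
      using Z(3,4) by (cases "emeasure q1 Z"; cases "emeasure q2 Z") auto
    have "emeasure ?q Z = ennreal ((a + b) / 2)"
    proof -
      have "emeasure ?q Z = ennreal (a + b) * (1 / 2)" using qe[OF Z(1)] ab by (simp add: mult.commute)
      also have "\<dots> = ennreal (a + b) / 2" by (simp add: ennreal_times_divide)
      also have "\<dots> = ennreal ((a + b) / 2)" using ab by (intro ennreal_divide_numeral) simp
      finally show ?thesis .
    qed
    then have "a \<le> (a + b) / 2" "b \<le> (a + b) / 2" using 1 2 ab by (simp_all add: ennreal_le_iff)
    then show ?thesis using ab by simp
  qed
  obtain V :: "nat \<Rightarrow> 'm set" where V: "\<And>n. open (V n)" "\<And>n. compact (closure (V n))" "incseq V" "(\<Union>n. V n) = UNIV"
    using open_exhaustion[OF lc] by metis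
  define \<Delta> where "\<Delta> = {z :: 'm \<times> 'm. fst z = snd z}"
  have b\<Delta>: "\<Delta> \<in> sets borel" unfolding \<Delta>_def by (intro borel_closed closed_Collect_eq continuous_intros)
  have bUV: "UNIV \<times> V n \<in> sets (borel :: ('m \<times> 'm) measure)" for n using V(1) by (intro rectangle_borel) auto
  have fV: "emeasure \<mu> (V n) < \<infinity>" for n
  proof -
    have "emeasure q1 (UNIV \<times> V n) \<le> emeasure q1 (UNIV \<times> closure (V n))"
      using s closure_subset[of "V n"] by (intro emeasure_mono Sigma_mono) (auto intro!: rectangle_borel)
    then have "emeasure \<mu> (V n) \<le> emeasure \<mu> (closure (V n))" using V(1) by (simp add: eq)
    then show ?thesis using \<mu>[OF V(2)] by (rule le_less_trans)
  qed
  have fin: "emeasure q1 Z < \<infinity>" "emeasure q2 Z < \<infinity>" if "Z \<subseteq> UNIV \<times> V n" for Z n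
  proof -
    have "emeasure q1 Z \<le> emeasure q1 (UNIV \<times> V n)" "emeasure q2 Z \<le> emeasure q2 (UNIV \<times> V n)"
      using that bUV s by (auto intro!: emeasure_mono)
    then show "emeasure q1 Z < \<infinity>" "emeasure q2 Z < \<infinity>" using fV[of n] V(1)
      by (auto simp: eq borel_open intro: le_less_trans)
  qed
  have on: "emeasure q1 (\<Delta> \<inter> UNIV \<times> B) = emeasure q2 (\<Delta> \<inter> UNIV \<times> B)" if B: "B \<in> sets borel" "B \<subseteq> V n" for B n
  proof -
    have bB: "UNIV \<times> B \<in> sets (borel :: ('m \<times> 'm) measure)" using B by (intro rectangle_borel) auto
    have sub: "UNIV \<times> B - \<Delta> \<subseteq> UNIV \<times> V n" using B by auto
    have o: "emeasure q1 (UNIV \<times> B - \<Delta>) = emeasure q2 (UNIV \<times> B - \<Delta>)"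
      using bB b\<Delta> by (intro off fin[OF sub]) (auto simp: \<Delta>_def)
    have split: "emeasure q' (UNIV \<times> B) = emeasure q' (UNIV \<times> B - \<Delta>) + emeasure q' (\<Delta> \<inter> UNIV \<times> B)" if "sets q' = sets borel" for q' :: "('m \<times> 'm) measure"
      using bB b\<Delta> that by (subst plus_emeasure) (auto intro: arg_cong[where f="emeasure q'"])
    show ?thesis using split[OF s(1)] split[OF s(2)] eq[OF B(1)] o fin(2)[OF sub]
      by (auto simp: ennreal_add_left_cancel)
  qed
  have main: "emeasure q1 (Z \<inter> UNIV \<times> V n) = emeasure q2 (Z \<inter> UNIV \<times> V n)" if Z: "Z \<in> sets borel" for Z n
  proof -
    let ?Z = "Z \<inter> UNIV \<times> V n"
    have bZ: "?Z \<in> sets borel" using Z bUV by auto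
    define B where "B = {y. (y, y) \<in> ?Z}"
    have "(\<lambda>y :: 'm. (y, y)) \<in> borel_measurable borel" by (intro borel_measurable_Pair) auto
    from vimage_borel[OF this bZ] have B: "B \<in> sets borel" "B \<subseteq> V n" by (auto simp: B_def vimage_def)
    have d: "?Z \<inter> \<Delta> = \<Delta> \<inter> UNIV \<times> B" by (auto simp: B_def \<Delta>_def)
    have o: "emeasure q1 (?Z - \<Delta>) = emeasure q2 (?Z - \<Delta>)"
      using bZ b\<Delta> by (intro off fin[of _ n]) (auto simp: \<Delta>_def)
    have split: "emeasure q' ?Z = emeasure q' (?Z - \<Delta>) + emeasure q' (?Z \<inter> \<Delta>)" if "sets q' = sets borel" for q' :: "('m \<times> 'm) measure"
      using bZ b\<Delta> that by (subst plus_emeasure) (auto intro: arg_cong[where f="emeasure q'"])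
    show ?thesis using split[OF s(1)] split[OF s(2)] o on[OF B] unfolding d by simp
  qed
  show "q1 = q2"
  proof (rule measure_eqI)
    fix Z assume "Z \<in> sets q1"
    then have Z: "Z \<in> sets borel" using s by simp
    have inc: "incseq (\<lambda>n. (UNIV :: 'm set) \<times> V n)" using V(3) unfolding incseq_def by (auto simp: subset_iff)
    have "(\<Union>n. (UNIV :: 'm set) \<times> V n) = UNIV \<times> (\<Union>n. V n)" by auto
    then have un: "(\<Union>n. (UNIV :: 'm set) \<times> V n) = UNIV" using V(4) by simp
    show "emeasure q1 Z = emeasure q2 Z"
      unfolding emeasure_incseq_SUP[OF s(1) Z inc bUV un] emeasure_incseq_SUP[OF s(2) Z inc bUV un] main[OF Z] ..
  qed (use s in simp)
qed

end

section \<open>Isometries of Riemannian manifolds\<close>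

lemma smooth_atlas_chart:
  assumes A: "smooth_atlas \<A>"
  shows "\<exists>U \<phi>. (U, \<phi>) \<in> \<A> \<and> x \<in> U"
    "(U, \<phi>) \<in> \<A> \<Longrightarrow> open U" "(U, \<phi>) \<in> \<A> \<Longrightarrow> continuous_on U \<phi>"
    "(U, \<phi>) \<in> \<A> \<Longrightarrow> x \<in> U \<Longrightarrow> inv_into U \<phi> (\<phi> x) = x"
    "(U, \<phi>) \<in> \<A> \<Longrightarrow> open W \<Longrightarrow> W \<subseteq> U \<Longrightarrow> open (\<phi> ` W)"
    "(U, \<phi>) \<in> \<A> \<Longrightarrow> open (\<phi> ` U)" "(U, \<phi>) \<in> \<A> \<Longrightarrow> continuous_on (\<phi> ` U) (inv_into U \<phi>)"
proof -
  have "x \<in> (\<Union>(U, \<phi>)\<in>\<A>. U)" using A by (simp add: smooth_atlas_def)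
  then show "\<exists>U \<phi>. (U, \<phi>) \<in> \<A> \<and> x \<in> U" by auto
  assume c: "(U, \<phi>) \<in> \<A>"
  then have h: "open U" "open (\<phi> ` U)" "homeomorphism U (\<phi> ` U) \<phi> (inv_into U \<phi>)" using A by (auto simp: smooth_atlas_def)
  then show "open U" "open (\<phi> ` U)" "continuous_on U \<phi>" "continuous_on (\<phi> ` U) (inv_into U \<phi>)"
    by (auto simp: homeomorphism_def)
  show "x \<in> U \<Longrightarrow> inv_into U \<phi> (\<phi> x) = x" using h(3) by (auto simp: homeomorphism_def)
  assume W: "open W" "W \<subseteq> U"
  have "openin (top_of_set (\<phi> ` U)) (\<phi> ` W)"
    using W by (intro homeomorphism_imp_open_map[OF h(3)]) (metis openin_open_eq h(1))
  then show "open (\<phi> ` W)" using h(2) openin_open_eq by blast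
qed

lemma smooth_atlas_locally_compact:
  fixes \<A> :: "('m::metric_space, 'n::finite) chart set"
  assumes A: "smooth_atlas \<A>" shows "locally compact (UNIV :: 'm set)"
proof (rule locally_compact_UNIV_I)
  fix x :: 'm
  obtain U \<phi> where c: "(U, \<phi>) \<in> \<A>" "x \<in> U" using smooth_atlas_chart(1)[OF A] by blast
  note ch = smooth_atlas_chart(2-)[OF A c(1)]
  obtain e where e: "e > 0" "cball (\<phi> x) e \<subseteq> \<phi> ` U" using ch(5) c(2) open_contains_cball by blast
  have "open (U \<inter> \<phi> -` ball (\<phi> x) e)" using ch(1,2) by (intro continuous_open_preimage) auto
  moreover have "compact (inv_into U \<phi> ` cball (\<phi> x) e)"
    using continuous_on_subset[OF ch(6) e(2)] by (intro compact_continuous_image) auto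
  moreover have "U \<inter> \<phi> -` ball (\<phi> x) e \<subseteq> inv_into U \<phi> ` cball (\<phi> x) e"
  proof
    fix y assume "y \<in> U \<inter> \<phi> -` ball (\<phi> x) e"
    then have "y = inv_into U \<phi> (\<phi> y)" "\<phi> y \<in> cball (\<phi> x) e" using ch(3) by auto
    then show "y \<in> inv_into U \<phi> ` cball (\<phi> x) e" by blast
  qed
  ultimately show "\<exists>V K. open V \<and> x \<in> V \<and> V \<subseteq> K \<and> compact K" using e(1) c(2)
    by (intro exI[of _ "U \<inter> \<phi> -` ball (\<phi> x) e"] exI[of _ "inv_into U \<phi> ` cball (\<phi> x) e"]) auto
qed

text \<open>The chain rule for the representation of \<open>f\<close> in charts around \<open>\<gamma> t\<close> and its image. The interior of the unit
  interval is needed because the derivative is two-sided.\<close>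

lemma isometry_curve_derivative:
  assumes A: "smooth_atlas \<A>" and f: "isometry \<A> g f"
    and c: "(U, \<phi>) \<in> \<A>" "(V, \<psi>) \<in> \<A>" and cont: "continuous_on {0..1} \<gamma>"
    and t: "0 < t" "t < 1" "\<gamma> t \<in> U" "f (\<gamma> t) \<in> V" and d: "((\<phi> \<circ> \<gamma>) has_vector_derivative v) (at t)"
  shows "((\<psi> \<circ> (f \<circ> \<gamma>)) has_vector_derivative
           frechet_derivative (\<psi> \<circ> f \<circ> inv_into U \<phi>) (at (\<phi> (\<gamma> t))) v) (at t)"
proof -
  let ?h = "\<psi> \<circ> f \<circ> inv_into U \<phi>"
  have sm: "smooth_on (\<phi> ` (U \<inter> f -` V)) ?h" and fc: "continuous_on UNIV f" using f c by (auto simp: isometry_def smooth_map_def)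
  have opV: "open (U \<inter> f -` V)"
    using smooth_atlas_chart(2)[OF A] c open_vimage[of V f] fc by (auto simp: continuous_on_open_vimage)
  have "Ck_on (Suc 0) (\<phi> ` (U \<inter> f -` V)) ?h" using sm by (simp only: smooth_on_def)
  then have "?h differentiable (at (\<phi> (\<gamma> t)))" using t by auto
  then have "(?h has_derivative frechet_derivative ?h (at (\<phi> (\<gamma> t)))) (at (\<phi> (\<gamma> t)))"
    by (simp add: frechet_derivative_works)
  then have "((?h \<circ> (\<phi> \<circ> \<gamma>)) has_vector_derivative frechet_derivative ?h (at (\<phi> (\<gamma> t))) v) (at t)"
    using vector_derivative_diff_chain_within[OF d, of ?h "frechet_derivative ?h (at (\<phi> (\<gamma> t)))"]
    by (simp add: has_derivative_at_withinI)
  moreover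
  define N where "N = {0<..<1} \<inter> \<gamma> -` (U \<inter> f -` V)"
  have "continuous_on {0<..<1} \<gamma>" by (rule continuous_on_subset[OF cont]) auto
  then have "open N" unfolding N_def by (rule continuous_open_preimage[OF _ open_greaterThanLessThan opV])
  moreover have "t \<in> N" using t by (auto simp: N_def)
  moreover have "(?h \<circ> (\<phi> \<circ> \<gamma>)) s = (\<psi> \<circ> (f \<circ> \<gamma>)) s" if "s \<in> N" for s
    using smooth_atlas_chart(4)[OF A c(1), of "\<gamma> s"] that by (simp add: N_def)
  ultimately show ?thesis by (rule has_vector_derivative_transform_within_open)
qed

text \<open>The derivative of the isometry maps the velocity of a curve to that of its image, in whatever charts
  the two speeds are computed. The end points join the exceptional set: a two-sided derivative there
  depends on values of the curve outside of the unit interval.\<close>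

lemma isometry_image_curve:
  assumes A: "smooth_atlas \<A>" and f: "isometry \<A> g f" and \<gamma>: "piecewise_C1_curve \<A> \<gamma>"
  shows "piecewise_C1_curve \<A> (f \<circ> \<gamma>)" "curve_length \<A> g (f \<circ> \<gamma>) = curve_length \<A> g \<gamma>"
proof -
  have cont: "continuous_on {0..1} \<gamma>" using \<gamma> by (simp add: piecewise_C1_curve_def)
  obtain S where S: "finite S" "\<And>U \<phi>. (U, \<phi>) \<in> \<A> \<Longrightarrow> (\<phi> \<circ> \<gamma>) C1_differentiable_on ({t\<in>{0..1}. \<gamma> t \<in> U} - S)"
    using \<gamma> by (auto simp: piecewise_C1_curve_def)
  have fc: "continuous_on UNIV f" using f by (simp add: isometry_def smooth_map_def)
  have cf: "continuous_on {0..1} (f \<circ> \<gamma>)" using cont fc by (intro continuous_on_compose) (auto intro: continuous_on_subset)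
  define S' where "S' = S \<union> {0, 1}"
  have S': "finite S'" using S(1) by (simp add: S'_def)
  have "(\<psi> \<circ> (f \<circ> \<gamma>)) C1_differentiable_on ({t\<in>{0..1}. (f \<circ> \<gamma>) t \<in> V} - S')" if V: "(V, \<psi>) \<in> \<A>" for V \<psi>
  proof -
    define T where "T = {t\<in>{0..1}. (f \<circ> \<gamma>) t \<in> V} - S'"
    define D where "D t = vector_derivative (\<psi> \<circ> (f \<circ> \<gamma>)) (at t)" for t
    have loc: "((\<psi> \<circ> (f \<circ> \<gamma>)) has_vector_derivative D t) (at t) \<and> isCont D t" if t: "t \<in> T" for t
    proof -
      obtain U \<phi> where U: "(U, \<phi>) \<in> \<A>" "\<gamma> t \<in> U" using smooth_atlas_chart(1)[OF A] by blast
      obtain E where E: "\<And>s. s \<in> {t\<in>{0..1}. \<gamma> t \<in> U} - S \<Longrightarrow> ((\<phi> \<circ> \<gamma>) has_vector_derivative E s) (at s)"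
        "continuous_on ({t\<in>{0..1}. \<gamma> t \<in> U} - S) E" using S(2)[OF U(1)] unfolding C1_differentiable_on_def by blast
      let ?h = "\<psi> \<circ> f \<circ> inv_into U \<phi>"
      let ?W = "\<phi> ` (U \<inter> f -` V)"
      have opV: "open (U \<inter> f -` V)"
        using smooth_atlas_chart(2)[OF A] U(1) V open_vimage[of V f] fc by (auto simp: continuous_on_open_vimage)
      define N where "N = ({0<..<1} \<inter> \<gamma> -` (U \<inter> f -` V)) - S"
      have "continuous_on {0<..<1} \<gamma>" by (rule continuous_on_subset[OF cont]) auto
      then have opN: "open N" unfolding N_def
        by (intro open_Diff finite_imp_closed S(1)) (rule continuous_open_preimage[OF _ open_greaterThanLessThan opV])
      have tN: "t \<in> N" using t U by (auto simp: N_def T_def S'_def)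
      have der: "((\<psi> \<circ> (f \<circ> \<gamma>)) has_vector_derivative frechet_derivative ?h (at (\<phi> (\<gamma> s))) (E s)) (at s)" if "s \<in> N" for s
        using that by (intro isometry_curve_derivative[OF A f U(1) V cont] E) (auto simp: N_def)
      have Deq: "D s = frechet_derivative ?h (at (\<phi> (\<gamma> s))) (E s)" if "s \<in> N" for s
        unfolding D_def by (rule vector_derivative_at[OF der[OF that]])
      have "smooth_on ?W ?h" using f U(1) V by (auto simp: isometry_def smooth_map_def)
      then have C1: "Ck_on (Suc 0) ?W ?h" by (simp only: smooth_on_def)
      have exp: "frechet_derivative ?h (at (\<phi> (\<gamma> s))) (E s)
          = (\<Sum>b\<in>Basis. (E s \<bullet> b) *\<^sub>R frechet_derivative ?h (at (\<phi> (\<gamma> s))) b)" if "s \<in> N" for s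
      proof -
        have "?h differentiable (at (\<phi> (\<gamma> s)))" using C1 that by (auto simp: N_def)
        then have lin: "linear (frechet_derivative ?h (at (\<phi> (\<gamma> s))))" by (rule linear_frechet_derivative)
        have "frechet_derivative ?h (at (\<phi> (\<gamma> s))) (\<Sum>b\<in>Basis. (E s \<bullet> b) *\<^sub>R b)
          = (\<Sum>b\<in>Basis. (E s \<bullet> b) *\<^sub>R frechet_derivative ?h (at (\<phi> (\<gamma> s))) b)"
          by (simp add: linear_sum[OF lin] linear_cmul[OF lin])
        then show ?thesis by (simp add: euclidean_representation)
      qed
      have c1: "continuous_on N (\<lambda>s. frechet_derivative ?h (at (\<phi> (\<gamma> s))) b)" for b
      proof (rule continuous_on_compose2[of ?W "\<lambda>y. frechet_derivative ?h (at y) b"])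
        show "continuous_on ?W (\<lambda>y. frechet_derivative ?h (at y) b)" using C1 by simp
        show "continuous_on N (\<lambda>s. \<phi> (\<gamma> s))"
          by (rule continuous_on_compose2[OF smooth_atlas_chart(3)[OF A U(1)]])
            (auto simp: N_def intro: continuous_on_subset[OF cont])
      qed (auto simp: N_def)
      have c2: "continuous_on N E" by (rule continuous_on_subset[OF E(2)]) (auto simp: N_def)
      have "continuous_on N (\<lambda>s. \<Sum>b\<in>Basis. (E s \<bullet> b) *\<^sub>R frechet_derivative ?h (at (\<phi> (\<gamma> s))) b)"
        by (intro continuous_intros c1 c2)
      then have "continuous_on N D" by (rule continuous_on_eq) (simp add: Deq exp)
      then have "isCont D t" using opN tN continuous_on_eq_continuous_at by blast
      then show ?thesis using der[OF tN] Deq[OF tN] by simp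
    qed
    then show ?thesis unfolding C1_differentiable_on_def T_def[symmetric]
      by (intro exI[of _ D]) (auto intro: continuous_at_imp_continuous_on)
  qed
  then show "piecewise_C1_curve \<A> (f \<circ> \<gamma>)" unfolding piecewise_C1_curve_def using cf S' by blast
  have sp: "speed \<A> g (f \<circ> \<gamma>) t = speed \<A> g \<gamma> t" if t: "t \<in> {0..1}" "t \<notin> S'" for t
  proof -
    define cU where "cU = (SOME c. c \<in> \<A> \<and> \<gamma> t \<in> fst c)"
    define cV where "cV = (SOME c. c \<in> \<A> \<and> (f \<circ> \<gamma>) t \<in> fst c)"
    obtain U \<phi> V \<psi> where UV: "cU = (U, \<phi>)" "cV = (V, \<psi>)" by (cases cU, cases cV)
    have "\<exists>c. c \<in> \<A> \<and> y \<in> fst c" for y using smooth_atlas_chart(1)[OF A, of y] by force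
    note ex = this
    have U: "(U, \<phi>) \<in> \<A>" "\<gamma> t \<in> U" and V: "(V, \<psi>) \<in> \<A>" "f (\<gamma> t) \<in> V"
    proof -
      have "cU \<in> \<A> \<and> \<gamma> t \<in> fst cU" "cV \<in> \<A> \<and> (f \<circ> \<gamma>) t \<in> fst cV"
        unfolding cU_def cV_def by (rule someI_ex, rule ex)+
      then show "(U, \<phi>) \<in> \<A>" "\<gamma> t \<in> U" "(V, \<psi>) \<in> \<A>" "f (\<gamma> t) \<in> V" using UV by auto
    qed
    obtain v where v: "((\<phi> \<circ> \<gamma>) has_vector_derivative v) (at t)"
      using S(2)[OF U(1)] t U(2) unfolding C1_differentiable_on_def S'_def by blast
    have t01: "0 < t" "t < 1" using t by (auto simp: S'_def less_eq_real_def)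
    have v': "((\<psi> \<circ> (f \<circ> \<gamma>)) has_vector_derivative frechet_derivative (\<psi> \<circ> f \<circ> inv_into U \<phi>) (at (\<phi> (\<gamma> t))) v) (at t)"
      by (rule isometry_curve_derivative[OF A f U(1) V(1) cont t01 U(2) V(2) v])
    have "\<gamma> t \<in> U \<inter> f -` V" using U V by simp
    then have "g (V, \<psi>) (f (\<gamma> t)) (frechet_derivative (\<psi> \<circ> f \<circ> inv_into U \<phi>) (at (\<phi> (\<gamma> t))) v)
        (frechet_derivative (\<psi> \<circ> f \<circ> inv_into U \<phi>) (at (\<phi> (\<gamma> t))) v) = g (U, \<phi>) (\<gamma> t) v v"
      using f U(1) V(1) unfolding isometry_def Let_def by fast
    then show ?thesis
      unfolding speed_def cU_def[symmetric] cV_def[symmetric] UV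
      by (simp add: vector_derivative_at[OF v] vector_derivative_at[OF v'])
  qed
  have "AE t in lborel. t \<notin> S'" using finite_imp_null_set_lborel[OF S'] by (rule AE_not_in)
  then show "curve_length \<A> g (f \<circ> \<gamma>) = curve_length \<A> g \<gamma>"
    unfolding curve_length_def
    by (intro nn_integral_cong_AE) (auto elim!: eventually_mono simp: sp indicator_def)
qed

lemma isometry_dist:
  assumes M: "riemannian_manifold \<A> g" and f: "isometry \<A> g f" and fi: "isometry \<A> g (inv f)"
  shows "dist (f x) (f y) = dist x y"
proof -
  have A: "smooth_atlas \<A>" and D: "\<And>x y. ennreal (dist x y) = riemannian_distance \<A> g x y"
    using M by (auto simp: riemannian_manifold_def)
  have le: "dist (k x) (k y) \<le> dist x y" if k: "isometry \<A> g k" for k x y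
  proof -
    have "riemannian_distance \<A> g (k x) (k y) \<le> riemannian_distance \<A> g x y"
      unfolding riemannian_distance_def
    proof (rule INF_mono)
      fix \<gamma> assume "\<gamma> \<in> {\<gamma>. piecewise_C1_curve \<A> \<gamma> \<and> \<gamma> 0 = x \<and> \<gamma> 1 = y}"
      then show "\<exists>\<gamma>'\<in>{\<gamma>. piecewise_C1_curve \<A> \<gamma> \<and> \<gamma> 0 = k x \<and> \<gamma> 1 = k y}. curve_length \<A> g \<gamma>' \<le> curve_length \<A> g \<gamma>"
        using isometry_image_curve[OF A k, of \<gamma>] by (intro bexI[of _ "k \<circ> \<gamma>"]) auto
    qed
    then show ?thesis by (simp add: D[symmetric])
  qed
  have "inv f (f z) = z" for z using f by (simp add: isometry_def bij_is_inj)
  then show ?thesis using le[OF f, of x y] le[OF fi, of "f x" "f y"] by simp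
qed

section \<open>Uniqueness of the optimal semicoupling\<close>

context transport_flow begin

lemma translate_region:
  assumes F: "fundamental_region G F" and f: "f \<in> G" shows "fundamental_region G (f ` F)"
  unfolding fundamental_region_def
proof (intro conjI ballI impI)
  show "f ` F \<in> sets borel"
    unfolding image_eq_vimage_inv[OF f] using F by (intro vimage_borel G_measurable G_inv f) (simp add: fundamental_region_def)
  have "y \<in> (\<Union>k\<in>G. k ` f ` F)" for y
  proof -
    have "y \<in> (\<Union>k\<in>G. k ` F)" using F by (simp add: fundamental_region_def)
    then obtain k x where k: "k \<in> G" "x \<in> F" "y = k x" by blast
    then have "y = (k \<circ> inv f) (f x)" using f by simp
    then show ?thesis using k f G_comp G_inv by blast
  qed
  then show "(\<Union>k\<in>G. k ` f ` F) = UNIV" by blast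
  fix k assume k: "k \<in> G" "k \<noteq> id"
  show "f ` F \<inter> k ` f ` F = {}"
  proof (rule ccontr)
    assume "f ` F \<inter> k ` f ` F \<noteq> {}"
    then obtain x y where xy: "x \<in> F" "y \<in> F" "f x = k (f y)" by blast
    have "inv (k \<circ> f) (f x) = y"
      using o_inv_distrib[OF G_bij[OF k(1)] G_bij[OF f]] f k(1) unfolding xy(3) by simp
    then have "inv (k \<circ> f) (f x) \<in> F" using xy(2) by simp
    moreover have "inv f (f x) \<in> F" using xy(1) inv_apply(2)[OF f, of x] by (simp only:)
    ultimately have "f = k \<circ> f"
      by (intro moved_disjoint[OF fundamental_moved[OF F] f G_comp[OF k(1) f]])
    then have "k (f (inv f z)) = f (inv f z)" for z by (metis comp_apply)
    then have "k z = z" for z using f by simp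
    then show False using k(2) by auto
  qed
qed

text \<open>The cost is additive over the disjoint translates, and each of them is a fundamental region.\<close>

lemma region_cost_union:
  assumes q: "borel_kernel P q" "invariant diag q" and F: "fundamental_region G F" and I: "I \<subseteq> G" "finite I"
  shows "region_cost q (\<Union>f\<in>I. f ` F) = of_nat (card I) * region_cost q B\<^sub>0"
proof -
  have ind: "indicator (UNIV \<times> (\<Union>f\<in>I. f ` F)) z = (\<Sum>f\<in>I. indicator (UNIV \<times> f ` F) z :: ennreal)" for z :: "'m \<times> 'm"
  proof -
    have "f = k" if "f \<in> I" "k \<in> I" "x \<in> f ` F" "x \<in> k ` F" for f k x
    proof -
      have "f \<in> G" "k \<in> G" using I(1) that by auto
      moreover from this have "inv f x \<in> F" "inv k x \<in> F" using that(3,4) by (simp_all add: image_eq_vimage_inv)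
      ultimately show ?thesis by (rule moved_disjoint[OF fundamental_moved[OF F]])
    qed
    then have "disjoint_family_on (\<lambda>f. (UNIV :: 'm set) \<times> f ` F) I"
      unfolding disjoint_family_on_def by blast
    then have "indicator (\<Union>f\<in>I. UNIV \<times> f ` F) z = (\<Sum>f\<in>I. indicator (UNIV \<times> f ` F) z :: ennreal)"
      by (rule indicator_UN_disjoint[OF I(2)])
    moreover have "UNIV \<times> (\<Union>f\<in>I. f ` F) = (\<Union>f\<in>I. (UNIV :: 'm set) \<times> f ` F)" by auto
    ultimately show ?thesis by (simp only:)
  qed
  have mF: "UNIV \<times> f ` F \<in> sets (borel :: ('m \<times> 'm) measure)" if "f \<in> I" for f
    using translate_region[OF F] I(1) that by (intro region_measurable) auto
  have mc: "(\<lambda>z. cost \<rho> z * indicator (UNIV \<times> f ` F) z) \<in> borel_measurable borel" if "f \<in> I" for f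
    using mF[OF that] by measurable
  have sq: "sets (q \<omega>) = sets borel" for \<omega> using kernel_sets[OF q(1)] by (simp add: space_P)
  have "region_cost q (\<Union>f\<in>I. f ` F) = (\<integral>\<^sup>+\<omega>. (\<Sum>f\<in>I. \<integral>\<^sup>+z\<in>UNIV \<times> f ` F. cost \<rho> z \<partial>q \<omega>) \<partial>P)"
    unfolding region_cost_def ind sum_distrib_left using mc sq
    by (intro nn_integral_cong nn_integral_sum) (simp cong: measurable_cong_sets)
  also have "\<dots> = (\<Sum>f\<in>I. region_cost q (f ` F))"
    unfolding region_cost_def by (intro nn_integral_sum kernel_nn_integral[OF q(1)] mc)
  also have "\<dots> = (\<Sum>f\<in>I. region_cost q B\<^sub>0)"
    using translate_region[OF F] I(1) by (intro sum.cong refl region_cost_independent[OF q region]) auto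
  finally show ?thesis by simp
qed

text \<open>Numerators in the definition of the mean cost are multiples of the cost of one region, with
  multiplicities that do not depend on the semicoupling. The factor is the supremum of the ratios of
  multiplicity and volume, and may a priori be infinite.\<close>

lemma mean_cost_factor:
  assumes m: "emeasure m B\<^sub>0 = 1"
  shows "\<exists>c\<ge>1. \<forall>q\<in>semicouplings. mean_cost G m \<rho> P q = region_cost q B\<^sub>0 * c"
proof -
  have "\<forall>B\<in>admissible_sets G. \<exists>n\<ge>1. \<forall>q\<in>semicouplings. region_cost q B = of_nat n * region_cost q B\<^sub>0"
  proof
    fix B assume "B \<in> admissible_sets G"
    then obtain I F where I: "I \<subseteq> G" "finite I" "I \<noteq> {}" "fundamental_region G F" "B = (\<Union>f\<in>I. f ` F)"
      by (auto simp: admissible_sets_def)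
    then have "1 \<le> card I" by (simp add: Suc_le_eq card_gt_0_iff)
    moreover have "region_cost q B = of_nat (card I) * region_cost q B\<^sub>0" if "q \<in> semicouplings" for q
      unfolding I(5) by (intro region_cost_union semicouplingsD(2,3)[OF that] I)
    ultimately show "\<exists>n\<ge>1. \<forall>q\<in>semicouplings. region_cost q B = of_nat n * region_cost q B\<^sub>0" by blast
  qed
  then obtain n where n: "\<And>B. B \<in> admissible_sets G \<Longrightarrow> (1::nat) \<le> n B"
    "\<And>B q. B \<in> admissible_sets G \<Longrightarrow> q \<in> semicouplings \<Longrightarrow> region_cost q B = of_nat (n B) * region_cost q B\<^sub>0" by metis
  have B0: "B\<^sub>0 \<in> admissible_sets G"
    unfolding admissible_sets_def using region G_id by (intro CollectI exI[of _ "{id}"] exI[of _ "B\<^sub>0"]) auto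
  define c where "c = (SUP B\<in>admissible_sets G. of_nat (n B) / emeasure m B)"
  have "(of_nat 1 :: ennreal) \<le> of_nat (n B\<^sub>0)" using n(1)[OF B0] by (rule of_nat_mono)
  then have "1 \<le> of_nat (n B\<^sub>0) / emeasure m B\<^sub>0" by (simp add: m divide_ennreal_def)
  also have "\<dots> \<le> c" unfolding c_def by (intro SUP_upper B0)
  finally have "1 \<le> c" .
  moreover have "mean_cost G m \<rho> P q = region_cost q B\<^sub>0 * c" if q: "q \<in> semicouplings" for q
  proof -
    have "mean_cost G m \<rho> P q = (SUP B\<in>admissible_sets G. region_cost q B / emeasure m B)"
      unfolding mean_cost_def region_cost_def ..
    also have "\<dots> = (SUP B\<in>admissible_sets G. region_cost q B\<^sub>0 * (of_nat (n B) / emeasure m B))"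
      using n(2)[OF _ q] by (intro SUP_cong refl) (simp add: ennreal_times_divide mult.commute)
    also have "\<dots> = region_cost q B\<^sub>0 * c" unfolding c_def by (rule SUP_mult_left_ennreal[symmetric])
    finally show ?thesis .
  qed
  ultimately show ?thesis by blast
qed

text \<open>If the common factor is infinite, then finite mean cost means that the cost of one region is 0.\<close>

lemma optimal_minimal:
  assumes m: "emeasure m B\<^sub>0 = 1" and fin: "optimal_mean_cost G m \<rho> P \<theta> lam mu < \<infinity>"
    and q: "optimal_semicoupling G m \<rho> P \<theta> lam mu q"
  shows "minimal q"
proof -
  obtain c where c: "1 \<le> c" "\<And>q. q \<in> semicouplings \<Longrightarrow> mean_cost G m \<rho> P q = region_cost q B\<^sub>0 * c"
    using mean_cost_factor[OF m] by blast
  have qS: "q \<in> semicouplings" and opt: "mean_cost G m \<rho> P q = optimal_mean_cost G m \<rho> P \<theta> lam mu"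
    using q by (auto simp: optimal_semicoupling_def)
  have fc: "region_cost q B\<^sub>0 * c < \<infinity>" using fin opt c(2)[OF qS] by simp
  have "region_cost q B\<^sub>0 * 1 \<le> region_cost q B\<^sub>0 * c" using c(1) by (intro mult_left_mono) auto
  then have "region_cost q B\<^sub>0 < \<infinity>" using fc by (auto intro: le_less_trans)
  moreover have "region_cost q B\<^sub>0 \<le> region_cost q' B\<^sub>0" if q': "q' \<in> semicouplings" for q'
  proof (cases "c = top")
    case True
    then have "region_cost q B\<^sub>0 = 0" using fc by (auto simp: ennreal_mult_less_top)
    then show ?thesis by simp
  next
    case False
    have "region_cost q B\<^sub>0 * c \<le> region_cost q' B\<^sub>0 * c"
      using opt INF_lower[OF q', of "mean_cost G m \<rho> P"] c(2)[OF qS] c(2)[OF q'] by (simp add: optimal_mean_cost_def)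
    then have "region_cost q B\<^sub>0 * c / c \<le> region_cost q' B\<^sub>0 * c / c" by (rule divide_right_mono_ennreal)
    moreover have "c \<noteq> 0" using c(1) by auto
    ultimately show ?thesis using False by (simp add: mult_divide_eq_ennreal)
  qed
  ultimately show ?thesis using qS by (simp add: minimal_def)
qed

text \<open>The constraints are convex, and the cost is affine.\<close>

lemma average_minimal:
  assumes q: "minimal q1" "minimal q2"
  shows "minimal (\<lambda>\<omega>. average (q1 \<omega>) (q2 \<omega>))"
proof -
  have S: "q1 \<in> semicouplings" "q2 \<in> semicouplings" using q by (auto simp: minimal_def)
  note D1 = semicouplingsD[OF S(1)] and D2 = semicouplingsD[OF S(2)]
  let ?q = "\<lambda>\<omega>. average (q1 \<omega>) (q2 \<omega>)"
  have e: "emeasure (?q \<omega>) Z = 1/2 * (emeasure (q1 \<omega>) Z + emeasure (q2 \<omega>) Z)" if "Z \<in> sets borel" for \<omega> Z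
    using that D1(4) D2(4) by (simp add: average_def emeasure_add_measure)
  have k: "borel_kernel P ?q" unfolding average_def by (intro kernel_scale kernel_add_measure D1(2) D2(2)) simp
  have "?q \<in> semicouplings"
  proof (rule semicouplingsI[OF k])
    show "invariant diag ?q"
      unfolding invariant_def[OF action_diag]
    proof (intro ballI allI measure_eqI)
      fix f \<omega> Z assume f: "f \<in> G" and "Z \<in> sets (?q (\<theta> f \<omega>))"
      then have Z: "Z \<in> sets borel" by (simp add: average_def)
      have m: "diag f \<in> borel_measurable borel" using f by (rule action_measurable[OF action_diag])
      have "q1 (\<theta> f \<omega>) = distr (q1 \<omega>) borel (diag f)" "q2 (\<theta> f \<omega>) = distr (q2 \<omega>) borel (diag f)"
        using D1(3) D2(3) f by (auto simp: invariant_def[OF action_diag])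
      then have "emeasure (?q (\<theta> f \<omega>)) Z = 1/2 * (emeasure (q1 \<omega>) (diag f -` Z) + emeasure (q2 \<omega>) (diag f -` Z))"
        unfolding e[OF Z] by (simp only: emeasure_distr_borel[OF D1(4) m Z] emeasure_distr_borel[OF D2(4) m Z])
      also have "\<dots> = emeasure (?q \<omega>) (diag f -` Z)" by (rule e[OF vimage_borel[OF m Z], symmetric])
      also have "\<dots> = emeasure (distr (?q \<omega>) borel (diag f)) Z"
        by (intro emeasure_distr_borel[symmetric] m Z) (simp add: average_def)
      finally show "emeasure (?q (\<theta> f \<omega>)) Z = emeasure (distr (?q \<omega>) borel (diag f)) Z" .
    qed (simp add: average_def)
    fix \<omega> and K :: "('m \<times> 'm) set" assume K: "compact K"
    let ?t = "emeasure (q1 \<omega>) K + emeasure (q2 \<omega>) K"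
    have "emeasure (?q \<omega>) K \<le> 1/2 * (?t + ?t)" unfolding e[OF borel_compact[OF K]] by (intro mult_left_mono) auto
    then show "emeasure (?q \<omega>) K < \<infinity>"
      using radon_measure_finite[OF D1(1) K, of \<omega>] radon_measure_finite[OF D2(1) K, of \<omega>]
      unfolding half_double by (auto intro: le_less_trans)
  next
    show "AE \<omega> in P. \<forall>Z\<in>sets borel. emeasure (?q \<omega>) (Z \<times> UNIV) \<le> emeasure (lam \<omega>) Z"
      using D1(5) D2(5)
    proof eventually_elim
      case (elim \<omega>)
      have "emeasure (?q \<omega>) (Z \<times> UNIV) \<le> 1/2 * (emeasure (lam \<omega>) Z + emeasure (lam \<omega>) Z)" if "Z \<in> sets borel" for Z
        using that elim by (subst e) (auto intro!: rectangle_borel mult_left_mono add_mono)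
      then show ?case by (simp add: half_double)
    qed
    show "AE \<omega> in P. \<forall>Z\<in>sets borel. emeasure (?q \<omega>) (UNIV \<times> Z) = emeasure (mu \<omega>) Z"
      using D1(6) D2(6)
    proof eventually_elim
      case (elim \<omega>)
      have "emeasure (?q \<omega>) (UNIV \<times> Z) = 1/2 * (emeasure (mu \<omega>) Z + emeasure (mu \<omega>) Z)" if "Z \<in> sets borel" for Z
        using that elim by (subst e) (auto intro!: rectangle_borel)
      then show ?case by (simp add: half_double)
    qed
  qed
  moreover have "region_cost ?q B\<^sub>0 = region_cost q1 B\<^sub>0"
  proof -
    let ?c = "\<lambda>z. cost \<rho> z * indicator (UNIV \<times> B\<^sub>0) z"
    have c: "?c \<in> borel_measurable borel" using region_measurable[OF region] by measurable
    have "(\<integral>\<^sup>+z. ?c z \<partial>?q \<omega>) = 1/2 * ((\<integral>\<^sup>+z. ?c z \<partial>q1 \<omega>) + (\<integral>\<^sup>+z. ?c z \<partial>q2 \<omega>))" for \<omega>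
      unfolding average_def using c D1(4) D2(4)
      by (subst nn_integral_scale_measure) (auto simp: nn_integral_add_measure cong: measurable_cong_sets)
    then have "region_cost ?q B\<^sub>0 = (\<integral>\<^sup>+\<omega>. 1/2 * ((\<integral>\<^sup>+z. ?c z \<partial>q1 \<omega>) + (\<integral>\<^sup>+z. ?c z \<partial>q2 \<omega>)) \<partial>P)"
      by (simp add: region_cost_def)
    also have "\<dots> = 1/2 * (region_cost q1 B\<^sub>0 + region_cost q2 B\<^sub>0)"
      unfolding region_cost_def using kernel_nn_integral[OF D1(2) c] kernel_nn_integral[OF D2(2) c]
      by (simp add: nn_integral_cmult nn_integral_add)
    also have "region_cost q2 B\<^sub>0 = region_cost q1 B\<^sub>0" using q S by (auto simp: minimal_def intro: antisym)
    finally show ?thesis by (simp add: half_double)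
  qed
  ultimately show ?thesis using q(1) by (simp add: minimal_def)
qed

end

theorem theorem4p11:
  fixes \<A> :: "('m::{metric_space, second_countable_topology}, 'n::finite) chart set"
    and g :: "('m, 'n) metric_tensor"
    and vol m :: "'m measure" and \<kappa> :: real
    and G :: "('m \<Rightarrow> 'm) set" and p :: 'm and B\<^sub>0 :: "'m set"
    and P :: "('w::metric_space) measure" and \<theta> :: "('m \<Rightarrow> 'm) \<Rightarrow> 'w \<Rightarrow> 'w"
    and \<rho> :: "real \<Rightarrow> real"
    and lam mu :: "'w \<Rightarrow> 'm measure" and \<beta> :: real
  assumes manifold: "riemannian_manifold \<A> g"
    and complete: "complete (UNIV :: 'm set)"
    and connected: "connected (UNIV :: 'm set)"
    and noncompact: "\<not> compact (UNIV :: 'm set)"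
    and group: "isometry_group \<A> g G"
    and action: "properly_discontinuous G" "cocompact G" "acts_freely G"
    and region: "dirichlet_fundamental_region G p B\<^sub>0"
    and volume: "riemannian_volume \<A> g vol" "0 < \<kappa>" "m = scale_measure (ennreal \<kappa>) vol"
      "emeasure m B\<^sub>0 = 1"
    and Omega: "compact (UNIV :: 'w set)" "prob_space P"
      "\<exists>Q. sets Q = sets borel \<and> P = completion Q"
    and flow: "measurable_flow P G \<theta>" "stationary P G \<theta>"
    and scale: "continuous_on {0..} \<rho>" "strict_mono_on {0..} \<rho>" "\<rho> 0 = 0"
      "filterlim \<rho> at_top at_top"
    and transport: "unique_optimal_transport \<rho> m"
    and random: "random_measure P lam" "random_measure P mu"
    and nonzero: "AE \<omega> in P. lam \<omega> \<noteq> null_measure borel" "AE \<omega> in P. mu \<omega> \<noteq> null_measure borel"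
    and equivariant: "equivariant G \<theta> lam" "equivariant G \<theta> mu"
    and beta: "0 < \<beta>" "\<beta> \<le> 1"
    and intensities: "intensity P B\<^sub>0 lam = 1" "intensity P B\<^sub>0 mu = ennreal \<beta>"
    and abs_cont: "AE \<omega> in P. absolutely_continuous m (lam \<omega>)"
    and finite_cost: "optimal_mean_cost G m \<rho> P \<theta> lam mu < \<infinity>"
  shows "\<forall>q\<^sub>1 q\<^sub>2. optimal_semicoupling G m \<rho> P \<theta> lam mu q\<^sub>1 \<and>
           optimal_semicoupling G m \<rho> P \<theta> lam mu q\<^sub>2 \<longrightarrow> (AE \<omega> in P. q\<^sub>1 \<omega> = q\<^sub>2 \<omega>)"
proof (intro allI impI)
  fix q\<^sub>1 q\<^sub>2
  assume opt: "optimal_semicoupling G m \<rho> P \<theta> lam mu q\<^sub>1 \<and> optimal_semicoupling G m \<rho> P \<theta> lam mu q\<^sub>2"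
  have atlas: "smooth_atlas \<A>" using manifold by (simp add: riemannian_manifold_def)
  have lc: "locally compact (UNIV :: 'm set)" by (rule smooth_atlas_locally_compact[OF atlas])
  have space_P: "space P = UNIV"
  proof -
    obtain Q where Q: "sets Q = sets (borel :: 'w measure)" "P = completion Q" using Omega(3) by blast
    show ?thesis using sets_eq_imp_space_eq[OF Q(1)] Q(2) by simp
  qed
  have iso: "isometry \<A> g f" if "f \<in> G" for f using group that by (simp add: isometry_group_def)
  have inv_G: "inv f \<in> G" if "f \<in> G" for f using group that by (simp add: isometry_group_def)
  have \<rho>_nonneg: "0 \<le> \<rho> r" if "0 \<le> r" for r
    using strict_mono_on_leD[OF scale(2), of 0 r] that scale(3) by simp
  interpret prob_space P by (rule Omega(2))
  interpret transport_flow G P \<theta> \<rho> lam mu B\<^sub>0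
  proof
    show "locally compact (UNIV :: 'm set)" by (rule lc)
    show "space P = UNIV" by (rule space_P)
    show "id \<in> G" using group by (simp add: isometry_group_def)
    show "f \<circ> k \<in> G" if "f \<in> G" "k \<in> G" for f k using group that by (simp add: isometry_group_def)
    show "inv f \<in> G" if "f \<in> G" for f by (rule inv_G[OF that])
    show "bij f" if "f \<in> G" for f using iso[OF that] by (simp add: isometry_def)
    show "dist (f x) (f y) = dist x y" if "f \<in> G" for f x y
      by (rule isometry_dist[OF manifold iso[OF that] iso[OF inv_G[OF that]]])
    show "finite {f \<in> G. f x \<in> K}" if "compact K" for K x using action(1) that by (simp add: properly_discontinuous_def)
    show "f = id" if "f \<in> G" "f x = x" for f x using action(3) that by (auto simp: acts_freely_def)
    show "\<theta> f \<in> P \<rightarrow>\<^sub>M P" if "f \<in> G" for f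
    proof -
      have "(\<lambda>\<omega>. (\<omega>, f)) \<in> P \<rightarrow>\<^sub>M P \<Otimes>\<^sub>M count_space G" using that by (intro measurable_Pair) auto
      moreover have "(\<lambda>(\<omega>, f). \<theta> f \<omega>) \<in> P \<Otimes>\<^sub>M count_space G \<rightarrow>\<^sub>M P"
        using flow(1) by (simp only: measurable_flow_def)
      ultimately have "(\<lambda>\<omega>. (\<lambda>(\<omega>, f). \<theta> f \<omega>) (\<omega>, f)) \<in> P \<rightarrow>\<^sub>M P" by (rule measurable_compose)
      then show ?thesis by simp
    qed
    show "distr P P (\<theta> f) = P" if "f \<in> G" for f using flow(2) that by (simp add: stationary_def)
    show "\<theta> id \<omega> = \<omega>" for \<omega> using flow(1) by (simp add: measurable_flow_def)
    show "\<theta> f (\<theta> k \<omega>) = \<theta> (f \<circ> k) \<omega>" if "f \<in> G" "k \<in> G" for f k \<omega>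
      using flow(1) that unfolding measurable_flow_def by (metis comp_apply)
    show "continuous_on {0..} \<rho>" by (rule scale)
    show "0 \<le> \<rho> r" if "0 \<le> r" for r by (rule \<rho>_nonneg[OF that])
    show "random_measure P lam" "random_measure P mu" "equivariant G \<theta> lam" by (rule random equivariant)+
    show "fundamental_region G B\<^sub>0" using region by (simp add: dirichlet_fundamental_region_def)
  qed
  interpret U: unique_transport \<rho> m
    by unfold_locales (use lc scale transport in auto)
  have min: "minimal q\<^sub>1" "minimal q\<^sub>2" using optimal_minimal[OF volume(4) finite_cost] opt by auto
  then have S: "q\<^sub>1 \<in> semicouplings" "q\<^sub>2 \<in> semicouplings" by (auto simp: minimal_def)
  note D1 = semicouplingsD[OF S(1)] and D2 = semicouplingsD[OF S(2)]
  have avg: "minimal (\<lambda>\<omega>. average (q\<^sub>1 \<omega>) (q\<^sub>2 \<omega>))" by (rule average_minimal[OF min])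
  have sm: "sets m = sets borel" using volume by (simp add: riemannian_volume_def)
  have rmu: "mu \<omega> \<in> radon_measures" for \<omega> using random_measure_radon[OF random(2)] space_P by simp
  show "AE \<omega> in P. q\<^sub>1 \<omega> = q\<^sub>2 \<omega>"
    using D1(5,6) D2(5,6) minimal_cyclically_monotone[OF avg] minimal_unused_farther[OF avg] abs_cont
  proof eventually_elim
    case (elim \<omega>)
    show ?case
      by (rule U.semicoupling_unique[where \<nu>="lam \<omega>" and \<mu>="mu \<omega>"])
        (use elim D1(1) D2(1) lam_radon sm radon_measure_finite[OF rmu] in auto)
  qed
qed

end
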